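(* Let $d\in\mathbb{N}$, $\alpha>0$, $p\in(1,d/\alpha]$ and $L>0$ be given. Then there exists a constant $C>0$ such that for all $T\colon\mathbb{R}^d\to\mathbb{R}^d$ which are Lipschitz continuous with constant $L$ and for all $\mu\in\mathcal{M}^+(\mathbb{R}^d)$, we have $$\|\mu\|_{L^{\alpha,p}(\mathbb{R}^d)^*}\le C\,\|T_\#\mu\|_{L^{\alpha,p}(\mathbb{R}^d)^*}.$$
   Context: With the Fourier transform $(\mathcal{F}f)(\xi)=\int_{\mathbb{R}^d}f(x)e^{-i\xi\cdot x}\,dx$, the Bessel kernel $g_\alpha\in L^1(\mathbb{R}^d)$, $\alpha>0$, is the function with $(\mathcal{F}g_\alpha)(\xi)=(1+|\xi|^2)^{-\alpha/2}$. For $\alpha>0$, $p\in(1,\infty)$, the (real) Bessel potential space is $L^{\alpha,p}(\mathbb{R}^d)=\{g_\alpha*f:f\in L^p(\mathbb{R}^d)\}$ with norm $\|g_\alpha*f\|_{L^{\alpha,p}(\mathbb{R}^d)}=\|f\|_{L^p(\mathbb{R}^d)}$; the star denotes the topological dual. $C_c^\infty(\mathbb{R}^d)$ is dense in $L^{\alpha,p}(\mathbb{R}^d)$. $\mathcal{M}^+(\mathbb{R}^d)$ is the set of all (nonnegative) Radon measures on $\mathbb{R}^d$, i.e. $\sigma$-additive $[0,\infty]$-valued measures on the Borel $\sigma$-algebra which are finite on compact sets, outer regular on all Borel sets and inner regular on open sets. A measure $\mu\in\mathcal{M}^+(\mathbb{R}^d)$ belongs to $L^{\alpha,p}(\mathbb{R}^d)^*$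 if the linear functional $C_c^\infty(\mathbb{R}^d)\ni\varphi\mapsto\int_{\mathbb{R}^d}\varphi\,d\mu$ is continuous with respect to the norm of $L^{\alpha,p}(\mathbb{R}^d)$ (equivalently, extends uniquely to an element of the dual); then $\|\mu\|_{L^{\alpha,p}(\mathbb{R}^d)^*}$ is the norm of this functional, and otherwise $\|\mu\|_{L^{\alpha,p}(\mathbb{R}^d)^*}:=\infty$. The pushforward is $(T_\#\mu)(B):=\mu(T^{-1}(B))$ for Borel sets $B\subset\mathbb{R}^d$; if $T_\#\mu$ is not finite on compact sets, then its dual norm is also understood to be $\infty$. *)

theory Defs
  imports "HOL-Analysis.Analysis"
begin

definition fourier_transform :: "('a::euclidean_space \<Rightarrow> complex) \<Rightarrow> 'a \<Rightarrow> complex" where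
  "fourier_transform f \<xi> = (LINT x|lborel. f x * exp (- (\<i> * complex_of_real (\<xi> \<bullet> x))))"

text \<open>The Fourier transform determines the kernel up to a null set only. The choice made here is
  harmless, since the kernel is used only inside the convolution integral below.\<close>

definition bessel_kernel :: "real \<Rightarrow> 'a::euclidean_space \<Rightarrow> real" where
  "bessel_kernel \<alpha> = (SOME g. integrable lborel g \<and>
     (\<forall>\<xi>. fourier_transform (\<lambda>x. complex_of_real (g x)) \<xi> =
           complex_of_real ((1 + (norm \<xi>)\<^sup>2) powr (- \<alpha> / 2))))"

definition fun_conv :: "('a::euclidean_space \<Rightarrow> real) \<Rightarrow> ('a \<Rightarrow> real) \<Rightarrow> 'a \<Rightarrow> real" where
  "fun_conv g f x = (LINT y|lborel. g (x - y) * f y)"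

definition Lp_space :: "real \<Rightarrow> ('a::euclidean_space \<Rightarrow> real) set" where
  "Lp_space p = {f \<in> borel_measurable lborel. integrable lborel (\<lambda>x. \<bar>f x\<bar> powr p)}"

definition Lp_norm :: "real \<Rightarrow> ('a::euclidean_space \<Rightarrow> real) \<Rightarrow> real" where
  "Lp_norm p f = (LINT x|lborel. \<bar>f x\<bar> powr p) powr (1 / p)"

text \<open>Elements of the Bessel potential space are classes of functions modulo null sets, so a
  function \<open>u\<close> is the potential of \<open>f\<close> if it agrees almost everywhere with the convolution.
  The density \<open>f\<close> is unique almost everywhere, because convolution with the Bessel kernel is
  injective on \<open>L\<^sup>p\<close>; hence the norm is well defined on functions that are Bessel potentials, and
  it is unspecified on all others. Test functions are always Bessel potentials.\<close>

definition is_bessel_potential ::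
    "real \<Rightarrow> real \<Rightarrow> ('a::euclidean_space \<Rightarrow> real) \<Rightarrow> ('a \<Rightarrow> real) \<Rightarrow> bool" where
  "is_bessel_potential \<alpha> p f u \<longleftrightarrow>
     f \<in> Lp_space p \<and> (AE x in lborel. u x = fun_conv (bessel_kernel \<alpha>) f x)"

definition bessel_norm :: "real \<Rightarrow> real \<Rightarrow> ('a::euclidean_space \<Rightarrow> real) \<Rightarrow> real" where
  "bessel_norm \<alpha> p u = (THE r. \<exists>f. is_bessel_potential \<alpha> p f u \<and> r = Lp_norm p f)"

fun k_times_cont_diff :: "nat \<Rightarrow> ('a::euclidean_space \<Rightarrow> real) \<Rightarrow> bool" where
  "k_times_cont_diff 0 f \<longleftrightarrow> continuous_on UNIV f"
| "k_times_cont_diff (Suc k) f \<longleftrightarrow>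
     (\<forall>x. f differentiable (at x)) \<and>
     (\<forall>v. k_times_cont_diff k (\<lambda>x. frechet_derivative f (at x) v))"

definition test_functions :: "('a::euclidean_space \<Rightarrow> real) set" where
  "test_functions = {\<phi>. (\<forall>k. k_times_cont_diff k \<phi>) \<and> compact (closure {x. \<phi> x \<noteq> 0})}"

definition finite_on_compacts :: "'a::euclidean_space measure \<Rightarrow> bool" where
  "finite_on_compacts \<mu> \<longleftrightarrow> (\<forall>K. compact K \<longrightarrow> emeasure \<mu> K < \<infinity>)"

definition radon_measures :: "'a::euclidean_space measure set" where
  "radon_measures = {\<mu>. sets \<mu> = sets borel \<and> finite_on_compacts \<mu> \<and>
     (\<forall>B\<in>sets borel. emeasure \<mu> B = (INF U\<in>{U. open U \<and> B \<subseteq> U}. emeasure \<mu> U)) \<and>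
     (\<forall>U. open U \<longrightarrow> emeasure \<mu> U = (SUP K\<in>{K. compact K \<and> K \<subseteq> U}. emeasure \<mu> K))}"

text \<open>The functional \<open>\<phi> \<mapsto> \<integral>\<phi> d\<mu>\<close> is linear, so its continuity is stated as boundedness.\<close>

definition in_bessel_dual :: "real \<Rightarrow> real \<Rightarrow> 'a::euclidean_space measure \<Rightarrow> bool" where
  "in_bessel_dual \<alpha> p \<mu> \<longleftrightarrow> finite_on_compacts \<mu> \<and>
     (\<exists>C. \<forall>\<phi>\<in>test_functions. \<bar>LINT x|\<mu>. \<phi> x\<bar> \<le> C * bessel_norm \<alpha> p \<phi>)"

definition bessel_dual_norm :: "real \<Rightarrow> real \<Rightarrow> 'a::euclidean_space measure \<Rightarrow> ennreal" where
  "bessel_dual_norm \<alpha> p \<mu> =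
     (if in_bessel_dual \<alpha> p \<mu>
      then SUP \<phi>\<in>{\<phi> \<in> test_functions. bessel_norm \<alpha> p \<phi> \<le> 1}. ennreal \<bar>LINT x|\<mu>. \<phi> x\<bar>
      else \<infinity>)"

end

theory Submission
  imports Defs "HOL-Probability.Characteristic_Functions"
begin

text \<open>By duality, \<open>\<mu>\<close> belongs to the dual space iff its Bessel potential \<open>g\<^sub>\<alpha> * \<mu>\<close> is in \<open>L\<^sup>q\<close>, where
  \<open>q = p/(p-1)\<close>, and the \<open>L\<^sup>q\<close> norm of the potential is the dual norm. By Wolff's inequality
  \<open>\<integral>(g\<^sub>\<alpha> * \<mu>)\<^sup>q dx\<close> is comparable to
  \<open>\<Sum>\<^sub>i \<integral>(2\<^sup>i\<^sup>(\<^sup>d\<^sup>-\<^sup>\<alpha>\<^sup>p\<^sup>)\<mu>(B(y, 2\<^sup>-\<^sup>i)))\<^sup>q\<^sup>-\<^sup>1 d\<mu>(y)\<close>, and this energy is monotone under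
  Lipschitz maps because \<open>B(y, r) \<subseteq> T\<^sup>-\<^sup>1(B(Ty, Lr))\<close>. The radii on the two sides differ by the factor \<open>L\<close>, which
  only changes constants in the lower Wolff bound.\<close>

section \<open>Lebesgue integrals under affine maps\<close>

text \<open>Since p > 1, the condition p \<le> d/\<alpha> forces \<alpha> < d. The kernel then has
  the singularity |z|^(\<alpha>-d), which a weighted sum of indicators of shrinking dyadic balls
  models; large radii never occur, because the tail of the kernel is absorbed by its local averages.
  Two obstacles shape the rest. The exponent q is an arbitrary real number above 1, so the q-th
  power of a dyadic sum cannot be multiplied out. It is bounded pointwise by pure powers and mixed
  products in which the power q - 1 sits on the coarser scale; after integration by Tonelli the
  mixed products decay with the gap between the scales. Secondly, the functional is known on smooth
  compactly supported functions only, while the density that is extremal for the L^q norm of the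
  potential is merely bounded and measurable, and even a smooth density has a potential without
  compact support. Cutoffs repair the support and mollifiers the smoothness, the latter through
  lower semicontinuity of the potential, which may be infinite at some points.\<close>

lemma nn_integral_lborel_affine:
  fixes f :: "'a::euclidean_space \<Rightarrow> ennreal"
  assumes [measurable]: "f \<in> borel_measurable borel" and "c \<noteq> 0"
  shows "(\<integral>\<^sup>+x. f x \<partial>lborel) = ennreal (\<bar>c\<bar> ^ DIM('a)) * (\<integral>\<^sup>+x. f (t + c *\<^sub>R x) \<partial>lborel)"
  by (subst lborel_affine[OF \<open>c \<noteq> 0\<close>, of t])
     (simp add: nn_integral_density nn_integral_distr nn_integral_cmult)

lemma nn_integral_lborel_reflect:
  fixes f :: "'a::euclidean_space \<Rightarrow> ennreal"
  assumes "f \<in> borel_measurable borel"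
  shows "(\<integral>\<^sup>+x. f (t - x) \<partial>lborel) = (\<integral>\<^sup>+x. f x \<partial>lborel)"
  using nn_integral_lborel_affine[OF assms, of "-1" t] by simp

lemma nn_integral_lborel_translate:
  fixes f :: "'a::euclidean_space \<Rightarrow> ennreal"
  assumes "f \<in> borel_measurable borel"
  shows "(\<integral>\<^sup>+x. f (t + x) \<partial>lborel) = (\<integral>\<^sup>+x. f x \<partial>lborel)"
  using nn_integral_lborel_affine[OF assms, of "1" t] by simp

lemma distr_lborel_reflect:
  "distr lborel borel (\<lambda>x. t - x) = (lborel :: 'a::euclidean_space measure)"
  using lborel_affine[of "-1" t] by (simp add: density_1)

text \<open>No measurability is assumed: if \<open>f\<close> is not measurable, neither is its
  reflection, and both integrals take the default value 0. Commutativity of \<open>fun_conv\<close>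
  inherits this freedom from hypotheses.\<close>

lemma lborel_integral_reflect:
  fixes f :: "'a::euclidean_space \<Rightarrow> 'b::{banach, second_countable_topology}"
  shows "(LINT x|lborel. f (t - x)) = (LINT x|lborel. f x)"
proof (cases "f \<in> borel_measurable borel")
  case True
  then show ?thesis
    by (subst (2) distr_lborel_reflect[of t, symmetric]) (simp add: integral_distr)
next
  case False
  have "(\<lambda>x. f (t - x)) \<notin> borel_measurable borel"
  proof
    assume "(\<lambda>x. f (t - x)) \<in> borel_measurable borel"
    from measurable_compose[OF _ this, of "\<lambda>x. t - x" borel] False show False by simp
  qed
  with False have "\<not> integrable lborel f" "\<not> integrable lborel (\<lambda>x. f (t - x))"
    by (auto dest: borel_measurable_integrable)
  then show ?thesis by (simp add: not_integrable_integral_eq)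
qed

lemma lborel_integrable_reflect:
  fixes f :: "'a::euclidean_space \<Rightarrow> 'b::{banach, second_countable_topology}"
  assumes "integrable lborel f"
  shows "integrable lborel (\<lambda>x. f (t - x))"
proof -
  have "integrable (distr lborel borel (\<lambda>x. t - x)) f" using assms by (simp add: distr_lborel_reflect)
  then show ?thesis by (subst (asm) integrable_distr_eq) (use borel_measurable_integrable[OF assms] in auto)
qed

lemma lborel_integral_translate:
  fixes f :: "'a::euclidean_space \<Rightarrow> 'b::{banach, second_countable_topology}"
  shows "(LINT x|lborel. f (t + x)) = (LINT x|lborel. f x)"
  using lborel_integral_reflect[of "\<lambda>x. f (t - x)" 0] lborel_integral_reflect[of f t] by simp

lemma lborel_integrable_translate:
  fixes f :: "'a::euclidean_space \<Rightarrow> 'b::{banach, second_countable_topology}"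
  assumes "integrable lborel f"
  shows "integrable lborel (\<lambda>x. f (t + x))"
  using lborel_integrable_reflect[OF lborel_integrable_reflect[OF assms, of t], of 0] by simp

lemma AE_lborel_reflect:
  assumes "AE x in lborel. P (x::'a::euclidean_space)"
  shows "AE x in lborel. P (t - x)"
proof -
  have "AE x in distr lborel borel (\<lambda>x. t - x). P x" unfolding distr_lborel_reflect by (rule assms)
  then obtain N where N: "N \<in> sets borel" "{x. \<not> P x} \<subseteq> N" "emeasure (distr lborel borel (\<lambda>x. t - x)) N = 0"
    by (auto elim!: AE_E)
  show ?thesis
    by (rule AE_I[where N="(\<lambda>x. t - x) -` N"])
       (use N measurable_sets_borel[of "\<lambda>x. t - x" borel N] in \<open>auto simp: emeasure_distr\<close>)
qed

text \<open>The positive and negative parts of \<open>f\<close> are densities of two measures that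
  agree, with finite values, on all boxes. Boxes are stable under intersection, generate the Borel
  sets and exhaust the space, so the measures coincide, and with them the densities almost
  everywhere.\<close>

lemma AE_lborel_eq_0_if_box_integrals_eq_0:
  fixes f :: "'a::euclidean_space \<Rightarrow> real"
  assumes int: "\<And>a b. integrable lborel (\<lambda>x. f x * indicator (box a b) x)"
    and zero: "\<And>a b. (LINT x|lborel. f x * indicator (box a b) x) = 0"
    and [measurable]: "f \<in> borel_measurable borel"
  shows "AE x in lborel. f x = 0"
proof -
  define fp fm where "fp = (\<lambda>x. ennreal (f x))" and "fm = (\<lambda>x. ennreal (- f x))"
  have [measurable]: "fp \<in> borel_measurable borel" "fm \<in> borel_measurable borel"
    unfolding fp_def fm_def by measurable
  have eq: "(\<integral>\<^sup>+x. fp x * indicator (box a b) x \<partial>lborel) = (\<integral>\<^sup>+x. fm x * indicator (box a b) x \<partial>lborel)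
      \<and> (\<integral>\<^sup>+x. fp x * indicator (box a b) x \<partial>lborel) < \<infinity>" for a b
  proof -
    obtain r q where rq: "0 \<le> r" "0 \<le> q"
      "(\<integral>\<^sup>+x. ennreal (f x * indicator (box a b) x) \<partial>lborel) = ennreal r"
      "(\<integral>\<^sup>+x. ennreal (- (f x * indicator (box a b) x)) \<partial>lborel) = ennreal q"
      "(LINT x|lborel. f x * indicator (box a b) x) = r - q"
      by (rule integrableE[OF int[of a b]])
    have "(\<lambda>x. ennreal (f x * indicator (box a b) x)) = (\<lambda>x. fp x * indicator (box a b) x)"
         "(\<lambda>x. ennreal (- (f x * indicator (box a b) x))) = (\<lambda>x. fm x * indicator (box a b) x)"
      by (auto simp: fp_def fm_def fun_eq_iff split: split_indicator)
    with rq zero[of a b] show ?thesis by simp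
  qed
  have "density lborel fp = density lborel fm"
  proof (rule measure_eqI_generator_eq[where E="range (\<lambda>(a, b). box a b::'a set)" and \<Omega>=UNIV
        and A="\<lambda>n. box (- (real n *\<^sub>R One)) (real n *\<^sub>R One)"])
    let ?E = "range (\<lambda>(a, b). box a b::'a set)"
    show "Int_stable ?E" by (auto simp: Int_stable_def box_Int_box)
    show "?E \<subseteq> Pow UNIV" "sets (density lborel fp) = sigma_sets UNIV ?E"
      "sets (density lborel fm) = sigma_sets UNIV ?E"
      by (simp_all add: borel_eq_box)
    let ?A = "\<lambda>n::nat. box (- (real n *\<^sub>R One)) (real n *\<^sub>R One) :: 'a set"
    show "range ?A \<subseteq> ?E" "(\<Union>i. ?A i) = UNIV"
      unfolding UN_box_eq_UNIV by auto
    fix n show "emeasure (density lborel fp) (?A n) \<noteq> \<infinity>"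
      using eq[of "- (real n *\<^sub>R One)" "real n *\<^sub>R One"] by (auto simp: emeasure_density)
  next
    fix X assume "X \<in> range (\<lambda>(a, b). box a b::'a set)"
    then show "emeasure (density lborel fp) X = emeasure (density lborel fm) X"
      using eq by (auto simp: emeasure_density)
  qed
  then have "AE x in lborel. fp x = fm x"
    by (intro sigma_finite_measure.density_unique[OF lborel.sigma_finite_measure_axioms]) auto
  then show ?thesis
  proof eventually_elim
    fix x assume "fp x = fm x"
    then show "f x = 0"
      by (cases "f x \<ge> 0") (auto simp: fp_def fm_def ennreal_neg ennreal_eq_0_iff)
  qed
qed

section \<open>Bounded integrable functions\<close>

text \<open>The working class for densities: it contains the test functions, lies in every L^p with
  p \<ge> 1 and is stable under convolution with an integrable kernel. Such convolutions converge
  absolutely at every point, not just almost everywhere.\<close>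

definition bdint :: "('a::euclidean_space \<Rightarrow> real) \<Rightarrow> bool" where
  "bdint f \<longleftrightarrow> integrable lborel f \<and> (\<exists>B. \<forall>x. \<bar>f x\<bar> \<le> B)"

lemma bdintI: "integrable lborel f \<Longrightarrow> (\<And>x. \<bar>f x\<bar> \<le> B) \<Longrightarrow> bdint f"
  by (auto simp: bdint_def)

lemma bdint_integrable: "bdint f \<Longrightarrow> integrable lborel f"
  by (simp add: bdint_def)

lemma bdint_measurable: "bdint f \<Longrightarrow> f \<in> borel_measurable borel"
  by (auto simp: bdint_def dest: borel_measurable_integrable)

lemma bdint_boundedE:
  assumes "bdint f" obtains B where "B > 0" "\<And>x. \<bar>f x\<bar> \<le> B"
proof -
  obtain B where "\<And>x. \<bar>f x\<bar> \<le> B" using assms by (auto simp: bdint_def)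
  then have "\<bar>f x\<bar> \<le> \<bar>B\<bar> + 1" for x by (rule order_trans[of _ B]) auto
  then show ?thesis by (intro that[of "\<bar>B\<bar> + 1"]) auto
qed

lemma bdint_abs: "bdint f \<Longrightarrow> bdint (\<lambda>x. \<bar>f x\<bar>)"
  by (auto simp: bdint_def)

lemma bdint_add: "bdint f \<Longrightarrow> bdint g \<Longrightarrow> bdint (\<lambda>x. f x + g x)"
  unfolding bdint_def by (blast intro: Bochner_Integration.integrable_add order_trans[OF abs_triangle_ineq] add_mono)

lemma bdint_cmult: "bdint f \<Longrightarrow> bdint (\<lambda>x. c * f x)"
  unfolding bdint_def abs_mult by (blast intro: integrable_mult_right mult_left_mono abs_ge_zero)

lemma bdint_zero: "bdint (\<lambda>x. 0)"
  by (auto simp: bdint_def)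

lemma bdint_sum: "(\<And>i. i \<in> I \<Longrightarrow> bdint (f i)) \<Longrightarrow> bdint (\<lambda>x. \<Sum>i\<in>I. f i x)"
  by (induction I rule: infinite_finite_induct) (auto intro: bdint_zero bdint_add)

lemma bdint_Lp_space:
  assumes "bdint f" "p \<ge> 1"
  shows "f \<in> Lp_space p"
proof -
  obtain B where B: "B > 0" "\<And>x. \<bar>f x\<bar> \<le> B" using bdint_boundedE[OF assms(1)] by blast
  have [measurable]: "f \<in> borel_measurable borel" using bdint_measurable[OF assms(1)] .
  have "integrable lborel (\<lambda>x. \<bar>f x\<bar> powr p)"
  proof (rule Bochner_Integration.integrable_bound)
    show "integrable lborel (\<lambda>x. B powr (p - 1) * \<bar>f x\<bar>)"
      using bdint_integrable[OF assms(1)] by simp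
    show "AE x in lborel. norm (\<bar>f x\<bar> powr p) \<le> norm (B powr (p - 1) * \<bar>f x\<bar>)"
    proof (rule AE_I2)
      fix x
      have "\<bar>f x\<bar> powr p = \<bar>f x\<bar> powr (p - 1) * \<bar>f x\<bar>" by (cases "f x = 0") (auto simp: powr_diff)
      also have "\<dots> \<le> B powr (p - 1) * \<bar>f x\<bar>" using B assms(2) by (intro mult_right_mono powr_mono2) auto
      finally show "norm (\<bar>f x\<bar> powr p) \<le> norm (B powr (p - 1) * \<bar>f x\<bar>)" using B by (simp add: abs_mult)
    qed
  qed measurable
  then show ?thesis by (simp add: Lp_space_def)
qed

text \<open>Splitting at \<open>\<bar>f x\<bar> = 1\<close> replaces Hoelder's inequality: where
  \<open>f\<close> is small the product is at most \<open>\<bar>b x\<bar>\<close>, and where it is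
  large it is at most \<open>B\<close> times the p-th power of
  \<open>\<bar>f x\<bar>\<close>.\<close>

lemma Lp_space_mult_bdint_integrable:
  assumes f: "f \<in> Lp_space p" and b: "bdint b" and p: "p \<ge> 1"
  shows "integrable lborel (\<lambda>x. f x * b x)"
proof -
  obtain B where B: "B > 0" "\<And>x. \<bar>b x\<bar> \<le> B" using bdint_boundedE[OF b] by blast
  have [measurable]: "f \<in> borel_measurable borel" "b \<in> borel_measurable borel"
    using f bdint_measurable[OF b] by (auto simp: Lp_space_def)
  show ?thesis
  proof (rule Bochner_Integration.integrable_bound)
    show "integrable lborel (\<lambda>x. \<bar>b x\<bar> + B * \<bar>f x\<bar> powr p)"
      using f bdint_integrable[OF b] by (auto simp: Lp_space_def)
    show "AE x in lborel. norm (f x * b x) \<le> norm (\<bar>b x\<bar> + B * \<bar>f x\<bar> powr p)"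
    proof (rule AE_I2)
      fix x
      have "\<bar>f x\<bar> * \<bar>b x\<bar> \<le> \<bar>b x\<bar> + B * \<bar>f x\<bar> powr p"
      proof (cases "\<bar>f x\<bar> \<le> 1")
        case True then have "\<bar>f x\<bar> * \<bar>b x\<bar> \<le> \<bar>b x\<bar>" by (intro mult_left_le_one_le) auto
        then show ?thesis using B(1) by (simp add: add_increasing2)
      next
        case False
        then have "\<bar>f x\<bar> \<le> \<bar>f x\<bar> powr p" using p powr_mono[of 1 p "\<bar>f x\<bar>"] by simp
        then have "\<bar>f x\<bar> * \<bar>b x\<bar> \<le> \<bar>f x\<bar> powr p * B" using B by (intro mult_mono) auto
        then show ?thesis by (simp add: mult.commute add_increasing)
      qed
      then show "norm (f x * b x) \<le> norm (\<bar>b x\<bar> + B * \<bar>f x\<bar> powr p)" using B by (simp add: abs_mult)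
    qed
  qed measurable
qed

section \<open>Smooth functions and test functions\<close>

definition dderiv :: "'a::euclidean_space \<Rightarrow> ('a \<Rightarrow> real) \<Rightarrow> 'a \<Rightarrow> real" where
  "dderiv v f = (\<lambda>x. frechet_derivative f (at x) v)"

definition smooth :: "('a::euclidean_space \<Rightarrow> real) \<Rightarrow> bool" where
  "smooth f \<longleftrightarrow> (\<forall>k. k_times_cont_diff k f)"

lemma dderiv_eqI: "(f has_derivative f') (at x) \<Longrightarrow> dderiv v f x = f' v"
  unfolding dderiv_def by (metis frechet_derivative_at)

lemma has_derivative_dderiv: "f differentiable at x \<Longrightarrow> (f has_derivative (\<lambda>v. dderiv v f x)) (at x)"
  unfolding dderiv_def by (simp add: frechet_derivative_works)

lemma k_times_cont_diff_Suc:
  "k_times_cont_diff (Suc k) f \<longleftrightarrow> (\<forall>x. f differentiable (at x)) \<and> (\<forall>v. k_times_cont_diff k (dderiv v f))"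
  by (simp add: dderiv_def)

declare k_times_cont_diff.simps(2)[simp del] k_times_cont_diff_Suc[simp]

lemma k_times_cont_diff_SucD: "k_times_cont_diff (Suc k) f \<Longrightarrow> k_times_cont_diff k f"
proof (induction k arbitrary: f)
  case 0
  then show ?case
    by (auto intro!: continuous_at_imp_continuous_on differentiable_imp_continuous_within)
next
  case (Suc k)
  then show ?case by (metis k_times_cont_diff_Suc)
qed

lemma smooth_unfold: "smooth f \<longleftrightarrow> (\<forall>x. f differentiable at x) \<and> (\<forall>v. smooth (dderiv v f))"
  unfolding smooth_def
  by (metis k_times_cont_diff_Suc k_times_cont_diff_SucD)

lemma smooth_differentiable: "smooth f \<Longrightarrow> f differentiable at x"
  by (auto simp: smooth_unfold[of f])

lemma smooth_dderiv: "smooth f \<Longrightarrow> smooth (dderiv v f)"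
  by (auto simp: smooth_unfold[of f])

lemma smooth_continuous: "smooth f \<Longrightarrow> continuous_on S f"
  by (meson continuous_at_imp_continuous_on differentiable_imp_continuous_within smooth_differentiable)

text \<open>All iterated directional derivatives exist and satisfy \<open>P\<close>. The tower of
  derivatives has no last level, hence the coinductive form. The instances of \<open>P\<close> are
  \<open>bdint\<close> and \<open>bounded_fun\<close>.\<close>

coinductive smooth_with :: "(('a::euclidean_space \<Rightarrow> real) \<Rightarrow> bool) \<Rightarrow> ('a \<Rightarrow> real) \<Rightarrow> bool" for P where
  "(\<And>x. f differentiable at x) \<Longrightarrow> P f \<Longrightarrow> (\<And>v. smooth_with P (dderiv v f)) \<Longrightarrow> smooth_with P f"

lemma smooth_with_smooth: "smooth_with P f \<Longrightarrow> smooth f"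
proof -
  have "smooth_with P f \<Longrightarrow> k_times_cont_diff k f" for k
  proof (induction k arbitrary: f)
    case 0
    then have "\<And>x. f differentiable at x" by (auto elim: smooth_with.cases)
    then show ?case
      by (auto intro!: continuous_at_imp_continuous_on differentiable_imp_continuous_within)
  next
    case (Suc k)
    then show ?case by (auto elim: smooth_with.cases)
  qed
  then show "smooth_with P f \<Longrightarrow> smooth f" by (simp add: smooth_def)
qed

lemma smooth_with_prop: "smooth_with P f \<Longrightarrow> P f"
  by (auto elim: smooth_with.cases)

lemma smooth_with_dderiv: "smooth_with P f \<Longrightarrow> smooth_with P (dderiv v f)"
  by (auto elim: smooth_with.cases)

text \<open>Coinduction reduced to exhibiting an invariant family. The families used are the test
  functions themselves, their convolutions with a fixed kernel, and sums or multiples of functions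
  already treated.\<close>

lemma smooth_with_invariant:
  assumes "f \<in> S" and "\<And>f. f \<in> S \<Longrightarrow> P f" and "\<And>f x. f \<in> S \<Longrightarrow> f differentiable at x"
    and "\<And>f v. f \<in> S \<Longrightarrow> dderiv v f \<in> S"
  shows "smooth_with P f"
  using assms(1) by (coinduction arbitrary: f) (use assms(2-) in auto)

lemma dderiv_add:
  assumes "f differentiable at x" "g differentiable at x"
  shows "dderiv v (\<lambda>x. f x + g x) x = dderiv v f x + dderiv v g x"
  by (rule dderiv_eqI) (intro has_derivative_add assms has_derivative_dderiv)

lemma dderiv_mult:
  assumes "f differentiable at x" "g differentiable at x"
  shows "dderiv v (\<lambda>x. f x * g x) x = f x * dderiv v g x + dderiv v f x * g x"
  by (rule dderiv_eqI) (intro has_derivative_mult assms has_derivative_dderiv)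

lemma dderiv_const: "dderiv v (\<lambda>x. c) = (\<lambda>x. 0)"
  by (rule ext, rule dderiv_eqI) (rule has_derivative_const)

lemma k_times_cont_diff_const: "k_times_cont_diff k (\<lambda>x. c)"
  by (induction k arbitrary: c) (auto simp: dderiv_const)

lemma k_times_cont_diff_add:
  "k_times_cont_diff k f \<Longrightarrow> k_times_cont_diff k g \<Longrightarrow> k_times_cont_diff k (\<lambda>x. f x + g x)"
proof (induction k arbitrary: f g)
  case (Suc k)
  then have "dderiv v (\<lambda>x. f x + g x) = (\<lambda>x. dderiv v f x + dderiv v g x)" for v
    by (auto simp: dderiv_add)
  with Suc show ?case by (auto intro: differentiable_add)
qed (auto intro: continuous_on_add)

lemma k_times_cont_diff_mult:
  "k_times_cont_diff k f \<Longrightarrow> k_times_cont_diff k g \<Longrightarrow> k_times_cont_diff k (\<lambda>x. f x * g x)"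
proof (induction k arbitrary: f g)
  case (Suc k)
  then have *: "dderiv v (\<lambda>x. f x * g x) = (\<lambda>x. f x * dderiv v g x + dderiv v f x * g x)" for v
    by (auto simp: dderiv_mult)
  have "k_times_cont_diff k f" "k_times_cont_diff k g" using Suc.prems k_times_cont_diff_SucD by blast+
  then show ?case using Suc.prems Suc.IH by (auto simp: * intro!: k_times_cont_diff_add)
qed (auto intro: continuous_on_mult)

lemma smooth_const: "smooth (\<lambda>x. c)"
  by (simp add: smooth_def k_times_cont_diff_const)

lemma smooth_add: "smooth f \<Longrightarrow> smooth g \<Longrightarrow> smooth (\<lambda>x. f x + g x)"
  by (simp add: smooth_def k_times_cont_diff_add)

lemma smooth_mult: "smooth f \<Longrightarrow> smooth g \<Longrightarrow> smooth (\<lambda>x. f x * g x)"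
  by (simp add: smooth_def k_times_cont_diff_mult)

lemma smooth_cmult: "smooth f \<Longrightarrow> smooth (\<lambda>x. c * f x)"
  by (intro smooth_mult smooth_const)

lemma smooth_diff: "smooth f \<Longrightarrow> smooth g \<Longrightarrow> smooth (\<lambda>x. f x - g x)"
  using smooth_add[of f "\<lambda>x. (-1) * g x"] smooth_cmult[of g "-1"] by simp

lemma smooth_sum: "(\<And>i. i \<in> I \<Longrightarrow> smooth (f i)) \<Longrightarrow> smooth (\<lambda>x. \<Sum>i\<in>I. f i x)"
  by (induction I rule: infinite_finite_induct) (auto intro: smooth_const smooth_add)

lemma dderiv_affine:
  assumes "\<And>x. f differentiable at x"
  shows "dderiv v (\<lambda>x. f (t + c *\<^sub>R x)) = (\<lambda>x. c * dderiv v f (t + c *\<^sub>R x))"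
proof (rule ext, rule dderiv_eqI)
  fix x
  have "((\<lambda>x. f (t + c *\<^sub>R x)) has_derivative (\<lambda>v. dderiv (c *\<^sub>R v) f (t + c *\<^sub>R x))) (at x)"
    by (rule has_derivative_compose[OF _ has_derivative_dderiv[OF assms]])
       (auto intro!: derivative_eq_intros)
  also have "(\<lambda>v. dderiv (c *\<^sub>R v) f (t + c *\<^sub>R x)) = (\<lambda>v. c * dderiv v f (t + c *\<^sub>R x))"
    using linear_cmul[OF has_derivative_linear[OF has_derivative_dderiv[OF assms]]] by auto
  finally show "((\<lambda>x. f (t + c *\<^sub>R x)) has_derivative (\<lambda>v. c * dderiv v f (t + c *\<^sub>R x))) (at x)" .
qed

lemma differentiable_affine:
  assumes "\<And>x. f differentiable at (x::'a::euclidean_space)"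
  shows "(\<lambda>x. f (t + c *\<^sub>R x)) differentiable at x"
  by (rule differentiable_compose[of f "\<lambda>x. t + c *\<^sub>R x"]) (auto intro!: assms derivative_intros)

lemma smooth_affine:
  assumes "smooth f"
  shows "smooth (\<lambda>x. f (t + c *\<^sub>R x))"
proof -
  have "k_times_cont_diff k f \<Longrightarrow> k_times_cont_diff k (\<lambda>x. f (t + c *\<^sub>R x))" for k
  proof (induction k arbitrary: f)
    case 0
    then show ?case by (auto intro!: continuous_intros elim: continuous_on_compose2)
  next
    case (Suc k)
    then show ?case
      by (auto simp: dderiv_affine differentiable_affine intro!: k_times_cont_diff_mult k_times_cont_diff_const)
  qed
  with assms show ?thesis by (simp add: smooth_def)
qed

lemma smooth_inner: "smooth (\<lambda>x. x \<bullet> w)"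
proof -
  have "dderiv v (\<lambda>x. x \<bullet> w) = (\<lambda>x. v \<bullet> w)" for v
    by (rule ext, rule dderiv_eqI) (auto intro!: derivative_eq_intros)
  then show ?thesis by (subst smooth_unfold) (auto simp: smooth_const)
qed

lemma dderiv_eq_sum_Basis:
  assumes "f differentiable at x"
  shows "dderiv v f x = (\<Sum>b\<in>Basis. (v \<bullet> b) * dderiv b f x)"
proof -
  have l: "linear (\<lambda>v. dderiv v f x)" using has_derivative_linear[OF has_derivative_dderiv[OF assms]] .
  have "dderiv (\<Sum>b\<in>Basis. (v \<bullet> b) *\<^sub>R b) f x = (\<Sum>b\<in>Basis. (v \<bullet> b) * dderiv b f x)"
    by (subst linear_sum[OF l]) (simp add: linear_cmul[OF l])
  then show ?thesis by (simp add: euclidean_representation)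
qed

lemma dderiv_cong_open:
  assumes "open S" "\<And>x. x \<in> S \<Longrightarrow> f x = g x" "x \<in> S" "f differentiable at x"
  shows "dderiv v f x = dderiv v g x"
proof (rule sym, rule dderiv_eqI)
  show "(g has_derivative (\<lambda>v. dderiv v f x)) (at x)"
    by (rule has_derivative_transform_within_open[OF has_derivative_dderiv[OF assms(4)] assms(1,3,2)])
qed

section \<open>Test functions\<close>

lemma test_functions_iff: "\<phi> \<in> test_functions \<longleftrightarrow> smooth \<phi> \<and> bounded {x. \<phi> x \<noteq> 0}"
  by (simp add: test_functions_def smooth_def)

lemma test_functions_smooth: "\<phi> \<in> test_functions \<Longrightarrow> smooth \<phi>"
  by (simp add: test_functions_iff)

lemma test_functions_supportE:
  assumes "\<phi> \<in> test_functions"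
  obtains R where "R > 0" "\<And>x. norm x \<ge> R \<Longrightarrow> \<phi> x = 0"
proof -
  obtain B where "B > 0" "\<forall>x\<in>{x. \<phi> x \<noteq> 0}. norm x < B"
    using assms by (auto simp: test_functions_iff bounded_pos_less)
  then show ?thesis by (intro that[of B]) force+
qed

lemma test_functionsI:
  assumes "smooth \<phi>" "\<And>x. norm x \<ge> R \<Longrightarrow> \<phi> x = 0"
  shows "\<phi> \<in> test_functions"
proof -
  have "bounded {x. \<phi> x \<noteq> 0}" unfolding bounded_iff by (rule exI[of _ R]) (use assms(2) in force)
  with assms show ?thesis by (simp add: test_functions_iff)
qed

lemma test_functions_dderiv:
  assumes "\<phi> \<in> test_functions" shows "dderiv v \<phi> \<in> test_functions"
proof -
  obtain R where R: "R > 0" "\<And>x. norm x \<ge> R \<Longrightarrow> \<phi> x = 0" using test_functions_supportE[OF assms] by blast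
  \<comment> \<open>The support radius grows by 1 because the comparison with the zero function
    needs a whole neighbourhood of \<open>x\<close>, here the complement of
    \<open>cball 0 R\<close>.\<close>
  have "dderiv v \<phi> x = dderiv v (\<lambda>x. 0) x" if "norm x \<ge> R + 1" for x
    by (rule dderiv_cong_open[where S="- cball 0 R"])
       (use that R test_functions_smooth[OF assms] in \<open>auto simp: smooth_differentiable\<close>)
  with test_functions_smooth[OF assms] show ?thesis
    by (intro test_functionsI[of _ "R + 1"]) (auto simp: dderiv_const smooth_dderiv)
qed

lemma test_functions_mult:
  assumes "\<phi> \<in> test_functions" "smooth f" shows "(\<lambda>x. \<phi> x * f x) \<in> test_functions"
proof -
  obtain R where R: "R > 0" "\<And>x. norm x \<ge> R \<Longrightarrow> \<phi> x = 0" using test_functions_supportE[OF assms(1)] by blast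
  show ?thesis
    by (rule test_functionsI[of _ R], rule smooth_mult[OF test_functions_smooth[OF assms(1)] assms(2)]) (simp add: R(2))
qed

lemma test_functions_add:
  assumes "f \<in> test_functions" "g \<in> test_functions"
  shows "(\<lambda>x. f x + g x) \<in> test_functions"
proof -
  obtain R where R: "R > 0" "\<And>x. norm x \<ge> R \<Longrightarrow> f x = 0" using test_functions_supportE[OF assms(1)] by blast
  obtain R' where R': "R' > 0" "\<And>x. norm x \<ge> R' \<Longrightarrow> g x = 0" using test_functions_supportE[OF assms(2)] by blast
  show ?thesis
    by (rule test_functionsI[of _ "max R R'"],
        rule smooth_add[OF test_functions_smooth[OF assms(1)] test_functions_smooth[OF assms(2)]])
       (simp add: R(2) R'(2))
qed

lemma test_functions_cmult:
  assumes "f \<in> test_functions" shows "(\<lambda>x. c * f x) \<in> test_functions"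
  using test_functions_mult[OF assms smooth_const[of c]] by (simp add: mult.commute)

lemma test_functions_zero: "(\<lambda>x. 0) \<in> test_functions"
  by (rule test_functionsI[of _ 0]) (auto simp: smooth_const)

lemma test_functions_sum: "(\<And>i. i \<in> I \<Longrightarrow> f i \<in> test_functions) \<Longrightarrow> (\<lambda>x. \<Sum>i\<in>I. f i x) \<in> test_functions"
  by (induction I rule: infinite_finite_induct) (auto intro: test_functions_zero test_functions_add)

lemma test_functions_affine:
  assumes "f \<in> test_functions" "c \<noteq> 0" shows "(\<lambda>x. f (t + c *\<^sub>R x)) \<in> test_functions"
proof -
  obtain R where R: "R > 0" "\<And>x. norm x \<ge> R \<Longrightarrow> f x = 0" using test_functions_supportE[OF assms(1)] by blast
  show ?thesis
  proof (rule test_functionsI[of _ "(R + norm t) / \<bar>c\<bar>"])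
    fix x :: 'a assume "(R + norm t) / \<bar>c\<bar> \<le> norm x"
    then have "R + norm t \<le> norm (c *\<^sub>R x)" using assms(2) by (simp add: field_simps)
    moreover have "norm (c *\<^sub>R x) \<le> norm (t + c *\<^sub>R x) + norm t"
      using norm_triangle_ineq4[of "t + c *\<^sub>R x" t] by simp
    ultimately show "f (t + c *\<^sub>R x) = 0" by (intro R(2)) auto
  qed (intro smooth_affine test_functions_smooth assms)
qed

lemma test_functions_boundedE:
  assumes "\<phi> \<in> test_functions"
  obtains B where "B > 0" "\<And>x. \<bar>\<phi> x\<bar> \<le> B"
proof -
  obtain R where R: "R > 0" "\<And>x. norm x \<ge> R \<Longrightarrow> \<phi> x = 0" using test_functions_supportE[OF assms] by blast
  have "compact (\<phi> ` cball 0 R)"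
    by (intro compact_continuous_image smooth_continuous test_functions_smooth assms) auto
  then obtain B where B: "B > 0" "\<forall>y\<in>\<phi> ` cball 0 R. norm y \<le> B"
    using compact_imp_bounded bounded_pos by metis
  have "\<bar>\<phi> x\<bar> \<le> B" for x
    using B R(2)[of x] by (cases "norm x \<le> R") auto
  with B(1) show ?thesis using that by blast
qed

section \<open>Smooth functions of compact support\<close>

text \<open>The classical flat function \<open>exp (- (1 / s))\<close>, continued by 0 and divided
  by a power of \<open>s\<close>. The parameter \<open>m\<close> closes the family under
  differentiation, up to linear combinations.\<close>

definition bump_profile :: "nat \<Rightarrow> real \<Rightarrow> real" where
  "bump_profile m s = (if s > 0 then exp (- (1 / s)) / s ^ m else 0)"

lemma bump_profile_tendsto_0: "(bump_profile m \<longlongrightarrow> 0) (at 0)"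
proof -
  have "((\<lambda>s. inverse s ^ m / exp (inverse s)) \<longlongrightarrow> 0) (at_right (0::real))"
    by (rule filterlim_compose[OF tendsto_power_div_exp_0 filterlim_inverse_at_top_right])
  then have r: "(bump_profile m \<longlongrightarrow> 0) (at_right 0)"
    by (rule Lim_transform_eventually)
       (auto simp: bump_profile_def eventually_at_right_less exp_minus field_simps
         intro!: eventually_mono[OF eventually_at_right_less[of 0]])
  have l: "(bump_profile m \<longlongrightarrow> 0) (at_left 0)"
    by (rule Lim_transform_eventually[OF tendsto_const])
       (auto simp: bump_profile_def eventually_at_filter)
  show ?thesis using l r by (simp add: filterlim_at_split)
qed

lemma bump_profile_deriv:
  "(bump_profile m has_real_derivative (bump_profile (m + 2) s - m * bump_profile (m + 1) s)) (at s)"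
proof -
  consider "s < 0" | "s = 0" | "s > 0" by linarith
  then show ?thesis
  proof cases
    case 1
    have "((\<lambda>s. 0) has_real_derivative 0) (at s)" by simp
    then have "(bump_profile m has_real_derivative 0) (at s)"
      by (rule has_field_derivative_transform_within_open[where S="{..<0}"])
         (use 1 in \<open>auto simp: bump_profile_def\<close>)
    with 1 show ?thesis by (simp add: bump_profile_def)
  next
    case 2
    \<comment> \<open>At 0 the difference quotient is itself a member of the family,
      \<open>bump_profile (m + 1)\<close>, whose limit there is 0.\<close>
    have "((\<lambda>h. (bump_profile m (0 + h) - bump_profile m 0) / h) \<longlongrightarrow> 0) (at 0)"
      by (rule Lim_transform_eventually[OF bump_profile_tendsto_0[of "m + 1"]])
         (auto simp: bump_profile_def eventually_at_filter)
    with 2 show ?thesis by (simp add: DERIV_def bump_profile_def)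
  next
    case 3
    have "((\<lambda>s. exp (- (1 / s)) / s ^ m) has_real_derivative
            (bump_profile (m + 2) s - m * bump_profile (m + 1) s)) (at s)"
    proof (cases m)
      case 0
      then show ?thesis using 3
        by (auto intro!: derivative_eq_intros simp: bump_profile_def field_simps power2_eq_square)
    next
      case (Suc n)
      then show ?thesis using 3
        by (auto intro!: derivative_eq_intros simp: bump_profile_def divide_simps)
           (cases n; simp add: algebra_simps)
    qed
    then show ?thesis
      by (rule has_field_derivative_transform_within_open[where S="{0<..}"])
         (use 3 in \<open>auto simp: bump_profile_def\<close>)
  qed
qed

definition bump :: "'a::euclidean_space \<Rightarrow> real" where
  "bump x = bump_profile 0 (1 - x \<bullet> x)"

text \<open>By the chain rule each derivative is a combination of members of the same family with
  larger \<open>m\<close>, times a derivative of \<open>q\<close>; hence the induction on the order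
  generalises over \<open>m\<close>.\<close>

lemma smooth_bump_profile_comp:
  fixes q :: "'a::euclidean_space \<Rightarrow> real"
  assumes q: "smooth q"
  shows "smooth (\<lambda>x. bump_profile m (q x))"
proof -
  have hd: "((\<lambda>x. bump_profile m (q x)) has_derivative
     (\<lambda>v. (bump_profile (m + 2) (q x) - m * bump_profile (m + 1) (q x)) * dderiv v q x)) (at x)" for m x
    by (rule has_derivative_compose[of q _ _ _ "bump_profile m",
          OF has_derivative_dderiv[OF smooth_differentiable[OF q]] bump_profile_deriv[unfolded has_field_derivative_def]])
  have dd: "dderiv v (\<lambda>x. bump_profile m (q x)) =
     (\<lambda>x. (bump_profile (m + 2) (q x) + (- real m) * bump_profile (m + 1) (q x)) * dderiv v q x)" for m v
    by (rule ext, subst dderiv_eqI[OF hd]) auto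
  have diff: "(\<lambda>x. bump_profile m (q x)) differentiable at x" for m x
    using hd by (auto simp: differentiable_def)
  have "k_times_cont_diff k (\<lambda>x. bump_profile m (q x))" for k
  proof (induction k arbitrary: m)
    case 0 show ?case
      using diff by (auto intro!: continuous_at_imp_continuous_on differentiable_imp_continuous_within)
  next
    case (Suc k) then show ?case
      using smooth_dderiv[OF q, unfolded smooth_def]
      unfolding k_times_cont_diff_Suc dd
      by (intro conjI allI diff k_times_cont_diff_mult k_times_cont_diff_add k_times_cont_diff_const) auto
  qed
  then show ?thesis by (simp add: smooth_def)
qed

lemma bump_nonneg: "bump x \<ge> 0"
  by (simp add: bump_def bump_profile_def)

lemma bump_eq_0: "norm x \<ge> 1 \<Longrightarrow> bump x = 0"
  using power_mono[of 1 "norm x" 2] by (simp add: bump_def bump_profile_def dot_square_norm not_less)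

lemma bump_pos: "norm x < 1 \<Longrightarrow> bump x > 0"
  using power_strict_mono[of "norm x" 1 2] by (simp add: bump_def bump_profile_def dot_square_norm)

lemma bump_test_function: "(bump :: 'a::euclidean_space \<Rightarrow> real) \<in> test_functions"
proof (rule test_functionsI[of _ 1])
  have "smooth (\<lambda>x::'a. 1 - (\<Sum>b\<in>Basis. (x \<bullet> b) * (x \<bullet> b)))"
    by (intro smooth_diff smooth_const smooth_sum smooth_mult smooth_inner)
  then have "smooth (\<lambda>x::'a. 1 - x \<bullet> x)" by (subst euclidean_inner)
  then show "smooth (bump :: 'a \<Rightarrow> real)"
    unfolding bump_def[abs_def] by (rule smooth_bump_profile_comp)
qed (rule bump_eq_0)

section \<open>Powers of one minus the Laplacian\<close>

text \<open>Its Fourier symbol \<open>1 + |\<xi>|^2\<close> is the reciprocal of the symbol of the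
  kernel of order 2. An integer power of this operator followed by convolution with a kernel of
  positive order replaces a fractional power.\<close>

definition one_minus_laplacian :: "('a::euclidean_space \<Rightarrow> real) \<Rightarrow> 'a \<Rightarrow> real" where
  "one_minus_laplacian f x = f x - (\<Sum>b\<in>Basis. dderiv b (dderiv b f) x)"

lemma smooth_oml: "smooth f \<Longrightarrow> smooth (one_minus_laplacian f)"
  unfolding one_minus_laplacian_def[abs_def] by (intro smooth_diff smooth_sum smooth_dderiv)

lemma smooth_oml_pow: "smooth f \<Longrightarrow> smooth ((one_minus_laplacian ^^ k) f)"
  by (induction k) (auto intro: smooth_oml)

lemma test_functions_oml: "f \<in> test_functions \<Longrightarrow> one_minus_laplacian f \<in> test_functions"
proof -
  assume f: "f \<in> test_functions"
  have "(\<lambda>x. f x + (-1) * (\<Sum>b\<in>Basis. dderiv b (dderiv b f) x)) \<in> test_functions"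
    by (intro test_functions_add test_functions_sum test_functions_dderiv f test_functions_cmult)
  then show ?thesis by (simp add: one_minus_laplacian_def[abs_def])
qed

lemma test_functions_oml_pow: "f \<in> test_functions \<Longrightarrow> (one_minus_laplacian ^^ k) f \<in> test_functions"
  by (induction k) (auto intro: test_functions_oml)

lemma dderiv_linear_fun:
  assumes "smooth f" "smooth g"
  shows "dderiv v (\<lambda>x. f x + c * g x) = (\<lambda>x. dderiv v f x + c * dderiv v g x)"
  by (rule ext, rule dderiv_eqI)
     (intro has_derivative_add has_derivative_mult_right has_derivative_dderiv smooth_differentiable assms)

lemma oml_linear:
  assumes "smooth f" "smooth g"
  shows "one_minus_laplacian (\<lambda>x. f x + c * g x) = (\<lambda>x. one_minus_laplacian f x + c * one_minus_laplacian g x)"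
  by (rule ext)
     (simp add: one_minus_laplacian_def dderiv_linear_fun assms smooth_dderiv sum.distrib sum_distrib_left algebra_simps)

lemma oml_pow_linear:
  assumes "smooth f" "smooth g"
  shows "(one_minus_laplacian ^^ k) (\<lambda>x. f x + c * g x) =
    (\<lambda>x. (one_minus_laplacian ^^ k) f x + c * (one_minus_laplacian ^^ k) g x)"
  using assms by (induction k) (auto simp: oml_linear smooth_oml_pow)

lemma oml_zero: "one_minus_laplacian (\<lambda>x. 0) = (\<lambda>x. 0)"
  by (rule ext) (simp add: one_minus_laplacian_def dderiv_const)

lemma oml_pow_zero: "(one_minus_laplacian ^^ k) (\<lambda>x. 0) = (\<lambda>x. 0)"
  by (induction k) (auto simp: oml_zero)

lemma oml_pow_sum:
  assumes "\<And>i. i \<in> I \<Longrightarrow> smooth (f i)"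
  shows "(one_minus_laplacian ^^ k) (\<lambda>x. \<Sum>i\<in>I. f i x) = (\<lambda>x. \<Sum>i\<in>I. (one_minus_laplacian ^^ k) (f i) x)"
  using assms
proof (induction I rule: infinite_finite_induct)
  case (insert i I)
  have "smooth (f i)" "smooth (\<lambda>x. \<Sum>i\<in>I. f i x)" using insert.prems by (auto intro: smooth_sum)
  from oml_pow_linear[OF this, where c=1 and k=k] insert show ?case by simp
qed (auto simp: oml_pow_zero)

section \<open>Convolution\<close>

lemma fun_conv_commute: "fun_conv g f x = fun_conv f g x"
  using lborel_integral_reflect[of "\<lambda>z. g z * f (x - z)" x]
  by (simp add: fun_conv_def mult.commute[of "f _" "g _"])

lemma integrable_mult_bounded:
  fixes g f :: "'a::euclidean_space \<Rightarrow> real"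
  assumes g: "integrable lborel g" and [measurable]: "f \<in> borel_measurable borel" and B: "\<And>x. \<bar>f x\<bar> \<le> B"
  shows "integrable lborel (\<lambda>x. g x * f x)"
proof (rule Bochner_Integration.integrable_bound)
  show "integrable lborel (\<lambda>x. B * g x)" using g by simp
  have [measurable]: "g \<in> borel_measurable borel" using g borel_measurable_integrable by auto
  show "(\<lambda>x. g x * f x) \<in> borel_measurable lborel" by measurable
  have "\<bar>g x\<bar> * \<bar>f x\<bar> \<le> \<bar>B\<bar> * \<bar>g x\<bar>" for x
    using B[of x] by (subst mult.commute) (intro mult_right_mono, auto)
  then show "AE x in lborel. norm (g x * f x) \<le> norm (B * g x)" by (simp add: abs_mult)
qed

lemma integrable_conv_integrand:
  fixes g f :: "'a::euclidean_space \<Rightarrow> real"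
  assumes "integrable lborel g" "f \<in> borel_measurable borel" "\<And>x. \<bar>f x\<bar> \<le> B"
  shows "integrable lborel (\<lambda>y. g (x - y) * f y)"
  by (rule integrable_mult_bounded[OF lborel_integrable_reflect[OF assms(1)] assms(2,3)])

lemma abs_fun_conv_le:
  fixes g f :: "'a::euclidean_space \<Rightarrow> real"
  assumes g: "integrable lborel g" and f: "f \<in> borel_measurable borel" and B: "\<And>x. \<bar>f x\<bar> \<le> B"
  shows "\<bar>fun_conv g f x\<bar> \<le> B * (LINT x|lborel. \<bar>g x\<bar>)"
proof -
  have "\<bar>fun_conv g f x\<bar> \<le> (LINT y|lborel. \<bar>g (x - y) * f y\<bar>)"
    unfolding fun_conv_def by (rule integral_abs_bound)
  also have "\<dots> \<le> (LINT y|lborel. B * \<bar>g (x - y)\<bar>)"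
  proof (rule integral_mono)
    show "integrable lborel (\<lambda>y. \<bar>g (x - y) * f y\<bar>)"
      using integrable_conv_integrand[OF assms] by simp
    show "integrable lborel (\<lambda>y. B * \<bar>g (x - y)\<bar>)"
      using lborel_integrable_reflect[OF g] by simp
    show "\<bar>g (x - y) * f y\<bar> \<le> B * \<bar>g (x - y)\<bar>" for y
      using B[of y] by (auto simp: abs_mult mult.commute intro: mult_right_mono)
  qed
  also have "\<dots> = B * (LINT x|lborel. \<bar>g x\<bar>)"
    using lborel_integral_reflect[of "\<lambda>y. \<bar>g y\<bar>" x] by simp
  finally show ?thesis .
qed

text \<open>A general normed field admits both the real convolution integrals and the complex
  integrands of the Fourier transform.\<close>

lemma integrable_conv_product:
  fixes f g :: "'a::euclidean_space \<Rightarrow> 'b::{real_normed_field, banach, second_countable_topology}"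
  assumes f: "integrable lborel f" and g: "integrable lborel g"
  shows "integrable (lborel \<Otimes>\<^sub>M lborel) (\<lambda>(y, x). g (x - y) * f y)"
proof (rule lborel_pair.Fubini_integrable)
  have [measurable]: "f \<in> borel_measurable borel" "g \<in> borel_measurable borel"
    using f g borel_measurable_integrable by auto
  show "(\<lambda>(y, x). g (x - y) * f y) \<in> borel_measurable (lborel \<Otimes>\<^sub>M lborel)" by measurable
  have t: "integrable lborel (\<lambda>x. g (x - y))" for y
    using lborel_integrable_translate[OF g, of "- y"] by simp
  have "(LINT x|lborel. norm (g (x - y) * f y)) = norm (f y) * (LINT x|lborel. norm (g x))" for y
    using lborel_integral_translate[of "\<lambda>x. norm (g x)" "- y"] by (simp add: norm_mult mult.commute)
  then show "integrable lborel (\<lambda>y. LINT x|lborel. norm (case (y, x) of (y, x) \<Rightarrow> g (x - y) * f y))"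
    using f by simp
  show "AE y in lborel. integrable lborel (\<lambda>x. case (y, x) of (y, x) \<Rightarrow> g (x - y) * f y)"
    using t by simp
qed

lemma integrable_fun_conv:
  fixes f g :: "'a::euclidean_space \<Rightarrow> real"
  assumes "integrable lborel g" "integrable lborel f"
  shows "integrable lborel (fun_conv g f)"
  using lborel_pair.integrable_snd[OF integrable_conv_product[OF assms(2,1)]]
  by (simp add: fun_conv_def[abs_def])

lemma bdint_fun_conv:
  assumes g: "integrable lborel g" and f: "bdint f"
  shows "bdint (fun_conv g f)"
proof -
  obtain B where B: "B > 0" "\<And>x. \<bar>f x\<bar> \<le> B" using bdint_boundedE[OF f] by blast
  show ?thesis
    by (rule bdintI[OF integrable_fun_conv[OF g bdint_integrable[OF f]]
          abs_fun_conv_le[OF g bdint_measurable[OF f] B(2)]])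
qed

text \<open>Boundedness of the third factor gives the identity at every \<open>x\<close> and not
  only almost everywhere: \<open>\<bar>b\<bar> * \<bar>c\<bar>\<close> (convolution) is again
  bounded, so the double integral converges absolutely against a translate of the integrable
  \<open>a\<close>.\<close>

lemma fun_conv_assoc:
  fixes a b c :: "'a::euclidean_space \<Rightarrow> real"
  assumes a: "integrable lborel a" and b: "integrable lborel b" and c: "bdint c"
  shows "fun_conv a (fun_conv b c) x = fun_conv (fun_conv a b) c x"
proof -
  obtain B where B: "B > 0" "\<And>x. \<bar>c x\<bar> \<le> B" using bdint_boundedE[OF c] by blast
  have [measurable]: "a \<in> borel_measurable borel" "b \<in> borel_measurable borel" "c \<in> borel_measurable borel"
    using a b bdint_measurable[OF c] borel_measurable_integrable by auto
  have "integrable (lborel \<Otimes>\<^sub>M lborel) (\<lambda>(y, z). a (x - y) * (b (y - z) * c z))"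
  proof (rule lborel_pair.Fubini_integrable)
    show "(\<lambda>(y, z). a (x - y) * (b (y - z) * c z)) \<in> borel_measurable (lborel \<Otimes>\<^sub>M lborel)" by measurable
    have bc: "integrable lborel (\<lambda>z. b (y - z) * c z)" for y
      by (rule integrable_conv_integrand[OF b _ B(2)]) measurable
    then show "AE y in lborel. integrable lborel (\<lambda>z. case (y, z) of (y, z) \<Rightarrow> a (x - y) * (b (y - z) * c z))"
      by simp
    have eq: "(LINT z|lborel. norm (a (x - y) * (b (y - z) * c z))) = \<bar>a (x - y)\<bar> * fun_conv (\<lambda>x. \<bar>b x\<bar>) (\<lambda>x. \<bar>c x\<bar>) y" for y
      by (simp add: fun_conv_def abs_mult)
    have bd: "bdint (fun_conv (\<lambda>x. \<bar>b x\<bar>) (\<lambda>x. \<bar>c x\<bar>))"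
      by (rule bdint_fun_conv) (use b c in \<open>auto intro: bdint_abs\<close>)
    obtain B' where B': "B' > 0" "\<And>x. \<bar>fun_conv (\<lambda>x. \<bar>b x\<bar>) (\<lambda>x. \<bar>c x\<bar>) x\<bar> \<le> B'"
      by (rule bdint_boundedE[OF bd]) (rule that)
    have "integrable lborel (\<lambda>y. \<bar>a (x - y)\<bar> * fun_conv (\<lambda>x. \<bar>b x\<bar>) (\<lambda>x. \<bar>c x\<bar>) y)"
      by (intro integrable_conv_integrand[OF _ bdint_measurable[OF bd] B'(2), of "\<lambda>y. \<bar>a y\<bar>"]) (use a in auto)
    then show "integrable lborel (\<lambda>y. LINT z|lborel. norm (case (y, z) of (y, z) \<Rightarrow> a (x - y) * (b (y - z) * c z)))"
      by (simp only: prod.case eq)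
  qed
  then have "(LINT z|lborel. LINT y|lborel. a (x - y) * (b (y - z) * c z)) =
             (LINT y|lborel. LINT z|lborel. a (x - y) * (b (y - z) * c z))"
    by (rule lborel_pair.Fubini_integral)
  moreover have "(LINT y|lborel. a (x - y) * (b (y - z) * c z)) = fun_conv a b (x - z) * c z" for z
  proof -
    have "(LINT y|lborel. a (x - y) * b (y - z)) = (LINT y|lborel. a (x - (z + y)) * b (z + y - z))"
      by (rule lborel_integral_translate[of "\<lambda>y. a (x - y) * b (y - z)" z, symmetric])
    also have "\<dots> = fun_conv a b (x - z)" by (simp add: fun_conv_def diff_diff_eq)
    finally have "(LINT y|lborel. a (x - y) * b (y - z)) * c z = fun_conv a b (x - z) * c z" by simp
    then show ?thesis by (simp flip: mult.assoc)
  qed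
  ultimately show ?thesis by (simp add: fun_conv_def)
qed

section \<open>Smoothness of convolutions\<close>

lemma continuous_fun_conv:
  assumes g: "integrable lborel g" and f: "continuous_on UNIV f" and B: "\<And>x. \<bar>f x\<bar> \<le> B"
  shows "continuous_on UNIV (fun_conv g f)"
  unfolding continuous_on_sequentially
proof (intro allI ballI impI)
  fix X :: "nat \<Rightarrow> 'a" and x assume X: "(\<forall>n. X n \<in> UNIV) \<and> X \<longlonglongrightarrow> x"
  have [measurable]: "f \<in> borel_measurable borel" "g \<in> borel_measurable borel"
    using f g borel_measurable_integrable by (auto intro: borel_measurable_continuous_onI)
  have "(\<lambda>n. LINT y|lborel. f (X n - y) * g y) \<longlonglongrightarrow> (LINT y|lborel. f (x - y) * g y)"
  proof (rule integral_dominated_convergence[where w="\<lambda>y. B * \<bar>g y\<bar>"])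
    show "integrable lborel (\<lambda>y. B * \<bar>g y\<bar>)" using g by simp
    show "AE y in lborel. (\<lambda>n. f (X n - y) * g y) \<longlonglongrightarrow> f (x - y) * g y"
    proof (rule AE_I2)
      fix y
      have "(\<lambda>n. f (X n - y)) \<longlonglongrightarrow> f (x - y)"
        by (rule continuous_on_tendsto_compose[OF f]) (use X in \<open>auto intro!: tendsto_intros\<close>)
      then show "(\<lambda>n. f (X n - y) * g y) \<longlonglongrightarrow> f (x - y) * g y" by (intro tendsto_intros)
    qed
    show "AE y in lborel. norm (f (X n - y) * g y) \<le> B * \<bar>g y\<bar>" for n
      using B by (intro AE_I2) (simp add: abs_mult mult_right_mono)
  qed measurable
  then show "(fun_conv g f \<circ> X) \<longlonglongrightarrow> fun_conv g f x"
    unfolding comp_def by (subst (1 2) fun_conv_commute) (simp add: fun_conv_def)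
qed

lemma smooth_dderiv_lipschitz:
  assumes f: "smooth f" and B: "\<And>b x. b \<in> Basis \<Longrightarrow> \<bar>dderiv b f x\<bar> \<le> B"
  shows "\<bar>dderiv v f x\<bar> \<le> real DIM('a::euclidean_space) * B * norm v"
    and "\<bar>f (x + v) - f (x::'a)\<bar> \<le> real DIM('a) * B * norm v"
proof -
  show 1: "\<bar>dderiv v f x\<bar> \<le> real DIM('a) * B * norm v" for v x
  proof -
    have "\<bar>dderiv v f x\<bar> \<le> (\<Sum>b\<in>Basis. \<bar>(v \<bullet> b) * dderiv b f x\<bar>)"
      by (subst dderiv_eq_sum_Basis[OF smooth_differentiable[OF f]]) (rule sum_abs)
    also have "\<dots> \<le> (\<Sum>b\<in>(Basis::'a set). norm v * B)"
      by (rule sum_mono) (auto simp: abs_mult Basis_le_norm intro!: mult_mono B)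
    finally show ?thesis by (simp add: mult_ac)
  qed
  have "norm (f (x + v) - f x) \<le> (real DIM('a) * B) * norm ((x + v) - x)"
  proof (rule differentiable_bound[of UNIV f "\<lambda>x v. dderiv v f x"])
    show "(f has_derivative (\<lambda>v. dderiv v f x)) (at x within UNIV)" for x
      using has_derivative_dderiv[OF smooth_differentiable[OF f]] by simp
    show "onorm (\<lambda>v. dderiv v f x) \<le> real DIM('a) * B" for x
      by (rule onorm_le) (use 1 in simp)
  qed auto
  then show "\<bar>f (x + v) - f x\<bar> \<le> real DIM('a) * B * norm v" by simp
qed

text \<open>The kernel is merely integrable, so the derivative has to fall on \<open>h\<close>. The
  remainder quotient of \<open>h\<close> is bounded by twice a Lipschitz constant, and dominated
  convergence along sequences of increments then differentiates under the integral.\<close>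

lemma fun_conv_has_derivative:
  fixes h :: "'a::euclidean_space \<Rightarrow> real"
  assumes g: "integrable lborel g" and h: "smooth h"
    and B0: "\<And>x. \<bar>h x\<bar> \<le> B0" and B: "\<And>b x. b \<in> Basis \<Longrightarrow> \<bar>dderiv b h x\<bar> \<le> B"
  shows "(fun_conv g h has_derivative (\<lambda>v. fun_conv g (dderiv v h) x)) (at x)"
  unfolding has_derivative_at
proof
  define M where "M = real DIM('a) * B"
  have [measurable]: "h \<in> borel_measurable borel" "g \<in> borel_measurable borel"
    using smooth_continuous[OF h] g borel_measurable_integrable by (auto intro: borel_measurable_continuous_onI)
  have [measurable]: "dderiv v h \<in> borel_measurable borel" for v
    using smooth_continuous[OF smooth_dderiv[OF h]] by (auto intro: borel_measurable_continuous_onI)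
  have Md: "\<bar>dderiv v h y\<bar> \<le> M * norm v" for v y
    unfolding M_def by (rule smooth_dderiv_lipschitz[OF h B])
  have Ml: "\<bar>h (y + v) - h y\<bar> \<le> M * norm v" for v y
    unfolding M_def by (rule smooth_dderiv_lipschitz[OF h B])
  have int0: "integrable lborel (\<lambda>y. h (z - y) * g y)" for z
    by (subst mult.commute, rule integrable_mult_bounded[OF g]) (use B0 in auto)
  have intd: "integrable lborel (\<lambda>y. dderiv v h (z - y) * g y)" for z v
    by (subst mult.commute, rule integrable_mult_bounded[OF g]) (use Md in auto)
  have conv: "fun_conv g f z = (LINT y|lborel. f (z - y) * g y)" for f z
    by (subst fun_conv_commute) (simp add: fun_conv_def)
  have "fun_conv g (dderiv v h) x = (\<Sum>b\<in>Basis. (v \<bullet> b) * fun_conv g (dderiv b h) x)" for v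
  proof -
    have "(LINT y|lborel. dderiv v h (x - y) * g y) =
        (LINT y|lborel. (\<Sum>b\<in>Basis. (v \<bullet> b) * (dderiv b h (x - y) * g y)))"
      by (subst dderiv_eq_sum_Basis[OF smooth_differentiable[OF h]]) (simp add: sum_distrib_right mult.assoc)
    also have "\<dots> = (\<Sum>b\<in>Basis. LINT y|lborel. (v \<bullet> b) * (dderiv b h (x - y) * g y))"
      by (rule Bochner_Integration.integral_sum) (use intd in simp)
    finally show ?thesis by (simp add: conv)
  qed
  from ext[OF this] show "bounded_linear (\<lambda>v. fun_conv g (dderiv v h) x)"
    by (rule ssubst) (intro bounded_linear_sum bounded_linear_mult_const bounded_linear_inner_left)
  show "(\<lambda>v. norm (fun_conv g h (x + v) - fun_conv g h x - fun_conv g (dderiv v h) x) / norm v) \<midarrow>0\<rightarrow> 0"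
    unfolding tendsto_at_iff_sequentially
  proof (intro allI impI)
    fix X :: "nat \<Rightarrow> 'a" assume X: "\<forall>i. X i \<in> UNIV - {0}" "X \<longlonglongrightarrow> 0"
    define R where "R n y = (h (x + X n - y) - h (x - y) - dderiv (X n) h (x - y)) / norm (X n)" for n y
    have "(\<lambda>n. LINT y|lborel. R n y * g y) \<longlonglongrightarrow> (LINT y|lborel. 0 * g y)"
    proof (rule integral_dominated_convergence[where w="\<lambda>y. (2 * M) * \<bar>g y\<bar>"])
      show "integrable lborel (\<lambda>y. (2 * M) * \<bar>g y\<bar>)" using g by simp
      show "AE y in lborel. (\<lambda>n. R n y * g y) \<longlonglongrightarrow> 0 * g y"
      proof (rule AE_I2, intro tendsto_mult tendsto_const)
        fix y
        have "(\<lambda>v. norm (h (x - y + v) - h (x - y) - dderiv v h (x - y)) / norm v) \<midarrow>0\<rightarrow> 0"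
          using has_derivative_dderiv[OF smooth_differentiable[OF h], of "x - y"] unfolding has_derivative_at by simp
        then have "((\<lambda>v. norm (h (x - y + v) - h (x - y) - dderiv v h (x - y)) / norm v) \<circ> X) \<longlonglongrightarrow> 0"
          using X unfolding tendsto_at_iff_sequentially by blast
        then have "(\<lambda>n. norm (R n y)) \<longlonglongrightarrow> 0" by (simp add: R_def comp_def algebra_simps)
        then show "(\<lambda>n. R n y) \<longlonglongrightarrow> 0" using tendsto_norm_zero_iff by blast
      qed
      have "\<bar>R n y\<bar> \<le> 2 * M" for n y
      proof -
        have "\<bar>h (x - y + X n) - h (x - y) - dderiv (X n) h (x - y)\<bar> \<le> M * norm (X n) + M * norm (X n)"
          using Ml[of "x - y" "X n"] Md[of "X n" "x - y"] by linarith
        moreover have "norm (X n) > 0" using X(1) by simp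
        ultimately show ?thesis unfolding R_def by (simp add: field_simps)
      qed
      then show "AE y in lborel. norm (R n y * g y) \<le> (2 * M) * \<bar>g y\<bar>" for n
        by (intro AE_I2) (simp add: abs_mult mult_right_mono)
    qed (auto simp: R_def[abs_def])
    moreover have "(LINT y|lborel. R n y * g y) =
        (fun_conv g h (x + X n) - fun_conv g h x - fun_conv g (dderiv (X n) h) x) / norm (X n)" for n
    proof -
      have "(LINT y|lborel. R n y * g y) = (LINT y|lborel. (h (x + X n - y) * g y - h (x - y) * g y
          - dderiv (X n) h (x - y) * g y) / norm (X n))"
        by (simp add: R_def algebra_simps diff_divide_distrib)
      also have "\<dots> = (LINT y|lborel. h (x + X n - y) * g y - h (x - y) * g y
          - dderiv (X n) h (x - y) * g y) / norm (X n)" by simp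
      also have "(LINT y|lborel. h (x + X n - y) * g y - h (x - y) * g y - dderiv (X n) h (x - y) * g y)
         = fun_conv g h (x + X n) - fun_conv g h x - fun_conv g (dderiv (X n) h) x"
        unfolding conv using int0 intd by simp
      finally show ?thesis .
    qed
    ultimately have "(\<lambda>n. norm ((fun_conv g h (x + X n) - fun_conv g h x - fun_conv g (dderiv (X n) h) x) / norm (X n))) \<longlonglongrightarrow> norm (0::real)"
      by (intro tendsto_norm) simp
    then show "((\<lambda>v. norm (fun_conv g h (x + v) - fun_conv g h x - fun_conv g (dderiv v h) x) / norm v) \<circ> X) \<longlonglongrightarrow> 0"
      by (simp add: comp_def)
  qed
qed

lemma test_functions_bdint: "\<phi> \<in> test_functions \<Longrightarrow> bdint \<phi>"
proof -
  assume \<phi>: "\<phi> \<in> test_functions"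
  obtain B where B: "B > 0" "\<And>x. \<bar>\<phi> x\<bar> \<le> B" using test_functions_boundedE[OF \<phi>] by blast
  obtain R where R: "R > 0" "\<And>x. norm x \<ge> R \<Longrightarrow> \<phi> x = 0" using test_functions_supportE[OF \<phi>] by blast
  have [measurable]: "\<phi> \<in> borel_measurable borel"
    using smooth_continuous[OF test_functions_smooth[OF \<phi>]] by (auto intro: borel_measurable_continuous_onI)
  have "integrable lborel (\<lambda>x. indicator (cball 0 R) x *\<^sub>R \<phi> x)"
    by (rule borel_integrable_compact)
       (auto intro: smooth_continuous test_functions_smooth \<phi>)
  moreover have "(\<lambda>x. indicator (cball 0 R) x *\<^sub>R \<phi> x) = \<phi>"
    using R(2) by (auto simp: fun_eq_iff indicator_def)
  ultimately show ?thesis using B by (intro bdintI[of _ B]) auto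
qed

lemma test_functions_dderiv_boundedE:
  fixes h :: "'a::euclidean_space \<Rightarrow> real"
  assumes h: "h \<in> test_functions"
  obtains B where "\<And>b x. b \<in> Basis \<Longrightarrow> \<bar>dderiv b h x\<bar> \<le> B"
proof -
  have "\<exists>B. \<forall>x. \<bar>dderiv b h x\<bar> \<le> B" for b
    using test_functions_boundedE[OF test_functions_dderiv[OF h, of b]] by blast
  then have "\<forall>b. \<exists>B. \<forall>x. \<bar>dderiv b h x\<bar> \<le> B" by blast
  from choice[OF this] obtain Bb where Bb: "\<And>b x. \<bar>dderiv b h x\<bar> \<le> Bb b" by blast
  have "\<bar>dderiv b h x\<bar> \<le> Max (Bb ` Basis)" if "b \<in> Basis" for b x
    using Bb[of b x] that by (auto intro: order_trans[OF _ Max_ge])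
  then show thesis by (rule that)
qed

lemma fun_conv_test_function:
  assumes g: "integrable lborel g" and h: "h \<in> test_functions"
  shows "fun_conv g h differentiable at x" and "dderiv v (fun_conv g h) = fun_conv g (dderiv v h)"
proof -
  obtain B0 where B0: "B0 > 0" "\<And>x. \<bar>h x\<bar> \<le> B0" using test_functions_boundedE[OF h] by blast
  obtain B where B: "\<And>b x. b \<in> Basis \<Longrightarrow> \<bar>dderiv b h x\<bar> \<le> B"
    by (rule test_functions_dderiv_boundedE[OF h]) (rule that)
  note d = fun_conv_has_derivative[OF g test_functions_smooth[OF h] B0(2) B]
  show "fun_conv g h differentiable at x" using d by (auto simp: differentiable_def)
  show "dderiv v (fun_conv g h) = fun_conv g (dderiv v h)" by (rule ext, rule dderiv_eqI[OF d])
qed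

text \<open>Differentiation stays inside the family of convolutions of \<open>g\<close> with test
  functions, since it acts on the test function, and every member of the family is bounded and
  integrable.\<close>

lemma smooth_with_fun_conv:
  assumes g: "integrable lborel g" and h: "h \<in> test_functions"
  shows "smooth_with bdint (fun_conv g h)"
  by (rule smooth_with_invariant[where S="fun_conv g ` test_functions"])
     (use g h in \<open>auto simp: fun_conv_test_function intro: bdint_fun_conv test_functions_bdint test_functions_dderiv\<close>)

lemma smooth_fun_conv:
  assumes "integrable lborel g" and "h \<in> test_functions"
  shows "smooth (fun_conv g h)"
  using smooth_with_fun_conv[OF assms] smooth_with_smooth by blast

lemma fun_conv_linear:
  assumes "integrable lborel g" "bdint f" "bdint h"
  shows "fun_conv g (\<lambda>x. f x + c * h x) x = fun_conv g f x + c * fun_conv g h x"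
proof -
  obtain B where B: "B > 0" "\<And>x. \<bar>f x\<bar> \<le> B" using bdint_boundedE[OF assms(2)] by blast
  obtain B' where B': "B' > 0" "\<And>x. \<bar>h x\<bar> \<le> B'" using bdint_boundedE[OF assms(3)] by blast
  have "integrable lborel (\<lambda>y. g (x - y) * f y)" "integrable lborel (\<lambda>y. g (x - y) * h y)"
    by (rule integrable_conv_integrand[OF assms(1)], use B B' assms in \<open>auto intro: bdint_measurable\<close>)+
  then show ?thesis by (simp add: fun_conv_def algebra_simps)
qed

lemma fun_conv_sum:
  assumes "integrable lborel g" "\<And>i. i \<in> I \<Longrightarrow> bdint (f i)"
  shows "fun_conv g (\<lambda>x. \<Sum>i\<in>I. f i x) x = (\<Sum>i\<in>I. fun_conv g (f i) x)"
  using assms(2)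
proof (induction I rule: infinite_finite_induct)
  case (insert i I)
  have "fun_conv g (\<lambda>x. f i x + 1 * (\<Sum>i\<in>I. f i x)) x = fun_conv g (f i) x + 1 * fun_conv g (\<lambda>x. \<Sum>i\<in>I. f i x) x"
    using insert.prems by (intro fun_conv_linear assms(1) bdint_sum) auto
  with insert show ?case by simp
qed (auto simp: fun_conv_def)

lemma oml_fun_conv:
  assumes g: "integrable lborel g" and h: "h \<in> test_functions"
  shows "one_minus_laplacian (fun_conv g h) = fun_conv g (one_minus_laplacian h)"
proof
  fix x
  have "fun_conv g (\<lambda>x. h x + (-1) * (\<Sum>b\<in>Basis. dderiv b (dderiv b h) x)) x =
      fun_conv g h x + (-1) * fun_conv g (\<lambda>x. \<Sum>b\<in>Basis. dderiv b (dderiv b h) x) x"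
    by (intro fun_conv_linear g test_functions_bdint h test_functions_sum test_functions_dderiv)
  also have "fun_conv g (\<lambda>x. \<Sum>b\<in>Basis. dderiv b (dderiv b h) x) x = (\<Sum>b\<in>Basis. fun_conv g (dderiv b (dderiv b h)) x)"
    by (intro fun_conv_sum g test_functions_bdint h test_functions_dderiv)
  finally show "one_minus_laplacian (fun_conv g h) x = fun_conv g (one_minus_laplacian h) x"
    by (simp add: one_minus_laplacian_def[abs_def] fun_conv_test_function g h test_functions_dderiv)
qed

lemma oml_pow_fun_conv:
  assumes "integrable lborel g" and "h \<in> test_functions"
  shows "(one_minus_laplacian ^^ k) (fun_conv g h) = fun_conv g ((one_minus_laplacian ^^ k) h)"
  by (induction k) (auto simp: oml_fun_conv assms test_functions_oml_pow)

section \<open>Fourier transform and Gaussians\<close>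

lemma integrable_mult_cis:
  fixes f :: "'a::euclidean_space \<Rightarrow> complex"
  assumes "integrable lborel f"
  shows "integrable lborel (\<lambda>x. f x * exp (- (\<i> * complex_of_real (\<xi> \<bullet> x))))"
proof (rule Bochner_Integration.integrable_bound[OF assms])
  have [measurable]: "f \<in> borel_measurable borel" using assms borel_measurable_integrable by auto
  show "(\<lambda>x. f x * exp (- (\<i> * complex_of_real (\<xi> \<bullet> x)))) \<in> borel_measurable lborel" by measurable
qed (simp add: norm_mult)

lemma fourier_transform_fun_conv:
  fixes f g :: "'a::euclidean_space \<Rightarrow> real"
  assumes g: "integrable lborel g" and f: "integrable lborel f"
  shows "fourier_transform (\<lambda>x. complex_of_real (fun_conv g f x)) \<xi> =
    fourier_transform (\<lambda>x. complex_of_real (g x)) \<xi> * fourier_transform (\<lambda>x. complex_of_real (f x)) \<xi>"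
proof -
  define e where "e x = exp (- (\<i> * complex_of_real (\<xi> \<bullet> x)))" for x :: 'a
  have e_add: "e x = e (x - y) * e y" for x y
    by (simp add: e_def inner_diff_right exp_add[symmetric] algebra_simps)
  define fe where "fe y = complex_of_real (f y) * e y" for y
  define ge where "ge y = complex_of_real (g y) * e y" for y
  have fe: "integrable lborel fe" and ge: "integrable lborel ge"
    unfolding fe_def ge_def e_def by (intro integrable_mult_cis integrable_of_real f g)+
  have "fourier_transform (\<lambda>x. complex_of_real (fun_conv g f x)) \<xi> =
      (LINT x|lborel. LINT y|lborel. ge (x - y) * fe y)"
  proof -
    have "complex_of_real (fun_conv g f x) * e x = (LINT y|lborel. ge (x - y) * fe y)" for x
    proof -
      have "complex_of_real (fun_conv g f x) * e x = (LINT y|lborel. complex_of_real (g (x - y) * f y)) * e x"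
        by (simp only: fun_conv_def integral_complex_of_real)
      also have "\<dots> = (LINT y|lborel. complex_of_real (g (x - y) * f y) * e x)"
        by simp
      also have "\<dots> = (LINT y|lborel. ge (x - y) * fe y)"
      proof (rule Bochner_Integration.integral_cong[OF refl])
        fix y show "complex_of_real (g (x - y) * f y) * e x = ge (x - y) * fe y"
          using e_add[of x y] by (simp add: ge_def fe_def mult_ac)
      qed
      finally show ?thesis .
    qed
    then show ?thesis by (simp only: fourier_transform_def e_def[symmetric])
  qed
  also have "\<dots> = (LINT y|lborel. LINT x|lborel. ge (x - y) * fe y)"
    by (rule lborel_pair.Fubini_integral[of "\<lambda>y x. ge (x - y) * fe y"])
       (use integrable_conv_product[OF fe ge] in simp)
  also have "\<dots> = (LINT y|lborel. (LINT x|lborel. ge x) * fe y)"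
  proof (rule Bochner_Integration.integral_cong[OF refl])
    fix y
    show "(LINT x|lborel. ge (x - y) * fe y) = (LINT x|lborel. ge x) * fe y"
      using lborel_integral_translate[of ge "- y"] by simp
  qed
  also have "\<dots> = (LINT x|lborel. ge x) * (LINT x|lborel. fe x)" by simp
  finally show ?thesis by (simp add: fourier_transform_def ge_def fe_def e_def)
qed

lemma integrable_product_mult:
  fixes f :: "'a::euclidean_space \<Rightarrow> 'c::{real_normed_field, banach, second_countable_topology}"
    and g :: "'b::euclidean_space \<Rightarrow> 'c"
  assumes f: "integrable lborel f" and g: "integrable lborel g"
  shows "integrable (lborel \<Otimes>\<^sub>M lborel) (\<lambda>(y, x). f y * g x)"
proof (rule lborel_pair.Fubini_integrable)
  have [measurable]: "f \<in> borel_measurable borel" "g \<in> borel_measurable borel"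
    using f g borel_measurable_integrable by auto
  show "(\<lambda>(y, x). f y * g x) \<in> borel_measurable (lborel \<Otimes>\<^sub>M lborel)" by measurable
  show "integrable lborel (\<lambda>y. LINT x|lborel. norm (case (y, x) of (y, x) \<Rightarrow> f y * g x))"
    using f by (simp add: norm_mult)
  show "AE y in lborel. integrable lborel (\<lambda>x. case (y, x) of (y, x) \<Rightarrow> f y * g x)"
    using g by simp
qed

lemma lborel_integral_prod:
  fixes f :: "'a::euclidean_space \<Rightarrow> real \<Rightarrow> complex"
  assumes f: "\<And>b. b \<in> Basis \<Longrightarrow> integrable lborel (f b)"
  shows "(LINT x|lborel. (\<Prod>b\<in>Basis. f b (x \<bullet> b))) = (\<Prod>b\<in>Basis. (LINT x|lborel. f b x))"
proof -
  interpret product_sigma_finite "\<lambda>_::'a. lborel :: real measure"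
    by unfold_locales
  have [measurable]: "f b \<in> borel_measurable borel" if "b \<in> Basis" for b
    using f[OF that] borel_measurable_integrable by auto
  have "(LINT x|lborel. (\<Prod>b\<in>Basis. f b (x \<bullet> b))) =
      (LINT x|distr (\<Pi>\<^sub>M b\<in>Basis. lborel) borel (\<lambda>f. \<Sum>b\<in>Basis. f b *\<^sub>R b). (\<Prod>b\<in>Basis. f b (x \<bullet> b)))"
    by (simp only: lborel_eq[symmetric])
  also have "\<dots> = (LINT g|(\<Pi>\<^sub>M b\<in>Basis. lborel). (\<Prod>b\<in>Basis. f b ((\<Sum>b'\<in>Basis. g b' *\<^sub>R b') \<bullet> b)))"
    by (rule integral_distr) measurable
  also have "\<dots> = (LINT g|(\<Pi>\<^sub>M b\<in>Basis. lborel). (\<Prod>b\<in>Basis. f b (g b)))"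
    by (intro Bochner_Integration.integral_cong refl prod.cong) (simp add: inner_sum_left inner_Basis sum.delta if_distrib cong: if_cong)
  also have "\<dots> = (\<Prod>b\<in>Basis. (LINT x|lborel. f b x))"
    by (rule product_integral_prod) (use f in auto)
  finally show ?thesis .
qed

lemma norm_power2_eq_sum: "(norm (x::'a::euclidean_space))\<^sup>2 = (\<Sum>b\<in>Basis. (x \<bullet> b)\<^sup>2)"
  by (subst power2_norm_eq_inner, subst euclidean_inner) (simp add: power2_eq_square)

section \<open>Gaussians\<close>

text \<open>The heat kernel at time \<open>t\<close>. The variance \<open>2 * t\<close> in each
  coordinate is the one for which the Fourier transform is
  \<open>exp (- t * (norm \<xi>)\<^sup>2)\<close>.\<close>

definition gauss :: "real \<Rightarrow> 'a::euclidean_space \<Rightarrow> real" where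
  "gauss t x = (\<Prod>b\<in>Basis. normal_density 0 (sqrt (2 * t)) (x \<bullet> b))"

lemma gauss_nonneg: "gauss t x \<ge> 0"
  unfolding gauss_def by (intro prod_nonneg) auto

lemma gauss_eq:
  assumes "t > 0"
  shows "gauss t (x::'a::euclidean_space) = (4 * pi * t) powr (- real DIM('a) / 2) * exp (- (norm x)\<^sup>2 / (4 * t))"
proof -
  have "gauss t x = (\<Prod>b\<in>(Basis::'a set). (4 * pi * t) powr (- 1 / 2) * exp (- (x \<bullet> b)\<^sup>2 / (4 * t)))"
  proof -
    have "sqrt (2 * pi * (sqrt (2 * t))\<^sup>2) = (4 * pi * t) powr (1 / 2)"
      using assms by (simp add: powr_half_sqrt mult_ac)
    moreover have "2 * (sqrt (2 * t))\<^sup>2 = 4 * t" using assms by simp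
    ultimately show ?thesis
      unfolding gauss_def normal_density_def by (simp add: powr_minus_divide)
  qed
  also have "\<dots> = ((4 * pi * t) powr (- 1 / 2)) ^ DIM('a) * exp (\<Sum>b\<in>(Basis::'a set). - (x \<bullet> b)\<^sup>2 / (4 * t))"
    by (simp add: prod.distrib exp_sum)
  also have "((4 * pi * t) powr (- 1 / 2)) ^ DIM('a) = (4 * pi * t) powr (- real DIM('a) / 2)"
    using assms by (simp add: powr_powr flip: powr_realpow)
  also have "(\<Sum>b\<in>(Basis::'a set). - (x \<bullet> b)\<^sup>2 / (4 * t)) = - (norm x)\<^sup>2 / (4 * t)"
    by (simp add: norm_power2_eq_sum sum_negf sum_divide_distrib)
  finally show ?thesis .
qed

lemma gauss_measurable[measurable]:
  assumes [measurable]: "f \<in> borel_measurable M" "g \<in> M \<rightarrow>\<^sub>M borel"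
  shows "(\<lambda>x. gauss (f x) (g x)) \<in> borel_measurable M"
  unfolding gauss_def normal_density_def by measurable

lemma nn_integral_gauss:
  assumes "t > 0" shows "(\<integral>\<^sup>+x. ennreal (gauss t x) \<partial>lborel) = 1"
proof -
  have 1: "(\<integral>\<^sup>+x. ennreal (normal_density 0 (sqrt (2 * t)) x) \<partial>lborel) = 1"
    using assms by (subst nn_integral_eq_integral) auto
  have "(\<integral>\<^sup>+x. ennreal (gauss t (x::'a)) \<partial>lborel) =
      (\<integral>\<^sup>+x. (\<Prod>b\<in>Basis. ennreal (normal_density 0 (sqrt (2 * t)) ((x::'a) \<bullet> b))) \<partial>lborel)"
    by (simp add: gauss_def prod_ennreal)
  also have "\<dots> = 1" by (subst nn_integral_lborel_prod) (auto simp: 1)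
  finally show ?thesis .
qed

lemma integrable_gauss: "t > 0 \<Longrightarrow> integrable lborel (gauss t :: 'a::euclidean_space \<Rightarrow> real)"
  using nn_integral_gauss[of t, where ?'a='a] by (intro integrableI_nonneg) (auto simp: gauss_nonneg)

lemma integral_gauss: "t > 0 \<Longrightarrow> (LINT x|lborel. gauss t (x::'a::euclidean_space)) = 1"
  using nn_integral_gauss[of t, where ?'a='a] by (subst integral_eq_nn_integral) (auto simp: gauss_nonneg)

lemma integral_normal_density_cis:
  assumes "\<sigma> > 0"
  shows "(LINT x|lborel. complex_of_real (normal_density 0 \<sigma> x) * exp (- (\<i> * complex_of_real (s * x)))) =
    complex_of_real (exp (- (\<sigma> * s)\<^sup>2 / 2))"
proof -
  have "char std_normal_distribution (- \<sigma> * s) = complex_of_real (exp (- (\<sigma> * s)\<^sup>2 / 2))"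
    by (simp add: char_std_normal_distribution)
  also have "char std_normal_distribution (- \<sigma> * s) =
      (LINT x|lborel. std_normal_density x *\<^sub>R exp (\<i> * complex_of_real (- \<sigma> * s * x)))"
    unfolding char_def by (subst integral_density) auto
  also have "\<dots> = (LINT x|lborel. \<bar>\<sigma>\<bar> *\<^sub>R (complex_of_real (normal_density 0 \<sigma> (0 + \<sigma> * x)) * exp (- (\<i> * complex_of_real (s * (0 + \<sigma> * x))))))"
    using assms
    by (intro Bochner_Integration.integral_cong refl)
       (simp add: normal_density_def std_normal_density_def scaleR_conv_of_real real_sqrt_mult power_mult_distrib mult_ac)
  also have "\<dots> = (LINT x|lborel. complex_of_real (normal_density 0 \<sigma> x) * exp (- (\<i> * complex_of_real (s * x))))"
    using assms by (subst (2) lborel_integral_real_affine[of \<sigma> _ 0]) auto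
  finally show ?thesis by simp
qed

lemma fourier_transform_gauss:
  assumes "t > 0"
  shows "fourier_transform (\<lambda>x. complex_of_real (gauss t x)) \<xi> = complex_of_real (exp (- t * (norm \<xi>)\<^sup>2))"
proof -
  define f where "f b x = complex_of_real (normal_density 0 (sqrt (2 * t)) x) * exp (- (\<i> * complex_of_real ((\<xi> \<bullet> b) * x)))"
    for b and x :: real
  have f: "integrable lborel (f b)" for b
    unfolding f_def
    using integrable_mult_cis[of "\<lambda>x. complex_of_real (normal_density 0 (sqrt (2 * t)) x)" "\<xi> \<bullet> b"] assms
    by (simp add: integrable_of_real)
  have "complex_of_real (gauss t x) * exp (- (\<i> * complex_of_real (\<xi> \<bullet> x))) = (\<Prod>b\<in>Basis. f b (x \<bullet> b))" for x
  proof -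
    have "exp (- (\<i> * complex_of_real (\<xi> \<bullet> x))) = exp (\<Sum>b\<in>Basis. - (\<i> * complex_of_real ((\<xi> \<bullet> b) * (x \<bullet> b))))"
      by (subst euclidean_inner) (simp add: sum_negf sum_distrib_left)
    then show ?thesis by (simp add: exp_sum f_def gauss_def prod.distrib)
  qed
  then have "fourier_transform (\<lambda>x. complex_of_real (gauss t x)) \<xi> = (\<Prod>b\<in>Basis. (LINT x|lborel. f b x))"
    using f by (simp add: fourier_transform_def lborel_integral_prod)
  also have "\<dots> = (\<Prod>b\<in>Basis. complex_of_real (exp (- t * (\<xi> \<bullet> b)\<^sup>2)))"
    unfolding f_def using assms
    by (intro prod.cong refl) (subst integral_normal_density_cis, auto simp: power_mult_distrib)
  also have "\<dots> = complex_of_real (exp (\<Sum>b\<in>Basis. - t * (\<xi> \<bullet> b)\<^sup>2))"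
    by (simp add: exp_sum)
  also have "(\<Sum>b\<in>Basis. - t * (\<xi> \<bullet> b)\<^sup>2) = - t * (norm \<xi>)\<^sup>2"
    by (simp add: norm_power2_eq_sum sum_negf sum_distrib_left)
  finally show ?thesis .
qed

section \<open>Injectivity of the Fourier transform\<close>

lemma lborel_integral_scale:
  fixes f :: "'a::euclidean_space \<Rightarrow> real"
  assumes [measurable]: "f \<in> borel_measurable borel" and "c \<noteq> 0"
  shows "(LINT x|lborel. f x) = \<bar>c\<bar> ^ DIM('a) * (LINT x|lborel. f (c *\<^sub>R x))"
  by (subst lborel_affine[OF \<open>c \<noteq> 0\<close>, of 0])
     (simp add: integral_density integral_distr)

lemma gauss_scale:
  assumes "c > 0" shows "gauss (c\<^sup>2) (c *\<^sub>R x) * c ^ DIM('a) = gauss 1 (x::'a::euclidean_space)"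
proof -
  have "(4 * pi * c\<^sup>2) powr (- real DIM('a) / 2) = (4 * pi) powr (- real DIM('a) / 2) * (c powr 2) powr (- real DIM('a) / 2)"
    using assms by (simp add: powr_mult)
  also have "(c powr 2) powr (- real DIM('a) / 2) = inverse (c ^ DIM('a))"
    using assms by (simp only: powr_powr) (simp add: powr_minus powr_realpow)
  finally show ?thesis using assms
    by (subst (1 2) gauss_eq) (auto simp: power_mult_distrib)
qed

text \<open>A Gaussian at time \<open>(c n)\<^sup>2\<close> has width \<open>c n\<close>. Rescaling
  to unit time moves \<open>n\<close> into the argument of the indicator, which is eventually
  constant along \<open>y - c n *\<^sub>R w\<close> unless \<open>y\<close> is on the boundary of
  the box; the boundary is a null set.\<close>

lemma fun_conv_gauss_indicator_box_tendsto:
  fixes y a b :: "'a::euclidean_space"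
  assumes y: "y \<in> box a b \<or> y \<notin> cbox a b" and c: "c \<longlonglongrightarrow> 0" "\<And>n. c n > 0"
  shows "(\<lambda>n. fun_conv (gauss ((c n)\<^sup>2)) (indicator (box a b)) y) \<longlonglongrightarrow> indicator (box a b) y"
proof -
  have "fun_conv (gauss ((c n)\<^sup>2)) (indicator (box a b)) y = (LINT w|lborel. gauss 1 w * indicator (box a b) (y - c n *\<^sub>R w))" for n
  proof -
    have "fun_conv (gauss ((c n)\<^sup>2)) (indicator (box a b)) y = (LINT z|lborel. gauss ((c n)\<^sup>2) z * indicator (box a b) (y - z))"
      by (subst fun_conv_commute) (simp add: fun_conv_def mult.commute)
    also have "\<dots> = \<bar>c n\<bar> ^ DIM('a) * (LINT w|lborel. gauss ((c n)\<^sup>2) (c n *\<^sub>R w) * indicator (box a b) (y - c n *\<^sub>R w))"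
      by (rule lborel_integral_scale) (use c(2)[of n] in auto)
    also have "\<dots> = (LINT w|lborel. \<bar>c n\<bar> ^ DIM('a) * (gauss ((c n)\<^sup>2) (c n *\<^sub>R w) * indicator (box a b) (y - c n *\<^sub>R w)))"
      by simp
    also have "\<dots> = (LINT w|lborel. gauss 1 w * indicator (box a b) (y - c n *\<^sub>R w))"
      using c(2)[of n] by (intro Bochner_Integration.integral_cong refl) (simp add: gauss_scale[symmetric] mult_ac)
    finally show ?thesis .
  qed
  moreover have "(\<lambda>n. LINT w|lborel. gauss 1 w * indicator (box a b) (y - c n *\<^sub>R w)) \<longlonglongrightarrow> (LINT w|lborel. gauss 1 (w::'a) * indicator (box a b) y)"
  proof (rule integral_dominated_convergence[where w="gauss 1 :: 'a \<Rightarrow> real"])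
    show "AE w in lborel. (\<lambda>n. gauss 1 w * indicator (box a b) (y - c n *\<^sub>R w)) \<longlonglongrightarrow> gauss 1 w * indicator (box a b) y"
    proof (rule AE_I2)
      fix w
      have lim: "(\<lambda>n. y - c n *\<^sub>R w) \<longlonglongrightarrow> y" using c(1) by (auto intro!: tendsto_eq_intros)
      have "eventually (\<lambda>n. y - c n *\<^sub>R w \<in> box a b \<longleftrightarrow> y \<in> box a b) sequentially"
        using y
      proof
        assume "y \<in> box a b"
        with topological_tendstoD[OF lim open_box, of a b] show ?thesis by simp
      next
        assume "y \<notin> cbox a b"
        moreover have "open (- cbox a b)" by (rule open_Compl[OF closed_cbox])
        ultimately have "eventually (\<lambda>n. y - c n *\<^sub>R w \<in> - cbox a b) sequentially"
          using topological_tendstoD[OF lim, of "- cbox a b"] by simp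
        then show ?thesis
          by eventually_elim (use \<open>y \<notin> cbox a b\<close> box_subset_cbox[of a b] in auto)
      qed
      then have "eventually (\<lambda>n. gauss 1 w * indicator (box a b) (y - c n *\<^sub>R w) = gauss 1 w * indicator (box a b) y) sequentially"
        by eventually_elim (auto simp: indicator_def)
      then show "(\<lambda>n. gauss 1 w * indicator (box a b) (y - c n *\<^sub>R w)) \<longlonglongrightarrow> gauss 1 w * indicator (box a b) y"
        by (rule tendsto_eventually)
    qed
  qed (auto simp: integrable_gauss gauss_nonneg indicator_def)
  ultimately show ?thesis by (simp add: integral_gauss)
qed

lemma AE_lborel_box_or_not_cbox: "AE y in lborel. (y::'a::euclidean_space) \<in> box a b \<or> y \<notin> cbox a b"
proof (rule AE_I)
  show "{y \<in> space lborel. \<not> (y \<in> box a b \<or> y \<notin> cbox a b)} \<subseteq> cbox a b - box a b" by auto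
  show "cbox a b - box a b \<in> sets lborel" by simp
  have "emeasure lborel (cbox a b - box a b) = emeasure lborel (cbox a b) - emeasure lborel (box a b)"
    by (rule emeasure_Diff) (auto simp: box_subset_cbox emeasure_lborel_box_eq)
  also have "\<dots> = 0" by (auto simp: emeasure_lborel_box_eq emeasure_lborel_cbox_eq)
  finally show "emeasure lborel (cbox a b - box a b) = 0" .
qed

lemma bdint_indicator_box: "bdint (indicator (box a b))"
  by (rule bdintI[of _ 1]) (auto simp: emeasure_lborel_box_eq indicator_def)

text \<open>A Gaussian is a multiple of the Fourier transform of another Gaussian, so by Fubini the convolution
  with it sees \<open>f\<close> only through its Fourier transform.\<close>

lemma fourier_transform_0_imp_fun_conv_gauss_0:
  fixes f :: "'a::euclidean_space \<Rightarrow> real"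
  assumes f: "integrable lborel f" and t: "t > 0"
    and zero: "\<And>\<xi>. fourier_transform (\<lambda>x. complex_of_real (f x)) \<xi> = 0"
  shows "fun_conv f (gauss t) x = 0"
proof -
  define C where "C = complex_of_real ((4 * pi * t) powr (- real DIM('a) / 2))"
  \<comment> \<open>For this \<open>s\<close> the Fourier transform of \<open>gauss s\<close> at
    \<open>z\<close> is \<open>exp (- (norm z)\<^sup>2 / (4 * t))\<close>, that is,
    \<open>gauss t\<close> without its normalising factor \<open>C\<close>.\<close>
  define s where "s = 1 / (4 * t)"
  have s: "s > 0" using t by (simp add: s_def)
  have g: "complex_of_real (gauss t z) = C * (LINT \<zeta>|lborel. complex_of_real (gauss s \<zeta>) * exp (- (\<i> * complex_of_real (z \<bullet> \<zeta>))))" for z :: 'a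
    using fourier_transform_gauss[OF s, of z] gauss_eq[OF t, of z] by (simp add: fourier_transform_def C_def s_def)
  have F: "integrable (lborel \<Otimes>\<^sub>M lborel) (\<lambda>(y, \<zeta>). complex_of_real (f y) * (complex_of_real (gauss s \<zeta>) * exp (- (\<i> * complex_of_real ((x - y) \<bullet> \<zeta>)))))"
  proof (rule Bochner_Integration.integrable_bound[OF integrable_product_mult[of "\<lambda>y. complex_of_real (f y)" "\<lambda>\<zeta>. complex_of_real (gauss s \<zeta>)"]])
    have [measurable]: "f \<in> borel_measurable borel" using f borel_measurable_integrable by auto
    show "(\<lambda>(y, \<zeta>). complex_of_real (f y) * (complex_of_real (gauss s \<zeta>) * exp (- (\<i> * complex_of_real ((x - y) \<bullet> \<zeta>))))) \<in> borel_measurable (lborel \<Otimes>\<^sub>M lborel)"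
      by measurable
  qed (auto simp: norm_mult integrable_gauss[OF s] f integrable_of_real)
  have "complex_of_real (fun_conv f (gauss t) x) = complex_of_real (LINT y|lborel. gauss t (x - y) * f y)"
    by (subst fun_conv_commute) (simp add: fun_conv_def)
  also have "\<dots> = (LINT y|lborel. complex_of_real (f y) * complex_of_real (gauss t (x - y)))"
    by (simp flip: integral_complex_of_real add: mult.commute)
  also have "\<dots> = C * (LINT y|lborel. LINT \<zeta>|lborel. complex_of_real (f y) * (complex_of_real (gauss s \<zeta>) * exp (- (\<i> * complex_of_real ((x - y) \<bullet> \<zeta>)))))"
    by (simp add: g mult.left_commute[of _ C])
  also have "(LINT y|lborel. LINT \<zeta>|lborel. complex_of_real (f y) * (complex_of_real (gauss s \<zeta>) * exp (- (\<i> * complex_of_real ((x - y) \<bullet> \<zeta>)))))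
     = (LINT \<zeta>|lborel. LINT y|lborel. complex_of_real (f y) * (complex_of_real (gauss s \<zeta>) * exp (- (\<i> * complex_of_real ((x - y) \<bullet> \<zeta>)))))"
    by (rule lborel_pair.Fubini_integral[symmetric]) (rule F)
  also have "\<dots> = (LINT \<zeta>|lborel. complex_of_real (gauss s \<zeta>) * exp (- (\<i> * complex_of_real (x \<bullet> \<zeta>))) *
      fourier_transform (\<lambda>x. complex_of_real (f x)) (- \<zeta>))"
  proof (rule Bochner_Integration.integral_cong[OF refl])
    fix \<zeta> :: 'a
    have "(LINT y|lborel. complex_of_real (f y) * (complex_of_real (gauss s \<zeta>) * exp (- (\<i> * complex_of_real ((x - y) \<bullet> \<zeta>)))))
       = (LINT y|lborel. (complex_of_real (gauss s \<zeta>) * exp (- (\<i> * complex_of_real (x \<bullet> \<zeta>)))) * (complex_of_real (f y) * exp (- (\<i> * complex_of_real ((- \<zeta>) \<bullet> y)))))"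
      by (intro Bochner_Integration.integral_cong refl)
         (simp add: inner_diff_left exp_add[symmetric] algebra_simps exp_diff exp_minus inner_commute field_simps)
    then show "(LINT y|lborel. complex_of_real (f y) * (complex_of_real (gauss s \<zeta>) * exp (- (\<i> * complex_of_real ((x - y) \<bullet> \<zeta>)))))
      = complex_of_real (gauss s \<zeta>) * exp (- (\<i> * complex_of_real (x \<bullet> \<zeta>))) * fourier_transform (\<lambda>x. complex_of_real (f x)) (- \<zeta>)"
      by (simp add: fourier_transform_def)
  qed
  also have "\<dots> = 0" by (simp add: zero)
  finally show ?thesis by simp
qed

text \<open>By associativity, \<open>f\<close> convolved with a Gaussian-smoothed box indicator
  equals the vanishing convolution of \<open>f\<close> and the Gaussian, convolved with that
  indicator. Letting the width of the Gaussian tend to 0 kills all box integrals. The reflected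
  \<open>f (- x)\<close> appears because the pairing with an indicator is a convolution evaluated at
  0.\<close>

lemma fourier_transform_0_imp_AE_0:
  fixes f :: "'a::euclidean_space \<Rightarrow> real"
  assumes f: "integrable lborel f"
    and zero: "\<And>\<xi>. fourier_transform (\<lambda>x. complex_of_real (f x)) \<xi> = 0"
  shows "AE x in lborel. f x = 0"
proof -
  have [measurable]: "f \<in> borel_measurable borel" using f borel_measurable_integrable by auto
  define c where "c n = 1 / real (Suc n)" for n
  have c: "c \<longlonglongrightarrow> 0" "\<And>n. c n > 0"
    unfolding c_def by (rule lim_1_over_n[THEN LIMSEQ_Suc], simp)
  have fm: "integrable lborel (\<lambda>x. f (- x))" using lborel_integrable_reflect[OF f, of 0] by simp
  have "AE x in lborel. f (- x) = 0"
  proof (rule AE_lborel_eq_0_if_box_integrals_eq_0)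
    fix a b :: 'a
    let ?i = "indicator (box a b) :: 'a \<Rightarrow> real"
    show "integrable lborel (\<lambda>x. f (- x) * ?i x)"
      by (rule integrable_mult_bounded[OF fm, of _ 1]) (auto simp: indicator_def)
    have "(\<lambda>n. LINT y|lborel. f (- y) * fun_conv (gauss ((c n)\<^sup>2)) ?i y) \<longlonglongrightarrow> (LINT y|lborel. f (- y) * ?i y)"
    proof (rule integral_dominated_convergence[where w="\<lambda>y. \<bar>f (- y)\<bar>"])
      have "fun_conv (gauss ((c n)\<^sup>2)) ?i \<in> borel_measurable borel" for n
        by (intro bdint_measurable bdint_fun_conv integrable_gauss bdint_indicator_box) (use c(2)[of n] in simp)
      then show "(\<lambda>y. f (- y) * fun_conv (gauss ((c n)\<^sup>2)) ?i y) \<in> borel_measurable lborel" for n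
        by simp
      show "AE y in lborel. (\<lambda>n. f (- y) * fun_conv (gauss ((c n)\<^sup>2)) ?i y) \<longlonglongrightarrow> f (- y) * ?i y"
        using AE_lborel_box_or_not_cbox
        by eventually_elim (intro tendsto_intros fun_conv_gauss_indicator_box_tendsto c)
      have "\<bar>fun_conv (gauss ((c n)\<^sup>2)) ?i y\<bar> \<le> 1" for n y
        using abs_fun_conv_le[OF integrable_gauss, of "(c n)\<^sup>2" ?i 1 y] c(2)[of n] integral_gauss[of "(c n)\<^sup>2", where ?'a='a]
        by (simp add: gauss_nonneg indicator_def)
      then show "AE y in lborel. norm (f (- y) * fun_conv (gauss ((c n)\<^sup>2)) ?i y) \<le> \<bar>f (- y)\<bar>" for n
        by (intro AE_I2) (simp add: abs_mult mult_left_le)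
    qed (use fm in auto)
    moreover have "(LINT y|lborel. f (- y) * fun_conv (gauss ((c n)\<^sup>2)) ?i y) = 0" for n
    proof -
      have "(LINT y|lborel. f (- y) * fun_conv (gauss ((c n)\<^sup>2)) ?i y) = fun_conv f (fun_conv (gauss ((c n)\<^sup>2)) ?i) 0"
        by (simp add: fun_conv_def)
      also have "\<dots> = fun_conv (fun_conv f (gauss ((c n)\<^sup>2))) ?i 0"
        by (intro fun_conv_assoc f integrable_gauss bdint_indicator_box) (use c(2)[of n] in simp)
      also have "fun_conv f (gauss ((c n)\<^sup>2)) = (\<lambda>x. 0)"
        using c(2)[of n] by (intro ext fourier_transform_0_imp_fun_conv_gauss_0[OF f _ zero]) simp
      finally show ?thesis by (simp add: fun_conv_def)
    qed
    ultimately show "(LINT x|lborel. f (- x) * ?i x) = 0"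
      by (simp add: LIMSEQ_const_iff)
  qed measurable
  from AE_lborel_reflect[OF this, of 0] show ?thesis by simp
qed

lemma fourier_transform_inj:
  fixes f g :: "'a::euclidean_space \<Rightarrow> real"
  assumes "integrable lborel f" "integrable lborel g"
    and "\<And>\<xi>. fourier_transform (\<lambda>x. complex_of_real (f x)) \<xi> = fourier_transform (\<lambda>x. complex_of_real (g x)) \<xi>"
  shows "AE x in lborel. f x = g x"
proof -
  have "fourier_transform (\<lambda>x. complex_of_real (f x - g x)) \<xi> = 0" for \<xi>
  proof -
    have "fourier_transform (\<lambda>x. complex_of_real (f x - g x)) \<xi> =
       fourier_transform (\<lambda>x. complex_of_real (f x)) \<xi> - fourier_transform (\<lambda>x. complex_of_real (g x)) \<xi>"
      unfolding fourier_transform_def of_real_diff left_diff_distrib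
      by (rule Bochner_Integration.integral_diff) (intro integrable_mult_cis integrable_of_real assms)+
    with assms(3) show ?thesis by simp
  qed
  from fourier_transform_0_imp_AE_0[OF _ this] assms(1,2) show ?thesis by simp
qed

section \<open>The Bessel kernel\<close>

text \<open>The density of the Gamma distribution with shape \<alpha>/2. It is the subordination
  weight: heat kernels averaged over time with this weight form the Bessel kernel.\<close>

definition bessel_weight :: "real \<Rightarrow> real \<Rightarrow> real" where
  "bessel_weight \<alpha> t = indicator {0<..} t * (t powr (\<alpha> / 2 - 1) * exp (- t) / Gamma (\<alpha> / 2))"

lemma bessel_weight_nonneg: "\<alpha> > 0 \<Longrightarrow> bessel_weight \<alpha> t \<ge> 0"
  unfolding bessel_weight_def by (intro mult_nonneg_nonneg divide_nonneg_nonneg) (auto intro: Gamma_real_nonneg)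

lemma bessel_weight_measurable[measurable]: "bessel_weight \<alpha> \<in> borel_measurable borel"
  unfolding bessel_weight_def[abs_def] by measurable

text \<open>The Gamma integral after the substitution \<open>t \<mapsto> s * t\<close> with
  \<open>s = 1 + r\<close>. It will be used with \<open>r = 0\<close> for the total mass and with
  \<open>r = (norm \<xi>)\<^sup>2\<close> for the Fourier transform.\<close>

lemma nn_integral_bessel_weight:
  assumes \<alpha>: "\<alpha> > 0" and r: "r \<ge> 0"
  shows "(\<integral>\<^sup>+t. ennreal (bessel_weight \<alpha> t * exp (- t * r)) \<partial>lborel) = ennreal ((1 + r) powr (- \<alpha> / 2))"
proof -
  define a s where "a = \<alpha> / 2" and "s = 1 + r"
  have a: "a > 0" and s: "s > 0" using \<alpha> r by (auto simp: a_def s_def)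
  have G: "Gamma a > 0" using a by (rule Gamma_real_pos)
  define I where "I = (\<integral>\<^sup>+t. ennreal (indicator {0..} (s * t) * (s * t) powr (a - 1) / exp (s * t)) \<partial>lborel)"
  have "ennreal (Gamma a) = ennreal s * I"
    unfolding I_def using Gamma_conv_nn_integral_real[OF a] s
    by (subst (asm) nn_integral_real_affine[of _ s 0]) auto
  moreover have "I = ennreal (1 / s) * (ennreal s * I)"
    using s by (simp flip: mult.assoc ennreal_mult')
  ultimately have "I = ennreal (1 / s) * ennreal (Gamma a)" by simp
  then have I: "I = ennreal (Gamma a / s)" using s G by (simp flip: ennreal_mult')
  have "(\<integral>\<^sup>+t. ennreal (bessel_weight \<alpha> t * exp (- t * r)) \<partial>lborel) =
      (\<integral>\<^sup>+t. ennreal (s powr (1 - a) / Gamma a) * ennreal (indicator {0..} (s * t) * (s * t) powr (a - 1) / exp (s * t)) \<partial>lborel)"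
  proof (rule nn_integral_cong_AE, use AE_lborel_singleton[of "0::real"] in eventually_elim)
    fix t :: real assume "t \<noteq> 0"
    then have "bessel_weight \<alpha> t * exp (- t * r) = s powr (1 - a) / Gamma a * (indicator {0..} (s * t) * (s * t) powr (a - 1) / exp (s * t))"
    proof (cases "t > 0")
      case True
      have "s powr (1 - a) * (s * t) powr (a - 1) = t powr (a - 1)"
        using True s by (simp add: powr_mult mult.assoc[symmetric] flip: powr_add)
      moreover have "exp (- t) * exp (- t * r) = 1 / exp (s * t)"
        by (simp add: s_def exp_minus exp_add[symmetric] field_simps)
      moreover have "indicator {0..} (s * t) = (1::real)" using True s by simp
      ultimately show ?thesis using True
        by (simp add: bessel_weight_def a_def[symmetric] mult.assoc mult.left_commute[of "exp _"])
           (simp_all add: mult_ac)?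
    next
      case False
      with \<open>t \<noteq> 0\<close> have "t < 0" by simp
      then have "s * t < 0" using s by (simp add: mult_pos_neg)
      then show ?thesis using \<open>t < 0\<close> by (simp add: bessel_weight_def)
    qed
    then show "ennreal (bessel_weight \<alpha> t * exp (- t * r)) = ennreal (s powr (1 - a) / Gamma a) * ennreal (indicator {0..} (s * t) * (s * t) powr (a - 1) / exp (s * t))"
      using G by (simp flip: ennreal_mult')
  qed
  also have "\<dots> = ennreal (s powr (1 - a) / Gamma a) * I"
    unfolding I_def by (rule nn_integral_cmult) measurable
  also have "\<dots> = ennreal (s powr (1 - a) / s)" using G s by (simp add: I flip: ennreal_mult')
  also have "s powr (1 - a) / s = s powr (- a)" using s by (simp add: powr_diff powr_minus_divide)
  finally show ?thesis by (simp add: a_def s_def)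
qed

text \<open>A fixed representative of the kernel. As a superposition of Gaussians it is lower
  semicontinuous and radially decreasing at every point, and its values in
  \<open>[0, \<infinity>]\<close> let Tonelli's theorem be applied without any prior
  finiteness.\<close>

definition bessel_kernel_nn :: "real \<Rightarrow> 'a::euclidean_space \<Rightarrow> ennreal" where
  "bessel_kernel_nn \<alpha> z = (\<integral>\<^sup>+t. ennreal (bessel_weight \<alpha> t * gauss t z) \<partial>lborel)"

text \<open>At the origin the kernel is infinite for \<open>\<alpha> \<le> d\<close>; its real version is \<open>0\<close> there, so singular measures
  are convolved with the extended version only.\<close>

definition bessel_kernel_real :: "real \<Rightarrow> 'a::euclidean_space \<Rightarrow> real" where
  "bessel_kernel_real \<alpha> z = enn2real (bessel_kernel_nn \<alpha> z)"

lemma bessel_kernel_nn_measurable[measurable]: "bessel_kernel_nn \<alpha> \<in> borel_measurable borel"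
  unfolding bessel_kernel_nn_def[abs_def] by measurable

lemma bessel_kernel_real_measurable[measurable]: "bessel_kernel_real \<alpha> \<in> borel_measurable borel"
  unfolding bessel_kernel_real_def[abs_def] by measurable

lemma bessel_kernel_real_nonneg: "bessel_kernel_real \<alpha> z \<ge> 0"
  by (simp add: bessel_kernel_real_def)

lemma gauss_uminus: "t > 0 \<Longrightarrow> gauss t (- z) = gauss t z"
  by (simp add: gauss_eq)

lemma bessel_weight_gauss_cong:
  assumes "\<And>t. t > 0 \<Longrightarrow> gauss t z = gauss t z'"
  shows "bessel_weight \<alpha> t * gauss t z = bessel_weight \<alpha> t * gauss t z'"
  using assms by (cases "t > 0") (auto simp: bessel_weight_def)

lemma bessel_kernel_nn_uminus: "bessel_kernel_nn \<alpha> (- z) = bessel_kernel_nn \<alpha> z"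
  unfolding bessel_kernel_nn_def
  by (intro nn_integral_cong arg_cong[of _ _ ennreal] bessel_weight_gauss_cong gauss_uminus)

lemma bessel_kernel_real_uminus: "bessel_kernel_real \<alpha> (- z) = bessel_kernel_real \<alpha> z"
  by (simp add: bessel_kernel_real_def bessel_kernel_nn_uminus)

lemma bessel_kernel_real_eq_integral:
  assumes "\<alpha> > 0"
  shows "bessel_kernel_real \<alpha> z = (LINT t|lborel. bessel_weight \<alpha> t * gauss t z)"
  unfolding bessel_kernel_real_def bessel_kernel_nn_def
  by (subst integral_eq_nn_integral) (auto simp: assms bessel_weight_nonneg gauss_nonneg)

lemma nn_integral_bessel_kernel_nn:
  assumes "\<alpha> > 0"
  shows "(\<integral>\<^sup>+z. bessel_kernel_nn \<alpha> (z::'a::euclidean_space) \<partial>lborel) = 1"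
proof -
  have "(\<integral>\<^sup>+z. bessel_kernel_nn \<alpha> (z::'a) \<partial>lborel) =
      (\<integral>\<^sup>+t. \<integral>\<^sup>+z. ennreal (bessel_weight \<alpha> t * gauss t (z::'a)) \<partial>lborel \<partial>lborel)"
    unfolding bessel_kernel_nn_def by (rule lborel_pair.Fubini') measurable
  also have "\<dots> = (\<integral>\<^sup>+t. ennreal (bessel_weight \<alpha> t * exp (- t * 0)) \<partial>lborel)"
  proof (rule nn_integral_cong)
    fix t
    have "(\<integral>\<^sup>+z. ennreal (bessel_weight \<alpha> t * gauss t (z::'a)) \<partial>lborel) =
        ennreal (bessel_weight \<alpha> t) * (\<integral>\<^sup>+z. ennreal (gauss t (z::'a)) \<partial>lborel)"
      by (subst nn_integral_cmult[symmetric]) (auto simp: ennreal_mult' bessel_weight_nonneg assms)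
    also have "\<dots> = ennreal (bessel_weight \<alpha> t)"
      using nn_integral_gauss[of t, where ?'a='a] by (cases "t > 0") (auto simp: bessel_weight_def)
    finally show "(\<integral>\<^sup>+z. ennreal (bessel_weight \<alpha> t * gauss t (z::'a)) \<partial>lborel) = ennreal (bessel_weight \<alpha> t * exp (- t * 0))"
      by simp
  qed
  also have "\<dots> = 1" using nn_integral_bessel_weight[OF assms, of 0] by simp
  finally show ?thesis .
qed

lemma AE_bessel_kernel_real:
  assumes "\<alpha> > 0"
  shows "AE z in lborel. ennreal (bessel_kernel_real \<alpha> (z::'a::euclidean_space)) = bessel_kernel_nn \<alpha> z"
proof -
  have "AE z in lborel. bessel_kernel_nn \<alpha> (z::'a) \<noteq> \<infinity>"
    by (rule nn_integral_PInf_AE) (auto simp: nn_integral_bessel_kernel_nn[OF assms])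
  then show ?thesis by eventually_elim (simp add: bessel_kernel_real_def less_top)
qed

lemma integrable_bessel_kernel_real:
  assumes "\<alpha> > 0" shows "integrable lborel (bessel_kernel_real \<alpha> :: 'a::euclidean_space \<Rightarrow> real)"
proof (rule integrableI_nonneg)
  have "(\<integral>\<^sup>+z. ennreal (bessel_kernel_real \<alpha> (z::'a)) \<partial>lborel) = (\<integral>\<^sup>+z. bessel_kernel_nn \<alpha> (z::'a) \<partial>lborel)"
    by (rule nn_integral_cong_AE[OF AE_bessel_kernel_real[OF assms]])
  then show "(\<integral>\<^sup>+z. ennreal (bessel_kernel_real \<alpha> (z::'a)) \<partial>lborel) < \<infinity>"
    by (simp add: nn_integral_bessel_kernel_nn[OF assms])
qed (auto simp: bessel_kernel_real_nonneg)

text \<open>Fubini exchanges heat time and space. For fixed time the inner integral is the transform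
  of a Gaussian, and integrating that against the weight is the Gamma integral with
  \<open>r = (norm \<xi>)\<^sup>2\<close>.\<close>

lemma fourier_transform_bessel_kernel_real:
  fixes \<xi> :: "'a::euclidean_space"
  assumes \<alpha>: "\<alpha> > 0"
  shows "fourier_transform (\<lambda>x. complex_of_real (bessel_kernel_real \<alpha> x)) \<xi> =
    complex_of_real ((1 + (norm \<xi>)\<^sup>2) powr (- \<alpha> / 2))"
proof -
  define e where "e x = exp (- (\<i> * complex_of_real (\<xi> \<bullet> x)))" for x :: 'a
  have [measurable]: "e \<in> borel_measurable borel" unfolding e_def[abs_def] by measurable
  have ne: "norm (e x) = 1" for x by (simp add: e_def)
  have gint: "integrable lborel (\<lambda>z. bessel_weight \<alpha> t * gauss t (z::'a))" for t
    by (cases "t > 0") (auto simp: bessel_weight_def integrable_gauss)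
  have wint: "integrable lborel (bessel_weight \<alpha>)"
    using nn_integral_bessel_weight[OF \<alpha>, of 0] by (intro integrableI_nonneg) (auto simp: bessel_weight_nonneg \<alpha>)
  have gI: "(LINT z|lborel. bessel_weight \<alpha> t * gauss t (z::'a)) = bessel_weight \<alpha> t" for t
    using integral_gauss[of t, where ?'a='a] by (cases "t > 0") (auto simp: bessel_weight_def)
  have F: "integrable (lborel \<Otimes>\<^sub>M lborel) (\<lambda>(t, z). complex_of_real (bessel_weight \<alpha> t * gauss t z) * e z)"
  proof (rule lborel_pair.Fubini_integrable)
    have "(LINT z|lborel. norm (complex_of_real (bessel_weight \<alpha> t * gauss t z) * e z)) = bessel_weight \<alpha> t" for t
    proof -
      have "norm (complex_of_real (bessel_weight \<alpha> t * gauss t z) * e z) = bessel_weight \<alpha> t * gauss t z" for z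
        by (simp add: norm_mult ne bessel_weight_nonneg[OF \<alpha>] gauss_nonneg del: of_real_mult)
      then show ?thesis by (simp only: gI)
    qed
    then show "integrable lborel (\<lambda>t. LINT z|lborel. norm (case (t, z) of (t, z) \<Rightarrow> complex_of_real (bessel_weight \<alpha> t * gauss t z) * e z))"
      using wint by simp
    show "AE t in lborel. integrable lborel (\<lambda>z. case (t, z) of (t, z) \<Rightarrow> complex_of_real (bessel_weight \<alpha> t * gauss t z) * e z)"
      unfolding e_def prod.case by (intro AE_I2 integrable_mult_cis integrable_of_real gint)
  qed measurable
  have "fourier_transform (\<lambda>x. complex_of_real (bessel_kernel_real \<alpha> x)) \<xi> =
      (LINT z|lborel. LINT t|lborel. complex_of_real (bessel_weight \<alpha> t * gauss t z) * e z)"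
    by (simp only: fourier_transform_def e_def[symmetric] bessel_kernel_real_eq_integral[OF \<alpha>]
        integral_complex_of_real[symmetric] integral_mult_left_zero[symmetric])
  also have "\<dots> = (LINT t|lborel. LINT z|lborel. complex_of_real (bessel_weight \<alpha> t * gauss t z) * e z)"
    by (rule lborel_pair.Fubini_integral[OF F])
  also have "\<dots> = (LINT t|lborel. complex_of_real (bessel_weight \<alpha> t * exp (- t * (norm \<xi>)\<^sup>2)))"
  proof (rule Bochner_Integration.integral_cong[OF refl])
    fix t
    have "(LINT z|lborel. complex_of_real (bessel_weight \<alpha> t * gauss t z) * e z) =
      complex_of_real (bessel_weight \<alpha> t) * fourier_transform (\<lambda>x. complex_of_real (gauss t x)) \<xi>"
      by (simp add: fourier_transform_def e_def[symmetric] mult.assoc)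
    then show "(LINT z|lborel. complex_of_real (bessel_weight \<alpha> t * gauss t z) * e z) = complex_of_real (bessel_weight \<alpha> t * exp (- t * (norm \<xi>)\<^sup>2))"
      by (cases "t > 0") (simp_all add: fourier_transform_gauss bessel_weight_def)
  qed
  also have "\<dots> = complex_of_real (LINT t|lborel. bessel_weight \<alpha> t * exp (- t * (norm \<xi>)\<^sup>2))"
    by (rule integral_complex_of_real)
  also have "(LINT t|lborel. bessel_weight \<alpha> t * exp (- t * (norm \<xi>)\<^sup>2)) = (1 + (norm \<xi>)\<^sup>2) powr (- \<alpha> / 2)"
    using nn_integral_bessel_weight[OF \<alpha>, of "(norm \<xi>)\<^sup>2"]
    by (subst integral_eq_nn_integral) (auto simp: bessel_weight_nonneg[OF \<alpha>])
  finally show ?thesis .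
qed

text \<open>The heat-time integral is a witness for the description behind
  \<open>bessel_kernel\<close>, so the chosen function has the defining properties.\<close>

lemma bessel_kernel_props:
  fixes \<alpha> :: real
  assumes "\<alpha> > 0"
  shows "integrable lborel (bessel_kernel \<alpha> :: 'a::euclidean_space \<Rightarrow> real)"
    and "fourier_transform (\<lambda>x. complex_of_real (bessel_kernel \<alpha> x)) (\<xi>::'a) =
           complex_of_real ((1 + (norm \<xi>)\<^sup>2) powr (- \<alpha> / 2))"
  using someI[of "\<lambda>g::'a \<Rightarrow> real. integrable lborel g \<and>
     (\<forall>\<xi>. fourier_transform (\<lambda>x. complex_of_real (g x)) \<xi> =
           complex_of_real ((1 + (norm \<xi>)\<^sup>2) powr (- \<alpha> / 2)))" "bessel_kernel_real \<alpha>"]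
    integrable_bessel_kernel_real[OF assms, where ?'a='a]
    fourier_transform_bessel_kernel_real[OF assms, where ?'a='a]
  unfolding bessel_kernel_def by blast+

lemma AE_bessel_kernel_eq:
  assumes "\<alpha> > 0" shows "AE x in lborel. bessel_kernel \<alpha> x = bessel_kernel_real \<alpha> (x::'a::euclidean_space)"
  by (rule fourier_transform_inj)
     (simp_all add: bessel_kernel_props assms integrable_bessel_kernel_real fourier_transform_bessel_kernel_real)

text \<open>By injectivity of the Fourier transform the chosen kernel and the explicit one agree
  almost everywhere, and \<open>y \<mapsto> x - y\<close> preserves null sets; the two convolutions
  therefore agree at every \<open>x\<close>.\<close>

lemma fun_conv_bessel_kernel_eq:
  assumes \<alpha>: "\<alpha> > 0" and [measurable]: "f \<in> borel_measurable borel"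
  shows "fun_conv (bessel_kernel \<alpha>) f x = fun_conv (bessel_kernel_real \<alpha>) f (x::'a::euclidean_space)"
  unfolding fun_conv_def
proof (rule integral_cong_AE)
  have [measurable]: "(bessel_kernel \<alpha> :: 'a \<Rightarrow> real) \<in> borel_measurable borel"
    using bessel_kernel_props(1)[OF \<alpha>] borel_measurable_integrable by auto
  show "(\<lambda>y. bessel_kernel \<alpha> (x - y) * f y) \<in> borel_measurable lborel" by measurable
  show "(\<lambda>y. bessel_kernel_real \<alpha> (x - y) * f y) \<in> borel_measurable lborel" by measurable
  show "AE y in lborel. bessel_kernel \<alpha> (x - y) * f y = bessel_kernel_real \<alpha> (x - y) * f y"
    using AE_lborel_reflect[OF AE_bessel_kernel_eq[OF \<alpha>], of x] by eventually_elim simp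
qed

section \<open>Fourier transforms of derivatives\<close>

text \<open>Translation replaces integration by parts: the transform of the difference quotient with
  increment \<open>c n *\<^sub>R v\<close> is the transform of \<open>\<phi>\<close> times a
  difference quotient of a complex exponential, and both sides converge as \<open>c n\<close> tends
  to 0.\<close>

lemma fourier_transform_dderiv:
  fixes \<phi> :: "'a::euclidean_space \<Rightarrow> real"
  assumes \<phi>: "\<phi> \<in> test_functions"
  shows "fourier_transform (\<lambda>x. complex_of_real (dderiv v \<phi> x)) \<xi> =
    \<i> * complex_of_real (\<xi> \<bullet> v) * fourier_transform (\<lambda>x. complex_of_real (\<phi> x)) \<xi>"
proof -
  define e where "e x = exp (- (\<i> * complex_of_real (\<xi> \<bullet> x)))" for x :: 'a
  have [measurable]: "e \<in> borel_measurable borel" unfolding e_def[abs_def] by measurable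
  have ne: "norm (e x) = 1" for x by (simp add: e_def)
  define F where "F = fourier_transform (\<lambda>x. complex_of_real (\<phi> x)) \<xi>"
  define c where "c n = 1 / real (Suc n)" for n
  have c: "c \<longlonglongrightarrow> 0" "\<And>n. c n > 0" "\<And>n. c n \<le> 1"
    unfolding c_def by (rule lim_1_over_n[THEN LIMSEQ_Suc], simp, simp)
  have s: "smooth \<phi>" using test_functions_smooth[OF \<phi>] .
  obtain R where R: "R > 0" "\<And>x. norm x \<ge> R \<Longrightarrow> \<phi> x = 0" using test_functions_supportE[OF \<phi>] by blast
  obtain B where B: "\<And>b x. b \<in> Basis \<Longrightarrow> \<bar>dderiv b \<phi> x\<bar> \<le> B"
    by (rule test_functions_dderiv_boundedE[OF \<phi>]) (rule that)
  define M where "M = real DIM('a) * B * norm v"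
  have lip: "\<bar>\<phi> (x + c n *\<^sub>R v) - \<phi> x\<bar> \<le> c n * M" for x n
    using smooth_dderiv_lipschitz(2)[OF s B, of x "c n *\<^sub>R v"] c(2)[of n] by (simp add: M_def mult_ac)
  have [measurable]: "\<phi> \<in> borel_measurable borel" "dderiv v \<phi> \<in> borel_measurable borel"
    by (intro bdint_measurable test_functions_bdint \<phi> test_functions_dderiv)+
  have "(\<lambda>n. LINT x|lborel. complex_of_real ((\<phi> (c n *\<^sub>R v + x) - \<phi> x) / c n) * e x) \<longlonglongrightarrow> (LINT x|lborel. complex_of_real (dderiv v \<phi> x) * e x)"
  \<comment> \<open>Since \<open>c n \<le> 1\<close>, all translated supports lie in the ball of
    radius \<open>R + norm v\<close>, on which the Lipschitz bound \<open>M\<close> controls every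
    difference quotient.\<close>
  proof (rule integral_dominated_convergence[where w="\<lambda>x. M * indicator (cball 0 (R + norm v)) x"])
    have "emeasure lborel (cball (0::'a) (R + norm v)) < \<infinity>"
      by (intro emeasure_compact_finite) auto
    then show "integrable lborel (\<lambda>x::'a. M * indicator (cball 0 (R + norm v)) x)"
      by (intro integrable_mult_right integrable_real_indicator) auto
    show "AE x in lborel. (\<lambda>n. complex_of_real ((\<phi> (c n *\<^sub>R v + x) - \<phi> x) / c n) * e x) \<longlonglongrightarrow> complex_of_real (dderiv v \<phi> x) * e x"
    proof (intro AE_I2 tendsto_mult tendsto_of_real tendsto_const)
      fix x
      have "((\<lambda>s. \<phi> (x + s *\<^sub>R v)) has_derivative (\<lambda>s. dderiv (s *\<^sub>R v) \<phi> (x + 0 *\<^sub>R v))) (at 0)"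
        by (rule has_derivative_compose[OF _ has_derivative_dderiv[OF smooth_differentiable[OF s]]])
           (auto intro!: derivative_eq_intros)
      also have "(\<lambda>s. dderiv (s *\<^sub>R v) \<phi> (x + 0 *\<^sub>R v)) = (\<lambda>s. dderiv v \<phi> x * s)"
        using linear_cmul[OF has_derivative_linear[OF has_derivative_dderiv[OF smooth_differentiable[OF s]]]] by (auto simp: mult.commute)
      finally have "((\<lambda>s. \<phi> (x + s *\<^sub>R v)) has_field_derivative dderiv v \<phi> x) (at 0)"
        by (simp add: has_field_derivative_def mult_commute_abs)
      then have "(\<lambda>h. (\<phi> (x + (0 + h) *\<^sub>R v) - \<phi> (x + 0 *\<^sub>R v)) / h) \<midarrow>0\<rightarrow> dderiv v \<phi> x"
        by (simp add: DERIV_def)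
      then have "((\<lambda>h. (\<phi> (x + h *\<^sub>R v) - \<phi> x) / h) \<circ> c) \<longlonglongrightarrow> dderiv v \<phi> x"
        unfolding tendsto_at_iff_sequentially using c(1,2) by (force simp: less_imp_neq[symmetric])
      then show "(\<lambda>n. (\<phi> (c n *\<^sub>R v + x) - \<phi> x) / c n) \<longlonglongrightarrow> dderiv v \<phi> x"
        by (simp add: comp_def add.commute)
    qed
    show "AE x in lborel. norm (complex_of_real ((\<phi> (c n *\<^sub>R v + x) - \<phi> x) / c n) * e x) \<le> M * indicator (cball 0 (R + norm v)) x" for n
    proof (rule AE_I2)
      fix x
      have "\<bar>(\<phi> (x + c n *\<^sub>R v) - \<phi> x) / c n\<bar> \<le> M * indicator (cball 0 (R + norm v)) x"
      proof (cases "norm x \<le> R + norm v")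
        case True
        then show ?thesis using lip[of x n] c(2)[of n] by (simp add: field_simps)
      next
        case False
        have "norm (c n *\<^sub>R v) \<le> norm v" using c(2,3)[of n] by (simp add: mult_left_le_one_le)
        moreover have "norm x \<le> norm (x + c n *\<^sub>R v) + norm (c n *\<^sub>R v)"
          using norm_triangle_ineq4[of "x + c n *\<^sub>R v" "c n *\<^sub>R v"] by simp
        ultimately have "R \<le> norm (x + c n *\<^sub>R v)" "R \<le> norm x"
          using False norm_ge_zero[of v] by linarith+
        then have "\<phi> (x + c n *\<^sub>R v) = 0" "\<phi> x = 0" by (auto intro!: R(2))
        then show ?thesis using False by simp
      qed
      then show "norm (complex_of_real ((\<phi> (c n *\<^sub>R v + x) - \<phi> x) / c n) * e x) \<le> M * indicator (cball 0 (R + norm v)) x"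
        unfolding norm_mult ne norm_of_real by (simp add: add.commute)
    qed
  qed measurable
  moreover have "(LINT x|lborel. complex_of_real ((\<phi> (c n *\<^sub>R v + x) - \<phi> x) / c n) * e x) =
      (exp (\<i> * complex_of_real (\<xi> \<bullet> v) * complex_of_real (c n)) - 1) / complex_of_real (c n) * F" for n
  proof -
    have i0: "integrable lborel (\<lambda>x. complex_of_real (\<phi> x) * e x)"
      unfolding e_def by (intro integrable_mult_cis integrable_of_real bdint_integrable test_functions_bdint \<phi>)
    define E where "E = exp (\<i> * complex_of_real (\<xi> \<bullet> v) * complex_of_real (c n))"
    have e: "e x = E * e (c n *\<^sub>R v + x)" for x
      by (simp add: E_def e_def inner_add_right exp_add[symmetric] algebra_simps)
    have i1: "integrable lborel (\<lambda>x. complex_of_real (\<phi> (c n *\<^sub>R v + x)) * e (c n *\<^sub>R v + x))"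
      by (rule lborel_integrable_translate[OF i0])
    have "(LINT x|lborel. complex_of_real ((\<phi> (c n *\<^sub>R v + x) - \<phi> x) / c n) * e x)
      = (LINT x|lborel. (E * (complex_of_real (\<phi> (c n *\<^sub>R v + x)) * e (c n *\<^sub>R v + x)) - complex_of_real (\<phi> x) * e x) / complex_of_real (c n))"
    proof (rule Bochner_Integration.integral_cong[OF refl])
      fix x
      show "complex_of_real ((\<phi> (c n *\<^sub>R v + x) - \<phi> x) / c n) * e x = (E * (complex_of_real (\<phi> (c n *\<^sub>R v + x)) * e (c n *\<^sub>R v + x)) - complex_of_real (\<phi> x) * e x) / complex_of_real (c n)"
        using e[of x] by (simp add: left_diff_distrib right_diff_distrib diff_divide_distrib mult_ac)
    qed
    also have "\<dots> = (E * (LINT x|lborel. complex_of_real (\<phi> (c n *\<^sub>R v + x)) * e (c n *\<^sub>R v + x)) - (LINT x|lborel. complex_of_real (\<phi> x) * e x)) / complex_of_real (c n)"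
      using i0 i1 by simp
    also have "(LINT x|lborel. complex_of_real (\<phi> (c n *\<^sub>R v + x)) * e (c n *\<^sub>R v + x)) = F"
      unfolding F_def fourier_transform_def e_def
      by (rule lborel_integral_translate[of "\<lambda>x. complex_of_real (\<phi> x) * exp (- (\<i> * complex_of_real (\<xi> \<bullet> x)))"])
    also have "(LINT x|lborel. complex_of_real (\<phi> x) * e x) = F" by (simp add: F_def fourier_transform_def e_def)
    finally show ?thesis by (simp add: E_def left_diff_distrib diff_divide_distrib)
  qed
  moreover have "(\<lambda>n. (exp (\<i> * complex_of_real (\<xi> \<bullet> v) * complex_of_real (c n)) - 1) / complex_of_real (c n) * F)
      \<longlonglongrightarrow> \<i> * complex_of_real (\<xi> \<bullet> v) * F"
  proof (intro tendsto_mult tendsto_const)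
    have "((\<lambda>z. exp (\<i> * complex_of_real (\<xi> \<bullet> v) * z)) has_field_derivative \<i> * complex_of_real (\<xi> \<bullet> v)) (at 0)"
      by (auto intro!: derivative_eq_intros)
    then have "(\<lambda>h. (exp (\<i> * complex_of_real (\<xi> \<bullet> v) * h) - 1) / h) \<midarrow>0\<rightarrow> \<i> * complex_of_real (\<xi> \<bullet> v)"
      by (simp add: DERIV_def)
    moreover have "filterlim (\<lambda>n. complex_of_real (c n)) (at 0) sequentially"
      using c(1,2) by (auto simp: filterlim_at less_imp_neq[symmetric] intro!: tendsto_eq_intros)
    ultimately show "(\<lambda>n. (exp (\<i> * complex_of_real (\<xi> \<bullet> v) * complex_of_real (c n)) - 1) / complex_of_real (c n)) \<longlonglongrightarrow> \<i> * complex_of_real (\<xi> \<bullet> v)"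
      by (rule filterlim_compose)
  qed
  ultimately have "(LINT x|lborel. complex_of_real (dderiv v \<phi> x) * e x) = \<i> * complex_of_real (\<xi> \<bullet> v) * F"
    by (simp only: LIMSEQ_unique)
  then show ?thesis
    by (simp only: F_def fourier_transform_def e_def)
qed

section \<open>Densities of test functions\<close>

lemma fourier_transform_oml:
  fixes \<phi> :: "'a::euclidean_space \<Rightarrow> real"
  assumes \<phi>: "\<phi> \<in> test_functions"
  shows "fourier_transform (\<lambda>x. complex_of_real (one_minus_laplacian \<phi> x)) \<xi> =
    complex_of_real (1 + (norm \<xi>)\<^sup>2) * fourier_transform (\<lambda>x. complex_of_real (\<phi> x)) \<xi>"
proof -
  have i: "integrable lborel (\<lambda>x. complex_of_real (f x) * exp (- (\<i> * complex_of_real (\<xi> \<bullet> x))))"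
    if "f \<in> test_functions" for f :: "'a \<Rightarrow> real"
    by (intro integrable_mult_cis integrable_of_real bdint_integrable test_functions_bdint that)
  have "fourier_transform (\<lambda>x. complex_of_real (one_minus_laplacian \<phi> x)) \<xi> =
      fourier_transform (\<lambda>x. complex_of_real (\<phi> x)) \<xi> -
      (\<Sum>b\<in>Basis. fourier_transform (\<lambda>x. complex_of_real (dderiv b (dderiv b \<phi>) x)) \<xi>)"
    unfolding fourier_transform_def one_minus_laplacian_def of_real_diff of_real_sum left_diff_distrib sum_distrib_right
    by (subst Bochner_Integration.integral_diff)
       (auto intro!: i \<phi> test_functions_dderiv Bochner_Integration.integrable_sum Bochner_Integration.integral_sum)
  also have "(\<Sum>b\<in>Basis. fourier_transform (\<lambda>x. complex_of_real (dderiv b (dderiv b \<phi>) x)) \<xi>) =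
     (\<Sum>b\<in>Basis. - complex_of_real ((\<xi> \<bullet> b)\<^sup>2) * fourier_transform (\<lambda>x. complex_of_real (\<phi> x)) \<xi>)"
  proof (intro sum.cong refl)
    fix b :: 'a
    have "\<i> * c * (\<i> * c * F) = (\<i> * \<i>) * (c * c) * F" for c F by (simp only: mult_ac)
    then show "fourier_transform (\<lambda>x. complex_of_real (dderiv b (dderiv b \<phi>) x)) \<xi> =
        - complex_of_real ((\<xi> \<bullet> b)\<^sup>2) * fourier_transform (\<lambda>x. complex_of_real (\<phi> x)) \<xi>"
      by (simp add: fourier_transform_dderiv \<phi> test_functions_dderiv power2_eq_square)
  qed
  also have "\<dots> = - complex_of_real ((norm \<xi>)\<^sup>2) * fourier_transform (\<lambda>x. complex_of_real (\<phi> x)) \<xi>"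
    by (simp add: norm_power2_eq_sum sum_distrib_right sum_negf)
  finally show ?thesis by (simp add: algebra_simps)
qed

lemma fourier_transform_oml_pow:
  fixes \<phi> :: "'a::euclidean_space \<Rightarrow> real"
  assumes \<phi>: "\<phi> \<in> test_functions"
  shows "fourier_transform (\<lambda>x. complex_of_real ((one_minus_laplacian ^^ k) \<phi> x)) \<xi> =
    complex_of_real ((1 + (norm \<xi>)\<^sup>2) ^ k) * fourier_transform (\<lambda>x. complex_of_real (\<phi> x)) \<xi>"
  by (induction k) (simp_all add: fourier_transform_oml[OF test_functions_oml_pow[OF \<phi>]] mult_ac)

text \<open>The set where two continuous functions differ is open, and a nonempty open set has
  positive Lebesgue measure. This upgrades identities obtained from Fourier transforms to every
  point, as is required for integration against measures that charge Lebesgue null sets.\<close>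

lemma AE_eq_continuous_imp_eq:
  fixes f g :: "'a::euclidean_space \<Rightarrow> real"
  assumes "AE x in lborel. f x = g x" "continuous_on UNIV f" "continuous_on UNIV g"
  shows "f x = g x"
proof (rule ccontr)
  assume ne: "f x \<noteq> g x"
  have "open {x. f x \<noteq> g x}" by (rule open_Collect_neq[OF assms(2,3)])
  with ne obtain e where e: "e > 0" "ball x e \<subseteq> {x. f x \<noteq> g x}"
    by (auto simp: open_contains_ball)
  from assms(1) have "emeasure lborel {x \<in> space lborel. \<not> (f x = g x)} = 0"
    by (subst (asm) AE_iff_measurable[OF _ refl]) (use \<open>open {x. f x \<noteq> g x}\<close> in auto)
  moreover have "emeasure lborel (ball x e) \<le> emeasure lborel {x \<in> space lborel. \<not> (f x = g x)}"
    using e(2) \<open>open {x. f x \<noteq> g x}\<close> by (intro emeasure_mono) auto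
  ultimately have "emeasure lborel (ball x e) = 0" by simp
  then show False using content_ball_pos[OF e(1), of x] by (simp add: measure_def)
qed

lemma test_functions_continuous: "\<phi> \<in> test_functions \<Longrightarrow> continuous_on S \<phi>"
  by (intro smooth_continuous test_functions_smooth)

text \<open>With \<open>2k > \<alpha>\<close>, a test function \<open>\<phi>\<close> is the potential of \<open>(1 - \<Delta>)\<^sup>\<alpha>\<^sup>/\<^sup>2\<phi> = g\<^bsub>2k-\<alpha>\<^esub> * (1 - \<Delta>)\<^sup>k\<phi>\<close>.\<close>

definition density_order :: "real \<Rightarrow> nat" where "density_order \<alpha> = nat \<lceil>\<alpha>\<rceil>"

definition bessel_density :: "real \<Rightarrow> ('a::euclidean_space \<Rightarrow> real) \<Rightarrow> 'a \<Rightarrow> real" where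
  "bessel_density \<alpha> \<phi> = fun_conv (bessel_kernel_real (2 * real (density_order \<alpha>) - \<alpha>)) ((one_minus_laplacian ^^ density_order \<alpha>) \<phi>)"

lemma density_order_pos: "\<alpha> > 0 \<Longrightarrow> 2 * real (density_order \<alpha>) - \<alpha> > 0"
  unfolding density_order_def by linarith

lemma bdint_bessel_density:
  assumes "\<alpha> > 0" "\<phi> \<in> test_functions"
  shows "bdint (bessel_density \<alpha> \<phi>)"
  unfolding bessel_density_def
  by (intro bdint_fun_conv integrable_bessel_kernel_real density_order_pos test_functions_bdint test_functions_oml_pow assms)

lemma continuous_bessel_density:
  assumes "\<alpha> > 0" "\<phi> \<in> test_functions"
  shows "continuous_on UNIV (bessel_density \<alpha> \<phi>)"
  unfolding bessel_density_def
  by (rule smooth_continuous)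
     (intro smooth_fun_conv integrable_bessel_kernel_real density_order_pos test_functions_oml_pow assms)

text \<open>On the Fourier side three powers of \<open>1 + |\<xi>|^2\<close> meet, with exponents
  -\<alpha>/2, -(2k-\<alpha>)/2 and k, and cancel. Both functions are integrable and continuous, so
  equal transforms mean equality everywhere.\<close>

lemma fun_conv_bessel_density:
  fixes \<phi> :: "'a::euclidean_space \<Rightarrow> real"
  assumes \<alpha>: "\<alpha> > 0" and \<phi>: "\<phi> \<in> test_functions"
  shows "fun_conv (bessel_kernel_real \<alpha>) (bessel_density \<alpha> \<phi>) x = \<phi> x"
proof (rule AE_eq_continuous_imp_eq[of "fun_conv (bessel_kernel_real \<alpha>) (bessel_density \<alpha> \<phi>)" \<phi>], rule fourier_transform_inj)
  define k where "k = density_order \<alpha>"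
  have k: "2 * real k - \<alpha> > 0" using density_order_pos[OF \<alpha>] by (simp add: k_def)
  have bd: "bdint (bessel_density \<alpha> \<phi>)" by (rule bdint_bessel_density[OF \<alpha> \<phi>])
  show "integrable lborel (fun_conv (bessel_kernel_real \<alpha>) (bessel_density \<alpha> \<phi>))"
    by (intro integrable_fun_conv integrable_bessel_kernel_real \<alpha> bdint_integrable bd)
  show "integrable lborel \<phi>" by (intro bdint_integrable test_functions_bdint \<phi>)
  obtain B where B: "B > 0" "\<And>x. \<bar>bessel_density \<alpha> \<phi> x\<bar> \<le> B" by (rule bdint_boundedE[OF bd]) (rule that)
  show "continuous_on UNIV (fun_conv (bessel_kernel_real \<alpha>) (bessel_density \<alpha> \<phi>))"
    by (rule continuous_fun_conv[OF integrable_bessel_kernel_real[OF \<alpha>] continuous_bessel_density[OF \<alpha> \<phi>] B(2)])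
  show "continuous_on UNIV \<phi>" by (rule test_functions_continuous[OF \<phi>])
  fix \<xi> :: 'a
  define s where "s = 1 + (norm \<xi>)\<^sup>2"
  have s: "s > 0" unfolding s_def by (simp add: add_pos_nonneg)
  have int: "integrable lborel ((one_minus_laplacian ^^ k) \<phi>)"
    by (intro bdint_integrable test_functions_bdint test_functions_oml_pow \<phi>)
  have "fourier_transform (\<lambda>x. complex_of_real (fun_conv (bessel_kernel_real \<alpha>) (bessel_density \<alpha> \<phi>) x)) \<xi> =
    complex_of_real (s powr (- \<alpha> / 2)) * (complex_of_real (s powr (- (2 * real k - \<alpha>) / 2)) *
      (complex_of_real (s ^ k) * fourier_transform (\<lambda>x. complex_of_real (\<phi> x)) \<xi>))"
    unfolding fourier_transform_fun_conv[OF integrable_bessel_kernel_real[OF \<alpha>] bdint_integrable[OF bd[unfolded bessel_density_def k_def[symmetric]]]]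
      bessel_density_def k_def[symmetric] fourier_transform_fun_conv[OF integrable_bessel_kernel_real[OF k] int]
      fourier_transform_bessel_kernel_real[OF \<alpha>] fourier_transform_bessel_kernel_real[OF k]
      fourier_transform_oml_pow[OF \<phi>] s_def ..
  also have "\<dots> = complex_of_real (s powr (- \<alpha> / 2) * s powr (- (2 * real k - \<alpha>) / 2) * s powr real k) *
      fourier_transform (\<lambda>x. complex_of_real (\<phi> x)) \<xi>"
    using s by (simp add: powr_realpow mult.assoc)
  also have "s powr (- \<alpha> / 2) * s powr (- (2 * real k - \<alpha>) / 2) * s powr real k = 1"
  proof -
    have "- \<alpha> / 2 + - (2 * real k - \<alpha>) / 2 + real k = 0" by (simp add: field_simps)
    then show ?thesis using s by (simp only: powr_add[symmetric]) simp
  qed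
  finally show "fourier_transform (\<lambda>x. complex_of_real (fun_conv (bessel_kernel_real \<alpha>) (bessel_density \<alpha> \<phi>) x)) \<xi> =
    fourier_transform (\<lambda>x. complex_of_real (\<phi> x)) \<xi>" by simp
qed

lemma is_bessel_potential_bessel_density:
  assumes "\<alpha> > 0" "\<phi> \<in> test_functions" "p \<ge> 1"
  shows "is_bessel_potential \<alpha> p (bessel_density \<alpha> \<phi>) \<phi>"
  unfolding is_bessel_potential_def
  by (auto simp: fun_conv_bessel_kernel_eq fun_conv_bessel_density assms bdint_measurable bdint_bessel_density
      intro: bdint_Lp_space)

text \<open>The kernel is even, so convolution with it is symmetric for the integral pairing.
  Absolute convergence holds because the kernel maps \<open>\<bar>h\<bar>\<close> to a bounded
  integrable function, which pairs with the L^p function \<open>f\<close>.\<close>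

lemma integral_fun_conv_bessel_kernel_mult:
  fixes f h :: "'a::euclidean_space \<Rightarrow> real"
  assumes \<alpha>: "\<alpha> > 0" and f: "f \<in> Lp_space p" and p: "p \<ge> 1" and h: "bdint h"
  shows "(LINT x|lborel. fun_conv (bessel_kernel_real \<alpha>) f x * h x) =
    (LINT y|lborel. f y * fun_conv (bessel_kernel_real \<alpha>) h y)"
proof -
  have [measurable]: "f \<in> borel_measurable borel" "h \<in> borel_measurable borel"
    using f bdint_measurable[OF h] by (auto simp: Lp_space_def)
  obtain B where B: "B > 0" "\<And>x. \<bar>h x\<bar> \<le> B" by (rule bdint_boundedE[OF h]) (rule that)
  have sym: "bessel_kernel_real \<alpha> (x - y) = bessel_kernel_real \<alpha> (y - x)" for x y :: 'a
    using bessel_kernel_real_uminus[of \<alpha> "x - y"] by simp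
  have i: "integrable lborel (\<lambda>x. bessel_kernel_real \<alpha> (x - y) * h x)" for y
    by (subst sym, rule integrable_conv_integrand[OF integrable_bessel_kernel_real[OF \<alpha>] _ B(2)]) measurable
  have "integrable (lborel \<Otimes>\<^sub>M lborel) (\<lambda>(y, x). bessel_kernel_real \<alpha> (x - y) * f y * h x)"
  proof (rule lborel_pair.Fubini_integrable)
    have "(LINT x|lborel. norm (bessel_kernel_real \<alpha> (x - y) * f y * h x)) = \<bar>f y\<bar> * fun_conv (bessel_kernel_real \<alpha>) (\<lambda>x. \<bar>h x\<bar>) y" for y
      by (simp add: fun_conv_def abs_mult bessel_kernel_real_nonneg sym[of _ y] mult_ac flip: integral_mult_right_zero)
    moreover have "integrable lborel (\<lambda>y. f y * fun_conv (bessel_kernel_real \<alpha>) (\<lambda>x. \<bar>h x\<bar>) y)"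
      by (intro Lp_space_mult_bdint_integrable[OF f _ p] bdint_fun_conv integrable_bessel_kernel_real \<alpha> bdint_abs h)
    moreover have "fun_conv (bessel_kernel_real \<alpha>) (\<lambda>x. \<bar>h x\<bar>) y \<ge> 0" for y
      by (simp add: fun_conv_def bessel_kernel_real_nonneg)
    ultimately show "integrable lborel (\<lambda>y. LINT x|lborel. norm (case (y, x) of (y, x) \<Rightarrow> bessel_kernel_real \<alpha> (x - y) * f y * h x))"
      using integrable_abs[of lborel "\<lambda>y. f y * fun_conv (bessel_kernel_real \<alpha>) (\<lambda>x. \<bar>h x\<bar>) y"] by (simp add: abs_mult)
    show "AE y in lborel. integrable lborel (\<lambda>x. case (y, x) of (y, x) \<Rightarrow> bessel_kernel_real \<alpha> (x - y) * f y * h x)"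
    proof (rule AE_I2)
      fix y
      have "integrable lborel (\<lambda>x. f y * (bessel_kernel_real \<alpha> (x - y) * h x))" using i by simp
      then show "integrable lborel (\<lambda>x. case (y, x) of (y, x) \<Rightarrow> bessel_kernel_real \<alpha> (x - y) * f y * h x)"
        by (simp add: mult_ac)
    qed
  qed measurable
  then have "(LINT x|lborel. LINT y|lborel. bessel_kernel_real \<alpha> (x - y) * f y * h x) =
      (LINT y|lborel. LINT x|lborel. bessel_kernel_real \<alpha> (x - y) * f y * h x)"
    by (rule lborel_pair.Fubini_integral)
  moreover have "(LINT x|lborel. bessel_kernel_real \<alpha> (x - y) * f y * h x) = f y * fun_conv (bessel_kernel_real \<alpha>) h y" for y
    by (simp add: fun_conv_def sym[of _ y] mult_ac flip: integral_mult_right_zero)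
  ultimately show ?thesis by (simp add: fun_conv_def)
qed

section \<open>Uniqueness of the density\<close>

text \<open>A smooth approximation of the indicator of the box from below: each factor is
  \<open>exp (- (1 / (n * s)))\<close> with \<open>s\<close> the distance to a face, and it tends to
  1 inside and vanishes outside.\<close>

definition box_test :: "'a::euclidean_space \<Rightarrow> 'a \<Rightarrow> nat \<Rightarrow> 'a \<Rightarrow> real" where
  "box_test a b n x = (\<Prod>i\<in>Basis. bump_profile 0 (real n * (x \<bullet> i - a \<bullet> i)) * bump_profile 0 (real n * (b \<bullet> i - x \<bullet> i)))"

lemma smooth_prod: "(\<And>i. i \<in> I \<Longrightarrow> smooth (f i)) \<Longrightarrow> smooth (\<lambda>x. \<Prod>i\<in>I. f i x)"
  by (induction I rule: infinite_finite_induct) (auto intro: smooth_const smooth_mult)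

lemma bump_profile_0_range: "0 \<le> bump_profile 0 s" "bump_profile 0 s \<le> 1"
  by (auto simp: bump_profile_def)

lemma box_test_range: "0 \<le> box_test a b n x" "box_test a b n x \<le> indicator (box a b) x"
proof -
  show "0 \<le> box_test a b n x"
    unfolding box_test_def by (intro prod_nonneg mult_nonneg_nonneg bump_profile_0_range)
  show "box_test a b n x \<le> indicator (box a b) x"
  proof (cases "x \<in> box a b")
    case True
    have "box_test a b n x \<le> 1" unfolding box_test_def
      by (intro prod_le_1 conjI mult_nonneg_nonneg mult_le_one bump_profile_0_range)
    with True show ?thesis by simp
  next
    case False
    then obtain i where i: "i \<in> Basis" "x \<bullet> i \<le> a \<bullet> i \<or> b \<bullet> i \<le> x \<bullet> i" by (auto simp: mem_box not_less)
    then have "real n * (x \<bullet> i - a \<bullet> i) \<le> 0 \<or> real n * (b \<bullet> i - x \<bullet> i) \<le> 0" by (auto simp: mult_nonneg_nonpos)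
    then have "bump_profile 0 (real n * (x \<bullet> i - a \<bullet> i)) * bump_profile 0 (real n * (b \<bullet> i - x \<bullet> i)) = 0"
      by (auto simp: bump_profile_def)
    with i(1) have "box_test a b n x = 0" unfolding box_test_def by (auto intro!: prod_zero)
    then show ?thesis by simp
  qed
qed

lemma box_test_test_function: "box_test a b n \<in> test_functions"
proof -
  have "bounded (box a b)" by (rule bounded_box)
  moreover have "{x. box_test a b n x \<noteq> 0} \<subseteq> box a b"
  proof
    fix x assume "x \<in> {x. box_test a b n x \<noteq> 0}"
    then show "x \<in> box a b" using box_test_range[of a b n x] by (cases "x \<in> box a b") auto
  qed
  ultimately have "bounded {x. box_test a b n x \<noteq> 0}" by (rule bounded_subset)
  moreover have "smooth (box_test a b n)" unfolding box_test_def[abs_def]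
    by (intro smooth_prod smooth_mult smooth_bump_profile_comp smooth_diff smooth_const smooth_inner)
  ultimately show ?thesis by (simp add: test_functions_iff)
qed

lemma box_test_tendsto: "(\<lambda>n. box_test a b n x) \<longlonglongrightarrow> indicator (box a b) x"
proof (cases "x \<in> box a b")
  case True
  have lim: "(\<lambda>n. bump_profile 0 (real n * s)) \<longlonglongrightarrow> 1" if "s > 0" for s
  proof -
    have "filterlim (\<lambda>n. real n * s) at_top sequentially"
      using filterlim_tendsto_pos_mult_at_top[OF tendsto_const that filterlim_real_sequentially] by (simp add: mult.commute)
    then have "(\<lambda>n. 1 / (real n * s)) \<longlonglongrightarrow> 0"
      using tendsto_inverse_0_at_top by (simp add: inverse_eq_divide)
    then have "(\<lambda>n. exp (- (1 / (real n * s)))) \<longlonglongrightarrow> exp (- 0)" by (intro tendsto_intros)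
    moreover have "eventually (\<lambda>n. exp (- (1 / (real n * s))) = bump_profile 0 (real n * s)) sequentially"
      using eventually_gt_at_top[of "0::nat"] by eventually_elim (use that in \<open>auto simp: bump_profile_def\<close>)
    ultimately show ?thesis using Lim_transform_eventually by fastforce
  qed
  have "(\<lambda>n. box_test a b n x) \<longlonglongrightarrow> (\<Prod>i\<in>(Basis::'a set). 1 * 1)"
    unfolding box_test_def using True by (intro tendsto_prod tendsto_mult lim) (auto simp: mem_box)
  with True show ?thesis by simp
next
  case False
  have "box_test a b n x = 0" for n using box_test_range[of a b n x] False by simp
  with False show ?thesis by simp
qed

text \<open>Dominated convergence along \<open>box_test\<close> carries the hypothesis from test
  functions over to indicators of boxes, and box integrals determine a function almost
  everywhere.\<close>

lemma Lp_space_AE_eqI: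
  fixes f g :: "'a::euclidean_space \<Rightarrow> real"
  assumes f: "f \<in> Lp_space p" and g: "g \<in> Lp_space p" and p: "p \<ge> 1"
    and eq: "\<And>\<phi>. \<phi> \<in> test_functions \<Longrightarrow> (LINT x|lborel. f x * \<phi> x) = (LINT x|lborel. g x * \<phi> x)"
  shows "AE x in lborel. f x = g x"
proof -
  have [measurable]: "f \<in> borel_measurable borel" "g \<in> borel_measurable borel"
    using f g by (auto simp: Lp_space_def)
  have i: "integrable lborel (\<lambda>x. (f x - g x) * h x)" if "bdint h" for h
    using Lp_space_mult_bdint_integrable[OF f that p] Lp_space_mult_bdint_integrable[OF g that p]
    by (simp add: left_diff_distrib)
  have "AE x in lborel. f x - g x = 0"
  proof (rule AE_lborel_eq_0_if_box_integrals_eq_0)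
    fix a b :: 'a
    show ib: "integrable lborel (\<lambda>x. (f x - g x) * indicator (box a b) x)"
      by (rule i[OF bdint_indicator_box])
    have "(\<lambda>n. LINT x|lborel. (f x - g x) * box_test a b n x) \<longlonglongrightarrow> (LINT x|lborel. (f x - g x) * indicator (box a b) x)"
    proof (rule integral_dominated_convergence[where w="\<lambda>x. \<bar>(f x - g x) * indicator (box a b) x\<bar>"])
      show "integrable lborel (\<lambda>x. \<bar>(f x - g x) * indicator (box a b) x\<bar>)" using ib by (rule integrable_abs)
      show "AE x in lborel. (\<lambda>n. (f x - g x) * box_test a b n x) \<longlonglongrightarrow> (f x - g x) * indicator (box a b) x"
        by (intro AE_I2 tendsto_mult tendsto_const box_test_tendsto)
      have [measurable]: "box_test a b n \<in> borel_measurable borel" for n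
        by (intro bdint_measurable test_functions_bdint box_test_test_function)
      show "(\<lambda>x. (f x - g x) * box_test a b n x) \<in> borel_measurable lborel" for n by measurable
      show "AE x in lborel. norm ((f x - g x) * box_test a b n x) \<le> \<bar>(f x - g x) * indicator (box a b) x\<bar>" for n
        using box_test_range[of a b n] by (intro AE_I2) (auto simp: abs_mult intro!: mult_left_mono)
    qed measurable
    moreover have "(LINT x|lborel. (f x - g x) * box_test a b n x) = 0" for n
      using eq[OF box_test_test_function[of a b n]]
        Lp_space_mult_bdint_integrable[OF f test_functions_bdint[OF box_test_test_function[of a b n]] p]
        Lp_space_mult_bdint_integrable[OF g test_functions_bdint[OF box_test_test_function[of a b n]] p]
      by (simp add: left_diff_distrib)
    ultimately show "(LINT x|lborel. (f x - g x) * indicator (box a b) x) = 0"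
      by (simp add: LIMSEQ_const_iff)
  qed measurable
  then show ?thesis by simp
qed

text \<open>Every test function \<open>\<phi>\<close> is itself a potential, namely of its density.
  By symmetry of the kernel the integral of \<open>f * \<phi>\<close> is that of the potential of
  \<open>f\<close> times this density, and so depends on \<open>u\<close> only. No Fourier transform
  of the L^p function \<open>f\<close> is involved.\<close>

lemma is_bessel_potential_unique:
  fixes f g :: "'a::euclidean_space \<Rightarrow> real"
  assumes \<alpha>: "\<alpha> > 0" and p: "p \<ge> 1" and f: "is_bessel_potential \<alpha> p f u" and g: "is_bessel_potential \<alpha> p g u"
  shows "AE x in lborel. f x = g x"
proof (rule Lp_space_AE_eqI)
  show fL: "f \<in> Lp_space p" and gL: "g \<in> Lp_space p" using f g by (auto simp: is_bessel_potential_def)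
  have [measurable]: "f \<in> borel_measurable borel" "g \<in> borel_measurable borel"
    using fL gL by (auto simp: Lp_space_def)
  fix \<phi> :: "'a \<Rightarrow> real" assume \<phi>: "\<phi> \<in> test_functions"
  have bd: "bdint (bessel_density \<alpha> \<phi>)" by (rule bdint_bessel_density[OF \<alpha> \<phi>])
  note [measurable] = bdint_measurable[OF bd]
  have eq: "(LINT x|lborel. f x * \<phi> x) = (LINT x|lborel. fun_conv (bessel_kernel_real \<alpha>) f x * bessel_density \<alpha> \<phi> x)"
    if "f \<in> Lp_space p" for f
    using integral_fun_conv_bessel_kernel_mult[OF \<alpha> that p bd] by (simp add: fun_conv_bessel_density[OF \<alpha> \<phi>])
  have m: "fun_conv (bessel_kernel_real \<alpha>) f \<in> borel_measurable borel" if [measurable]: "f \<in> borel_measurable borel" for f :: "'a \<Rightarrow> real"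
    unfolding fun_conv_def[abs_def] by measurable
  note [measurable] = m[OF \<open>f \<in> borel_measurable borel\<close>] m[OF \<open>g \<in> borel_measurable borel\<close>]
  have "AE x in lborel. fun_conv (bessel_kernel_real \<alpha>) f x = fun_conv (bessel_kernel_real \<alpha>) g x"
    using f g by (auto simp: is_bessel_potential_def fun_conv_bessel_kernel_eq[OF \<alpha>] elim!: AE_mp)
  then have "(LINT x|lborel. fun_conv (bessel_kernel_real \<alpha>) f x * bessel_density \<alpha> \<phi> x) =
     (LINT x|lborel. fun_conv (bessel_kernel_real \<alpha>) g x * bessel_density \<alpha> \<phi> x)"
    by (intro integral_cong_AE) auto
  then show "(LINT x|lborel. f x * \<phi> x) = (LINT x|lborel. g x * \<phi> x)"
    by (simp add: eq fL gL)
qed (rule p)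

lemma bessel_norm_eq:
  assumes \<alpha>: "\<alpha> > 0" and p: "p \<ge> 1" and f: "is_bessel_potential \<alpha> p f u"
  shows "bessel_norm \<alpha> p u = Lp_norm p f"
  unfolding bessel_norm_def
proof (rule the_equality)
  fix r assume "\<exists>f. is_bessel_potential \<alpha> p f u \<and> r = Lp_norm p f"
  then obtain g where g: "is_bessel_potential \<alpha> p g u" "r = Lp_norm p g" by blast
  have [measurable]: "f \<in> borel_measurable borel" "g \<in> borel_measurable borel"
    using f g by (auto simp: is_bessel_potential_def Lp_space_def)
  have "(LINT x|lborel. \<bar>g x\<bar> powr p) = (LINT x|lborel. \<bar>f x\<bar> powr p)"
    using is_bessel_potential_unique[OF \<alpha> p g(1) f] by (intro integral_cong_AE) auto
  then show "r = Lp_norm p f" by (simp add: g(2) Lp_norm_def)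
qed (use f in blast)

lemma bessel_norm_test_function:
  assumes "\<alpha> > 0" "p \<ge> 1" "\<phi> \<in> test_functions"
  shows "bessel_norm \<alpha> p \<phi> = Lp_norm p (bessel_density \<alpha> \<phi>)"
  by (intro bessel_norm_eq is_bessel_potential_bessel_density assms)

section \<open>Hoelder's and Young's inequalities for extended nonnegative functions\<close>

text \<open>Real powers on \<open>[0, \<infinity>]\<close>. Infinity is sent to infinity for every
  exponent, which is the intended value for positive exponents.\<close>

definition epow :: "ennreal \<Rightarrow> real \<Rightarrow> ennreal" where
  "epow x r = (if x = \<infinity> then \<infinity> else ennreal (enn2real x powr r))"

lemma epow_ennreal: "x \<ge> 0 \<Longrightarrow> epow (ennreal x) r = ennreal (x powr r)"
  by (simp add: epow_def)

lemma epow_top[simp]: "epow \<infinity> r = \<infinity>" "epow top r = top"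
  by (simp_all add: epow_def)

lemma epow_0[simp]: "epow 0 r = 0"
  by (simp add: epow_def)

lemma epow_1[simp]: "epow 1 r = 1"
  by (simp add: epow_def)

lemma epow_one[simp]: "epow x 1 = x"
  by (cases x) (auto simp: epow_ennreal)

lemma epow_measurable[measurable]:
  assumes [measurable]: "f \<in> borel_measurable M"
  shows "(\<lambda>x. epow (f x) r) \<in> borel_measurable M"
  unfolding epow_def by measurable

lemma epow_mono: "r \<ge> 0 \<Longrightarrow> x \<le> y \<Longrightarrow> epow x r \<le> epow y r"
proof (cases y)
  case (real b)
  assume a: "r \<ge> 0" "x \<le> y"
  then obtain a where "x = ennreal a" "a \<ge> 0" using real by (cases x) (auto simp: top_unique)
  with a real show ?thesis by (auto simp: epow_ennreal intro!: ennreal_leI powr_mono2)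
qed simp

lemma epow_eq_top_iff: "epow x r = top \<longleftrightarrow> x = top"
  by (simp add: epow_def)

lemma epow_mult: "r > 0 \<Longrightarrow> epow (x * y) r = epow x r * epow y r"
proof (cases x; cases y)
  assume r: "r > 0"
  { fix a b assume "x = ennreal a" "0 \<le> a" "y = ennreal b" "0 \<le> b"
    then show ?thesis by (simp add: epow_ennreal powr_mult flip: ennreal_mult') }
  { fix a assume "x = ennreal a" "0 \<le> a" "y = top"
    then show ?thesis using r by (cases "a = 0") (auto simp: epow_ennreal ennreal_mult_top) }
  { fix a assume "y = ennreal a" "0 \<le> a" "x = top"
    then show ?thesis using r by (cases "a = 0") (auto simp: epow_ennreal ennreal_top_mult) }
qed simp

lemma epow_add: "a > 0 \<Longrightarrow> b > 0 \<Longrightarrow> epow x (a + b) = epow x a * epow x b"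
  by (cases x) (auto simp: epow_ennreal powr_add ennreal_mult')

lemma epow_epow: "epow (epow x a) b = epow x (a * b)"
  by (cases x) (auto simp: epow_ennreal powr_powr)

text \<open>For positive \<open>r\<close> the power is monotone with monotone inverse
  \<open>epow _ (1 / r)\<close>, and an order isomorphism commutes with suprema.\<close>

lemma epow_SUP: "r > 0 \<Longrightarrow> epow (SUP i\<in>I. f i) r = (SUP i\<in>I. epow (f i) r)"
proof (rule antisym)
  assume r: "r > 0"
  have "f i \<le> epow (SUP i\<in>I. epow (f i) r) (1 / r)" if "i \<in> I" for i
  proof -
    have "epow (f i) r \<le> (SUP i\<in>I. epow (f i) r)" using that by (rule SUP_upper)
    then have "epow (epow (f i) r) (1 / r) \<le> epow (SUP i\<in>I. epow (f i) r) (1 / r)"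
      using r by (intro epow_mono) auto
    then show ?thesis using r by (simp add: epow_epow)
  qed
  then have "(SUP i\<in>I. f i) \<le> epow (SUP i\<in>I. epow (f i) r) (1 / r)" by (rule SUP_least)
  then have "epow (SUP i\<in>I. f i) r \<le> epow (epow (SUP i\<in>I. epow (f i) r) (1 / r)) r"
    using r by (intro epow_mono) auto
  then show "epow (SUP i\<in>I. f i) r \<le> (SUP i\<in>I. epow (f i) r)" using r by (simp add: epow_epow)
  show "(SUP i\<in>I. epow (f i) r) \<le> epow (SUP i\<in>I. f i) r"
    using r by (intro SUP_least epow_mono SUP_upper) auto
qed

lemma epow_add_le:
  assumes r: "r > 0"
  shows "epow (x + y) r \<le> ennreal (2 powr r) * (epow x r + epow y r)"
proof -
  have "epow (x + y) r \<le> epow (2 * max x y) r"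
    using r by (intro epow_mono) (simp_all add: mult_2 add_mono)
  also have "\<dots> = ennreal (2 powr r) * epow (max x y) r"
    using r epow_ennreal[of 2 r] by (simp add: epow_mult)
  also have "\<dots> \<le> ennreal (2 powr r) * (epow x r + epow y r)"
    by (intro mult_left_mono) (auto simp: max_def)
  finally show ?thesis .
qed

text \<open>The free weight \<open>s\<close> is what makes Hoelder's inequality follow without
  dividing the two functions by their norms, an operation that is awkward for extended
  values.\<close>

lemma Youngs_inequality_ennreal:
  assumes p: "p > 1" and q: "q > 1" and pq: "1 / p + 1 / q = 1" and s: "s > 0"
  shows "a * b \<le> ennreal (s powr p / p) * epow a p + ennreal (s powr (- q) / q) * epow b q"
proof (cases a)
  case (real x)
  note x = real
  show ?thesis
  proof (cases b)
    case (real y)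
    have "(s * x) * (y / s) \<le> (s * x) powr p / p + (y / s) powr q / q"
      using x real s p q pq by (intro Youngs_inequality) auto
    also have "(s * x) powr p / p = s powr p / p * x powr p" using x s by (simp add: powr_mult)
    also have "(y / s) powr q / q = s powr (- q) / q * y powr q" using real s by (simp add: powr_divide powr_minus field_simps)
    also have "(s * x) * (y / s) = x * y" using s by simp
    finally have le: "x * y \<le> s powr p / p * x powr p + s powr (- q) / q * y powr q" .
    define c d where "c = s powr p / p" and "d = s powr (- q) / q"
    have cd: "c \<ge> 0" "d \<ge> 0" using p q by (auto simp: c_def d_def)
    have "ennreal (x * y) \<le> ennreal (c * x powr p + d * y powr q)"
      using le unfolding c_def d_def by (rule ennreal_leI)
    then show ?thesis using x real cd unfolding c_def[symmetric] d_def[symmetric]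
      by (simp add: epow_ennreal ennreal_mult')
  next
    case top then show ?thesis using s q by (simp add: ennreal_mult_top)
  qed
next
  case top then show ?thesis using s p by (simp add: ennreal_mult_top)
qed

lemma nn_integral_Holder:
  assumes p: "p > 1" and q: "q > 1" and pq: "1 / p + 1 / q = 1"
    and [measurable]: "f \<in> borel_measurable M" "g \<in> borel_measurable M"
  shows "(\<integral>\<^sup>+x. f x * g x \<partial>M) \<le> epow (\<integral>\<^sup>+x. epow (f x) p \<partial>M) (1 / p) * epow (\<integral>\<^sup>+x. epow (g x) q \<partial>M) (1 / q)"
proof -
  define F G where "F = (\<integral>\<^sup>+x. epow (f x) p \<partial>M)" and "G = (\<integral>\<^sup>+x. epow (g x) q \<partial>M)"
  have zero: "(\<integral>\<^sup>+x. f x * g x \<partial>M) = 0" if "F = 0 \<or> G = 0"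
  proof -
    have eq0: "epow x r = 0 \<Longrightarrow> x = 0" for x r
      by (cases x) (auto simp: epow_ennreal)
    have "AE x in M. f x * g x = 0" using that
    proof
      assume "F = 0"
      then have "AE x in M. epow (f x) p = 0" unfolding F_def by (subst (asm) nn_integral_0_iff_AE) auto
      then show ?thesis by eventually_elim (auto dest: eq0)
    next
      assume "G = 0"
      then have "AE x in M. epow (g x) q = 0" unfolding G_def by (subst (asm) nn_integral_0_iff_AE) auto
      then show ?thesis by eventually_elim (auto dest: eq0)
    qed
    then show ?thesis by (subst nn_integral_0_iff_AE) auto
  qed
  consider "F = 0 \<or> G = 0" | "F \<noteq> 0" "G \<noteq> 0" "F = top \<or> G = top"
    | A B where "F = ennreal A" "G = ennreal B" "A > 0" "B > 0"
    by (cases F; cases G) (auto simp: less_le)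
  then have "(\<integral>\<^sup>+x. f x * g x \<partial>M) \<le> epow F (1 / p) * epow G (1 / q)"
  proof cases
    case 1 with zero show ?thesis by simp
  next
    case 2
    \<comment> \<open>The case in which one factor vanishes has been split off, so an infinite
      factor makes the right-hand side infinite; the product \<open>0 * top\<close> does not
      arise.\<close>
    have nz: "epow x r \<noteq> 0" if "x \<noteq> 0" for x r
      using that by (cases x) (auto simp: epow_ennreal)
    have "epow F (1 / p) \<noteq> 0" "epow G (1 / q) \<noteq> 0"
      using 2(1,2) by (blast dest: nz)+
    then have "epow F (1 / p) * epow G (1 / q) = top"
      using 2(3) by (auto simp: ennreal_mult_eq_top_iff epow_eq_top_iff)
    then show ?thesis by simp
  next
    case (3 A B)
    \<comment> \<open>The balancing weight: with it the two terms of Young's inequality integrate to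
      \<open>1 / p\<close> and \<open>1 / q\<close> times the same quantity
      \<open>A powr (1 / p) * B powr (1 / q)\<close>.\<close>
    define s where "s = (A powr (- 1 / q) * B powr (1 / q)) powr (1 / p)"
    have s: "s > 0" using 3 by (simp add: s_def)
    have sp: "s powr p = A powr (- 1 / q) * B powr (1 / q)"
      using p 3 by (simp add: s_def powr_powr)
    have "s powr (- q) = (A powr (- 1 / q) * B powr (1 / q)) powr (- (q / p))"
      using 3 by (simp add: s_def powr_powr)
    also have "\<dots> = A powr (1 / p) * B powr (- 1 / p)"
      using 3 q by (simp add: powr_mult powr_powr)
    finally have sq: "s powr (- q) = A powr (1 / p) * B powr (- 1 / p)" .
    have "(\<integral>\<^sup>+x. f x * g x \<partial>M) \<le> (\<integral>\<^sup>+x. ennreal (s powr p / p) * epow (f x) p + ennreal (s powr (- q) / q) * epow (g x) q \<partial>M)"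
      by (intro nn_integral_mono Youngs_inequality_ennreal p q pq s)
    also have "\<dots> = ennreal (s powr p / p) * F + ennreal (s powr (- q) / q) * G"
      unfolding F_def G_def by (simp add: nn_integral_add nn_integral_cmult)
    also have "\<dots> = ennreal (s powr p / p * A + s powr (- q) / q * B)"
      using 3 p q by (simp add: ennreal_plus flip: ennreal_mult')
    also have "s powr p / p * A + s powr (- q) / q * B = A powr (1 / p) * B powr (1 / q)"
    proof -
      have e: "1 / p = - 1 / q + 1" "1 / q = - 1 / p + 1" using pq by auto
      have "A powr (- 1 / q) * A = A powr (1 / p)"
        unfolding e(1) powr_add using 3 by simp
      moreover have "B powr (- 1 / p) * B = B powr (1 / q)"
        unfolding e(2) powr_add using 3 by simp
      ultimately have "s powr p / p * A = A powr (1 / p) * B powr (1 / q) * (1 / p)"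
          "s powr (- q) / q * B = A powr (1 / p) * B powr (1 / q) * (1 / q)"
        by (simp_all add: sp sq mult_ac)
      then show ?thesis using pq by (simp only: distrib_left[symmetric] mult_1_right)
    qed
    finally show ?thesis using 3 by (simp add: epow_ennreal ennreal_mult')
  qed
  then show ?thesis by (simp only: F_def G_def)
qed

text \<open>The kernel is split as the product of its powers 1/p and 1/q with p conjugate to q.
  Hoelder's inequality produces the q-th power of \<open>f\<close> averaged against the kernel, and
  Tonelli with translation invariance integrates the average.\<close>

lemma nn_integral_Young_convolution:
  fixes k f :: "'a::euclidean_space \<Rightarrow> ennreal"
  assumes q: "q > 1" and [measurable]: "k \<in> borel_measurable borel" "f \<in> borel_measurable borel"
  shows "(\<integral>\<^sup>+x. epow (\<integral>\<^sup>+y. k (x - y) * f y \<partial>lborel) q \<partial>lborel) \<le>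
    epow (\<integral>\<^sup>+x. k x \<partial>lborel) q * (\<integral>\<^sup>+x. epow (f x) q \<partial>lborel)"
proof -
  define p where "p = q / (q - 1)"
  have p: "p > 1" and pq: "1 / p + 1 / q = 1" using q by (auto simp: p_def field_simps)
  define K where "K = (\<integral>\<^sup>+x. k x \<partial>lborel)"
  have Kx: "(\<integral>\<^sup>+y. k (x - y) \<partial>lborel) = K" for x
    unfolding K_def by (rule nn_integral_lborel_reflect) measurable
  have "epow (\<integral>\<^sup>+y. k (x - y) * f y \<partial>lborel) q \<le> epow K (q / p) * (\<integral>\<^sup>+y. k (x - y) * epow (f y) q \<partial>lborel)" for x
  proof -
    have split: "k (x - y) = epow (k (x - y)) (1 / p) * epow (k (x - y)) (1 / q)" for y
      using epow_add[of "1 / p" "1 / q" "k (x - y)"] p q by (simp add: pq)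
    have "(\<integral>\<^sup>+y. k (x - y) * f y \<partial>lborel) = (\<integral>\<^sup>+y. epow (k (x - y)) (1 / p) * (epow (k (x - y)) (1 / q) * f y) \<partial>lborel)"
      by (subst split) (simp add: mult.assoc)
    also have "\<dots> \<le> epow (\<integral>\<^sup>+y. epow (epow (k (x - y)) (1 / p)) p \<partial>lborel) (1 / p) *
        epow (\<integral>\<^sup>+y. epow (epow (k (x - y)) (1 / q) * f y) q \<partial>lborel) (1 / q)"
      by (rule nn_integral_Holder[OF p q pq]) measurable
    also have "\<dots> = epow K (1 / p) * epow (\<integral>\<^sup>+y. k (x - y) * epow (f y) q \<partial>lborel) (1 / q)"
      using p q by (simp add: epow_epow epow_mult Kx)
    finally have "epow (\<integral>\<^sup>+y. k (x - y) * f y \<partial>lborel) q \<le>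
        epow (epow K (1 / p) * epow (\<integral>\<^sup>+y. k (x - y) * epow (f y) q \<partial>lborel) (1 / q)) q"
      using q by (intro epow_mono) auto
    then show ?thesis using q by (simp add: epow_mult epow_epow)
  qed
  then have "(\<integral>\<^sup>+x. epow (\<integral>\<^sup>+y. k (x - y) * f y \<partial>lborel) q \<partial>lborel) \<le>
      (\<integral>\<^sup>+x. epow K (q / p) * (\<integral>\<^sup>+y. k (x - y) * epow (f y) q \<partial>lborel) \<partial>lborel)"
    by (rule nn_integral_mono)
  also have "\<dots> = epow K (q / p) * (\<integral>\<^sup>+x. \<integral>\<^sup>+y. k (x - y) * epow (f y) q \<partial>lborel \<partial>lborel)"
    by (rule nn_integral_cmult) measurable
  also have "(\<integral>\<^sup>+x. \<integral>\<^sup>+y. k (x - y) * epow (f y) q \<partial>lborel \<partial>lborel) = (\<integral>\<^sup>+y. \<integral>\<^sup>+x. k (x - y) * epow (f y) q \<partial>lborel \<partial>lborel)"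
    by (rule lborel_pair.Fubini') measurable
  also have "\<dots> = (\<integral>\<^sup>+y. K * epow (f y) q \<partial>lborel)"
  proof (rule nn_integral_cong)
    fix y
    have "(\<integral>\<^sup>+x. k (x - y) \<partial>lborel) = K"
      unfolding K_def using nn_integral_lborel_translate[of k "- y"] by simp
    then show "(\<integral>\<^sup>+x. k (x - y) * epow (f y) q \<partial>lborel) = K * epow (f y) q"
      by (subst nn_integral_multc) auto
  qed
  also have "\<dots> = K * (\<integral>\<^sup>+y. epow (f y) q \<partial>lborel)" by (rule nn_integral_cmult) measurable
  also have "epow K (q / p) * (K * (\<integral>\<^sup>+y. epow (f y) q \<partial>lborel)) = epow K q * (\<integral>\<^sup>+y. epow (f y) q \<partial>lborel)"
  proof -
    have "q / p + 1 = q" using q by (simp add: p_def field_simps)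
    then have "epow K (q / p) * K = epow K q"
      using epow_add[of "q / p" 1 K] p q by simp
    then show ?thesis by (simp add: mult.assoc[symmetric])
  qed
  finally show ?thesis by (simp add: K_def)
qed

section \<open>Cutoff of potentials\<close>

lemma smooth_with_add:
  assumes P: "\<And>f g. P f \<Longrightarrow> P g \<Longrightarrow> P (\<lambda>x. f x + g x)" and f: "smooth_with P f" and g: "smooth_with P g"
  shows "smooth_with P (\<lambda>x. f x + g x)"
proof (rule smooth_with_invariant[where S="{\<lambda>x. f x + g x |f g. smooth_with P f \<and> smooth_with P g}"])
  fix h x assume "h \<in> {\<lambda>x. f x + g x |f g. smooth_with P f \<and> smooth_with P g}"
  then obtain f g where h: "h = (\<lambda>x. f x + g x)" "smooth_with P f" "smooth_with P g" by blast
  then have s: "smooth f" "smooth g" by (auto dest: smooth_with_smooth)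
  show "P h" using h P by (auto dest: smooth_with_prop)
  show "h differentiable at x" using s h(1) by (auto intro: smooth_differentiable smooth_add)
  have "dderiv v h = (\<lambda>x. dderiv v f x + dderiv v g x)" for v
    using s by (auto simp: h(1) dderiv_add smooth_differentiable)
  then show "dderiv v h \<in> {\<lambda>x. f x + g x |f g. smooth_with P f \<and> smooth_with P g}" for v
    using h(2,3) smooth_with_dderiv by blast
qed (use f g in blast)

lemma smooth_with_cmult:
  assumes P: "\<And>f. P f \<Longrightarrow> P (\<lambda>x. c * f x)" and f: "smooth_with P f"
  shows "smooth_with P (\<lambda>x. c * f x)"
proof (rule smooth_with_invariant[where S="{\<lambda>x. c * f x |f. smooth_with P f}"])
  fix h x assume "h \<in> {\<lambda>x. c * f x |f. smooth_with P f}"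
  then obtain f where h: "h = (\<lambda>x. c * f x)" "smooth_with P f" by blast
  then have s: "smooth f" by (auto dest: smooth_with_smooth)
  show "P h" using h P by (auto dest: smooth_with_prop)
  show "h differentiable at x" using s h(1) by (auto intro: smooth_differentiable smooth_cmult)
  have "dderiv v h = (\<lambda>x. c * dderiv v f x)" for v
    using dderiv_linear_fun[OF smooth_const[of 0] s, of v c] by (simp add: h(1) dderiv_const)
  then show "dderiv v h \<in> {\<lambda>x. c * f x |f. smooth_with P f}" for v
    using h(2) smooth_with_dderiv by blast
qed (use f in blast)

lemma smooth_with_bdint_sum:
  assumes "\<And>i. i \<in> I \<Longrightarrow> smooth_with bdint (f i)"
  shows "smooth_with bdint (\<lambda>x. \<Sum>i\<in>I. f i x)"
proof -
  have z: "smooth_with bdint (\<lambda>x. 0)"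
    by (rule smooth_with_invariant[where S="{\<lambda>x. 0}"]) (auto simp: dderiv_const bdint_zero)
  show ?thesis using assms
    by (induction I rule: infinite_finite_induct) (auto intro: z smooth_with_add bdint_add)
qed

lemma smooth_with_bdint_oml:
  assumes "smooth_with bdint f" shows "smooth_with bdint (one_minus_laplacian f)"
proof -
  have "smooth_with bdint (\<lambda>x. f x + (-1) * (\<Sum>b\<in>Basis. dderiv b (dderiv b f) x))"
    by (intro smooth_with_add smooth_with_cmult smooth_with_bdint_sum smooth_with_dderiv assms bdint_add bdint_cmult)
  then show ?thesis by (simp add: one_minus_laplacian_def[abs_def])
qed

lemma bdint_oml_pow: "smooth_with bdint f \<Longrightarrow> bdint ((one_minus_laplacian ^^ k) f)"
proof -
  assume "smooth_with bdint f"
  then have "smooth_with bdint ((one_minus_laplacian ^^ k) f)"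
    by (induction k) (auto intro: smooth_with_bdint_oml)
  then show ?thesis by (rule smooth_with_prop)
qed

lemma oml_mult:
  assumes a: "smooth a" and b: "smooth b"
  shows "one_minus_laplacian (\<lambda>x. a x * b x) x = a x * one_minus_laplacian b x
    - 2 * (\<Sum>i\<in>Basis. dderiv i a x * dderiv i b x) - (\<Sum>i\<in>Basis. dderiv i (dderiv i a) x * b x)"
proof -
  note d = smooth_differentiable[OF a] smooth_differentiable[OF b]
    smooth_differentiable[OF smooth_dderiv[OF a]] smooth_differentiable[OF smooth_dderiv[OF b]]
  have 1: "dderiv i (\<lambda>x. a x * b x) = (\<lambda>x. a x * dderiv i b x + dderiv i a x * b x)" for i
    by (rule ext) (simp add: dderiv_mult d)
  have 2: "dderiv i (dderiv i (\<lambda>x. a x * b x)) x = a x * dderiv i (dderiv i b) x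
      + (2 * (dderiv i a x * dderiv i b x) + dderiv i (dderiv i a) x * b x)" for i
    unfolding 1 by (subst dderiv_add) (auto simp: dderiv_mult d intro!: differentiable_mult)
  show ?thesis
    unfolding one_minus_laplacian_def 2
    by (simp add: sum.distrib algebra_simps flip: sum_distrib_left)
qed

definition bounded_fun :: "('a \<Rightarrow> real) \<Rightarrow> bool" where
  "bounded_fun f \<longleftrightarrow> (\<exists>B. \<forall>x. \<bar>f x\<bar> \<le> B)"

text \<open>Each derivative that falls on the dilated cutoff gains a factor \<open>1 / R\<close>.\<close>

lemma oml_pow_cutoff:
  fixes \<kappa> u :: "'a::euclidean_space \<Rightarrow> real"
  assumes "smooth_with bounded_fun \<kappa>" and "smooth_with bdint u"
  shows "\<exists>\<Psi>. bdint \<Psi> \<and> (\<forall>R\<ge>1. \<forall>x. \<bar>(one_minus_laplacian ^^ k) (\<lambda>y. \<kappa> ((1 / R) *\<^sub>R y) * u y) x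
     - \<kappa> ((1 / R) *\<^sub>R x) * (one_minus_laplacian ^^ k) u x\<bar> \<le> \<Psi> x / R)"
  using assms
proof (induction k arbitrary: \<kappa> u)
  case 0
  show ?case by (rule exI[of _ "\<lambda>x. 0"]) (simp add: bdint_zero)
next
  case (Suc k)
  let ?L = "one_minus_laplacian ^^ k"
  note \<kappa> = Suc.prems(1) and u = Suc.prems(2)
  note su = smooth_with_smooth[OF u] and s\<kappa> = smooth_with_smooth[OF \<kappa>]
  obtain \<Psi>0 where \<Psi>0: "bdint \<Psi>0" "\<And>R x. R \<ge> 1 \<Longrightarrow>
      \<bar>?L (\<lambda>y. \<kappa> ((1 / R) *\<^sub>R y) * one_minus_laplacian u y) x - \<kappa> ((1 / R) *\<^sub>R x) * ?L (one_minus_laplacian u) x\<bar> \<le> \<Psi>0 x / R"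
    using Suc.IH[OF \<kappa> smooth_with_bdint_oml[OF u]] by blast
  \<comment> \<open>Terms in which a derivative has hit the cutoff already carry a factor
    \<open>1 / R\<close>, so a bound uniform in \<open>R\<close> suffices for them. It follows from
    the induction hypothesis, which is general in both the cutoff and the function and hence applies
    to their derivatives.\<close>
  have rem: "\<exists>\<Phi>. bdint \<Phi> \<and> (\<forall>R\<ge>1. \<forall>x. \<bar>?L (\<lambda>y. \<eta> ((1 / R) *\<^sub>R y) * w y) x\<bar> \<le> \<Phi> x)"
    if \<eta>: "smooth_with bounded_fun \<eta>" and w: "smooth_with bdint w" for \<eta> w :: "'a \<Rightarrow> real"
  proof -
    obtain \<Psi> where \<Psi>: "bdint \<Psi>" "\<And>R x. R \<ge> 1 \<Longrightarrow> \<bar>?L (\<lambda>y. \<eta> ((1 / R) *\<^sub>R y) * w y) x - \<eta> ((1 / R) *\<^sub>R x) * ?L w x\<bar> \<le> \<Psi> x / R"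
      using Suc.IH[OF \<eta> w] by blast
    obtain B where B: "\<And>x. \<bar>\<eta> x\<bar> \<le> B" using smooth_with_prop[OF \<eta>] by (auto simp: bounded_fun_def)
    show ?thesis
    proof (intro exI conjI allI impI)
      show "bdint (\<lambda>x. \<bar>\<Psi> x\<bar> + B * \<bar>?L w x\<bar>)"
        by (intro bdint_add bdint_cmult bdint_abs \<Psi>(1) bdint_oml_pow w)
      fix R :: real and x assume R: "R \<ge> 1"
      have "\<Psi> x / R \<le> \<bar>\<Psi> x\<bar> / R" using R by (intro divide_right_mono) auto
      also have "\<dots> \<le> \<bar>\<Psi> x\<bar>" using R by (simp add: divide_le_eq mult_le_cancel_left1)
      finally have "\<Psi> x / R \<le> \<bar>\<Psi> x\<bar>" .
      moreover have "\<bar>\<eta> ((1 / R) *\<^sub>R x) * ?L w x\<bar> \<le> B * \<bar>?L w x\<bar>"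
        unfolding abs_mult by (intro mult_right_mono B) auto
      ultimately show "\<bar>?L (\<lambda>y. \<eta> ((1 / R) *\<^sub>R y) * w y) x\<bar> \<le> \<bar>\<Psi> x\<bar> + B * \<bar>?L w x\<bar>"
        using \<Psi>(2)[OF R, of x] by linarith
    qed
  qed
  have "\<forall>i. \<exists>\<Phi>. bdint \<Phi> \<and> (\<forall>R\<ge>1. \<forall>x. \<bar>?L (\<lambda>y. dderiv i \<kappa> ((1 / R) *\<^sub>R y) * dderiv i u y) x\<bar> \<le> \<Phi> x)"
    by (intro allI rem smooth_with_dderiv \<kappa> u)
  from choice[OF this] obtain \<Phi> where \<Phi>: "\<And>i. bdint (\<Phi> i)"
    "\<And>i R x. R \<ge> 1 \<Longrightarrow> \<bar>?L (\<lambda>y. dderiv i \<kappa> ((1 / R) *\<^sub>R y) * dderiv i u y) x\<bar> \<le> \<Phi> i x" by blast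
  have "\<forall>i. \<exists>\<Phi>. bdint \<Phi> \<and> (\<forall>R\<ge>1. \<forall>x. \<bar>?L (\<lambda>y. dderiv i (dderiv i \<kappa>) ((1 / R) *\<^sub>R y) * u y) x\<bar> \<le> \<Phi> x)"
    by (intro allI rem smooth_with_dderiv \<kappa> u)
  from choice[OF this] obtain \<Theta> where \<Theta>: "\<And>i. bdint (\<Theta> i)"
    "\<And>i R x. R \<ge> 1 \<Longrightarrow> \<bar>?L (\<lambda>y. dderiv i (dderiv i \<kappa>) ((1 / R) *\<^sub>R y) * u y) x\<bar> \<le> \<Theta> i x" by blast
  show ?case
  proof (intro exI conjI allI impI)
    show "bdint (\<lambda>x. \<Psi>0 x + (2 * (\<Sum>i\<in>Basis. \<Phi> i x) + (\<Sum>i\<in>Basis. \<Theta> i x)))"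
      by (intro bdint_add bdint_cmult bdint_sum \<Psi>0 \<Phi> \<Theta>)
    fix R :: real and x :: 'a assume R: "R \<ge> 1"
    define c where "c = 1 / R"
    have c: "0 < c" "c \<le> 1" using R by (auto simp: c_def)
    have sc: "smooth (\<lambda>y. f (c *\<^sub>R y))" if "smooth f" for f :: "'a \<Rightarrow> real"
      using smooth_affine[OF that, of 0 c] by simp
    have dc: "dderiv v (\<lambda>y. f (c *\<^sub>R y)) = (\<lambda>y. c * dderiv v f (c *\<^sub>R y))" if "smooth f" for f :: "'a \<Rightarrow> real" and v
      using dderiv_affine[of f v 0 c] that by (simp add: smooth_differentiable)
    have dc2: "dderiv v (\<lambda>y. c * dderiv v \<kappa> (c *\<^sub>R y)) = (\<lambda>y. c * (c * dderiv v (dderiv v \<kappa>) (c *\<^sub>R y)))" for v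
      using dderiv_linear_fun[OF smooth_const[of 0] sc[OF smooth_dderiv[OF s\<kappa>]], of v c v]
      by (simp add: dderiv_const dc smooth_dderiv s\<kappa>)
    define A where "A = (\<lambda>y. \<kappa> (c *\<^sub>R y) * one_minus_laplacian u y)"
    define B where "B = (\<lambda>i y. dderiv i \<kappa> (c *\<^sub>R y) * dderiv i u y)"
    define C where "C = (\<lambda>i y. dderiv i (dderiv i \<kappa>) (c *\<^sub>R y) * u y)"
    have sA: "smooth A" and sB: "smooth (B i)" and sC: "smooth (C i)" for i
      unfolding A_def B_def C_def by (intro smooth_mult sc s\<kappa> smooth_oml su smooth_dderiv)+
    have "one_minus_laplacian (\<lambda>y. \<kappa> (c *\<^sub>R y) * u y) =
        (\<lambda>y. (A y + (-2 * c) * (\<Sum>i\<in>Basis. B i y)) + (- (c * c)) * (\<Sum>i\<in>Basis. C i y))"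
      by (rule ext, subst oml_mult[OF sc[OF s\<kappa>] su])
         (simp add: dc s\<kappa> dc2 A_def B_def C_def sum_distrib_left mult_ac sum_negf)
    then have "(one_minus_laplacian ^^ Suc k) (\<lambda>y. \<kappa> (c *\<^sub>R y) * u y) x =
        ?L (\<lambda>y. (A y + (-2 * c) * (\<Sum>i\<in>Basis. B i y)) + (- (c * c)) * (\<Sum>i\<in>Basis. C i y)) x"
      by (simp only: funpow_Suc_right comp_def)
    also have "\<dots> = ?L A x + (-2 * c) * (\<Sum>i\<in>Basis. ?L (B i) x) + (- (c * c)) * (\<Sum>i\<in>Basis. ?L (C i) x)"
      by (subst oml_pow_linear, (intro smooth_add smooth_cmult smooth_sum sA sB sC)+,
          subst oml_pow_linear, (intro smooth_add smooth_cmult smooth_sum sA sB sC)+,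
          subst (1 2) oml_pow_sum) (auto intro: sB sC)
    finally have eq: "(one_minus_laplacian ^^ Suc k) (\<lambda>y. \<kappa> (c *\<^sub>R y) * u y) x =
       ?L A x + (-2 * c) * (\<Sum>i\<in>Basis. ?L (B i) x) + (- (c * c)) * (\<Sum>i\<in>Basis. ?L (C i) x)" .
    have eq2: "(one_minus_laplacian ^^ Suc k) u x = ?L (one_minus_laplacian u) x"
      by (simp only: funpow_Suc_right comp_def)
    have bA: "\<bar>?L A x - \<kappa> (c *\<^sub>R x) * ?L (one_minus_laplacian u) x\<bar> \<le> c * \<Psi>0 x"
      using \<Psi>0(2)[OF R, of x] by (simp add: A_def c_def)
    have bB: "\<bar>\<Sum>i\<in>Basis. ?L (B i) x\<bar> \<le> (\<Sum>i\<in>Basis. \<Phi> i x)"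
      using \<Phi>(2)[OF R, of _ x] by (intro order_trans[OF sum_abs] sum_mono) (simp add: B_def c_def)
    have bC: "\<bar>\<Sum>i\<in>Basis. ?L (C i) x\<bar> \<le> (\<Sum>i\<in>Basis. \<Theta> i x)"
      using \<Theta>(2)[OF R, of _ x] by (intro order_trans[OF sum_abs] sum_mono) (simp add: C_def c_def)
    have "\<bar>(-2 * c) * (\<Sum>i\<in>Basis. ?L (B i) x)\<bar> \<le> c * (2 * (\<Sum>i\<in>Basis. \<Phi> i x))"
      using bB c by (simp add: abs_mult)
    moreover have "\<bar>(- (c * c)) * (\<Sum>i\<in>Basis. ?L (C i) x)\<bar> \<le> c * (\<Sum>i\<in>Basis. \<Theta> i x)"
    proof -
      have "c * c * \<bar>\<Sum>i\<in>Basis. ?L (C i) x\<bar> \<le> c * 1 * (\<Sum>i\<in>Basis. \<Theta> i x)"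
        using c bC by (intro mult_mono) auto
      then show ?thesis using c by (simp add: abs_mult)
    qed
    ultimately have "\<bar>(one_minus_laplacian ^^ Suc k) (\<lambda>y. \<kappa> (c *\<^sub>R y) * u y) x - \<kappa> (c *\<^sub>R x) * (one_minus_laplacian ^^ Suc k) u x\<bar>
        \<le> c * \<Psi>0 x + c * (2 * (\<Sum>i\<in>Basis. \<Phi> i x)) + c * (\<Sum>i\<in>Basis. \<Theta> i x)"
      using bA unfolding eq eq2 by linarith
    moreover have eqR: "c * \<Psi>0 x + c * (2 * (\<Sum>i\<in>Basis. \<Phi> i x)) + c * (\<Sum>i\<in>Basis. \<Theta> i x) =
        (\<Psi>0 x + (2 * (\<Sum>i\<in>Basis. \<Phi> i x) + (\<Sum>i\<in>Basis. \<Theta> i x))) / R"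
      by (simp add: c_def add_divide_distrib)
    ultimately show "\<bar>(one_minus_laplacian ^^ Suc k) (\<lambda>y. \<kappa> ((1 / R) *\<^sub>R y) * u y) x - \<kappa> ((1 / R) *\<^sub>R x) * (one_minus_laplacian ^^ Suc k) u x\<bar>
        \<le> (\<Psi>0 x + (2 * (\<Sum>i\<in>Basis. \<Phi> i x) + (\<Sum>i\<in>Basis. \<Theta> i x))) / R"
      unfolding c_def[symmetric] by (simp only: eqR)
  qed
qed

definition cutoff :: "'a::euclidean_space \<Rightarrow> real" where
  "cutoff x = exp 1 * bump x"

lemma cutoff_0: "cutoff 0 = 1"
  by (simp add: cutoff_def bump_def bump_profile_def flip: exp_add)

lemma cutoff_nonneg: "cutoff x \<ge> 0"
  by (simp add: cutoff_def bump_nonneg)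

lemma cutoff_test_function: "cutoff \<in> test_functions"
  unfolding cutoff_def[abs_def] by (intro test_functions_cmult bump_test_function)

lemma smooth_with_bounded_cutoff: "smooth_with bounded_fun cutoff"
proof (rule smooth_with_invariant[where S=test_functions])
  fix f :: "'a \<Rightarrow> real" assume f: "f \<in> test_functions"
  show "bounded_fun f" using test_functions_boundedE[OF f] unfolding bounded_fun_def by blast
qed (auto intro: cutoff_test_function test_functions_dderiv smooth_differentiable test_functions_smooth)

text \<open>The potential \<open>u\<close> has in general no compact support, so it cannot be tested
  directly; its cutoffs are test functions, and their densities converge to \<open>h\<close>. The
  commutator bound for the cutoff supplies one bounded integrable envelope \<open>D\<close> for all
  \<open>n\<close>, so that dominated convergence applies first inside the convolution and then to
  the p-th powers.\<close>

lemma Lp_norm_bessel_density_cutoff_tendsto: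
  fixes h :: "'a::euclidean_space \<Rightarrow> real"
  assumes \<alpha>: "\<alpha> > 0" and p: "p \<ge> 1" and h: "h \<in> test_functions"
  defines "u \<equiv> fun_conv (bessel_kernel_real \<alpha>) h"
  shows "(\<lambda>n. Lp_norm p (bessel_density \<alpha> (\<lambda>y. cutoff ((1 / real (Suc n)) *\<^sub>R y) * u y))) \<longlonglongrightarrow> Lp_norm p h"
proof -
  define k where "k = density_order \<alpha>"
  define \<beta> where "\<beta> = 2 * real k - \<alpha>"
  let ?L = "one_minus_laplacian ^^ k"
  have \<beta>: "\<beta> > 0" using density_order_pos[OF \<alpha>] by (simp add: \<beta>_def k_def)
  note gi = integrable_bessel_kernel_real[OF \<alpha>, where ?'a='a] integrable_bessel_kernel_real[OF \<beta>, where ?'a='a]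
  have u: "smooth_with bdint u" unfolding u_def by (rule smooth_with_fun_conv[OF gi(1) h])
  obtain \<Psi> where \<Psi>: "bdint \<Psi>" "\<And>R x. R \<ge> 1 \<Longrightarrow>
      \<bar>?L (\<lambda>y. cutoff ((1 / R) *\<^sub>R y) * u y) x - cutoff ((1 / R) *\<^sub>R x) * ?L u x\<bar> \<le> \<Psi> x / R"
    using oml_pow_cutoff[OF smooth_with_bounded_cutoff u, of k] by blast
  obtain B where B: "B > 0" "\<And>x::'a. \<bar>cutoff x\<bar> \<le> B"
    by (rule test_functions_boundedE[OF cutoff_test_function]) (rule that)
  define \<phi> where "\<phi> n = (\<lambda>y. cutoff ((1 / real (Suc n)) *\<^sub>R y) * u y)" for n
  have \<phi>: "\<phi> n \<in> test_functions" for n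
    unfolding \<phi>_def using test_functions_affine[OF cutoff_test_function, of "1 / real (Suc n)" 0] smooth_with_smooth[OF u]
    by (intro test_functions_mult) auto
  define D where "D = (\<lambda>x. \<bar>\<Psi> x\<bar> + B * \<bar>?L u x\<bar>)"
  have D: "bdint D" unfolding D_def by (intro bdint_add bdint_cmult bdint_abs \<Psi>(1) bdint_oml_pow u)
  have L\<phi>: "\<bar>?L (\<phi> n) x - cutoff ((1 / real (Suc n)) *\<^sub>R x) * ?L u x\<bar> \<le> \<Psi> x / real (Suc n)" for n x
    unfolding \<phi>_def using \<Psi>(2)[of "real (Suc n)" x] by simp
  have bD: "\<bar>?L (\<phi> n) x\<bar> \<le> D x" for n x
  proof -
    have "\<Psi> x / real (Suc n) \<le> \<bar>\<Psi> x\<bar> / real (Suc n)" by (intro divide_right_mono) auto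
    also have "\<dots> \<le> \<bar>\<Psi> x\<bar>" by (simp add: divide_le_eq mult_le_cancel_left1)
    finally have "\<Psi> x / real (Suc n) \<le> \<bar>\<Psi> x\<bar>" .
    moreover have "\<bar>cutoff ((1 / real (Suc n)) *\<^sub>R x) * ?L u x\<bar> \<le> B * \<bar>?L u x\<bar>"
      unfolding abs_mult by (intro mult_right_mono B) auto
    ultimately show ?thesis using L\<phi>[of n x] unfolding D_def by linarith
  qed
  have lim: "(\<lambda>n. ?L (\<phi> n) x) \<longlonglongrightarrow> ?L u x" for x
  proof -
    have i0: "(\<lambda>n. 1 / real (Suc n)) \<longlonglongrightarrow> 0" by (rule lim_1_over_n[THEN LIMSEQ_Suc])
    have "(\<lambda>n. \<Psi> x * (1 / real (Suc n))) \<longlonglongrightarrow> \<Psi> x * 0" by (intro tendsto_intros i0)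
    then have g0: "(\<lambda>n. \<Psi> x / real (Suc n)) \<longlonglongrightarrow> 0" by simp
    have "(\<lambda>n. ?L (\<phi> n) x - cutoff ((1 / real (Suc n)) *\<^sub>R x) * ?L u x) \<longlonglongrightarrow> 0"
      by (rule Lim_null_comparison[OF always_eventually g0], rule allI, unfold real_norm_def, rule L\<phi>)
    moreover have "(\<lambda>n. (1 / real (Suc n)) *\<^sub>R x) \<longlonglongrightarrow> 0 *\<^sub>R x"
      by (intro tendsto_scaleR i0 tendsto_const)
    then have "(\<lambda>n. cutoff ((1 / real (Suc n)) *\<^sub>R x)) \<longlonglongrightarrow> cutoff (0 *\<^sub>R x)"
      by (rule continuous_on_tendsto_compose[OF test_functions_continuous[OF cutoff_test_function, of UNIV]]) auto
    then have "(\<lambda>n. cutoff ((1 / real (Suc n)) *\<^sub>R x) * ?L u x) \<longlonglongrightarrow> cutoff (0 *\<^sub>R x) * ?L u x"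
      by (intro tendsto_mult tendsto_const)
    ultimately show ?thesis using tendsto_add by (fastforce simp: cutoff_0)
  qed
  define f where "f n = bessel_density \<alpha> (\<phi> n)" for n
  have f_eq: "f n = fun_conv (bessel_kernel_real \<beta>) (?L (\<phi> n))" for n
    by (simp add: f_def bessel_density_def k_def \<beta>_def)
  have [measurable]: "?L (\<phi> n) \<in> borel_measurable borel" "?L u \<in> borel_measurable borel" "D \<in> borel_measurable borel"
     "h \<in> borel_measurable borel" for n
    by (intro bdint_measurable D bdint_oml_pow u test_functions_bdint test_functions_oml_pow \<phi> h)+
  obtain BD where BD: "BD > 0" "\<And>x. \<bar>D x\<bar> \<le> BD" by (rule bdint_boundedE[OF D]) (rule that)
  have Dn: "D x \<ge> 0" for x using B by (simp add: D_def)
  have ci: "integrable lborel (\<lambda>y. bessel_kernel_real \<beta> (x - y) * D y)" for x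
    by (rule integrable_conv_integrand[OF gi(2) _ BD(2)]) measurable
  have limf: "(\<lambda>n. f n x) \<longlonglongrightarrow> h x" for x
  proof -
    have "(\<lambda>n. f n x) \<longlonglongrightarrow> fun_conv (bessel_kernel_real \<beta>) (?L u) x"
      unfolding f_eq fun_conv_def
    proof (rule integral_dominated_convergence[OF _ _ ci])
      show "AE y in lborel. (\<lambda>n. bessel_kernel_real \<beta> (x - y) * ?L (\<phi> n) y) \<longlonglongrightarrow> bessel_kernel_real \<beta> (x - y) * ?L u y"
        by (intro AE_I2 tendsto_intros lim)
      show "AE y in lborel. norm (bessel_kernel_real \<beta> (x - y) * ?L (\<phi> n) y) \<le> bessel_kernel_real \<beta> (x - y) * D y" for n
        by (intro AE_I2) (simp add: abs_mult bessel_kernel_real_nonneg mult_left_mono bD)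
    qed measurable
    \<comment> \<open>The operator passes through the convolution onto \<open>h\<close>.
      Associativity lets the kernels of orders \<beta> and \<alpha> change places, after which the
      convolution with the kernel of order \<alpha> undoes the density of the test function
      \<open>h\<close>.\<close>
    also have "fun_conv (bessel_kernel_real \<beta>) (?L u) x = h x"
    proof -
      have Lh: "bdint (?L h)" by (intro test_functions_bdint test_functions_oml_pow h)
      have "fun_conv (bessel_kernel_real \<beta>) (?L u) x = fun_conv (bessel_kernel_real \<beta>) (fun_conv (bessel_kernel_real \<alpha>) (?L h)) x"
        unfolding u_def oml_pow_fun_conv[OF gi(1) h] ..
      also have "\<dots> = fun_conv (fun_conv (bessel_kernel_real \<beta>) (bessel_kernel_real \<alpha>)) (?L h) x"
        by (rule fun_conv_assoc[OF gi(2,1) Lh])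
      also have "fun_conv (bessel_kernel_real \<beta>) (bessel_kernel_real \<alpha>) = fun_conv (bessel_kernel_real \<alpha>) (bessel_kernel_real \<beta> :: 'a \<Rightarrow> real)"
        by (rule ext) (rule fun_conv_commute)
      also have "fun_conv (fun_conv (bessel_kernel_real \<alpha>) (bessel_kernel_real \<beta>)) (?L h) x =
          fun_conv (bessel_kernel_real \<alpha>) (fun_conv (bessel_kernel_real \<beta>) (?L h)) x"
        by (rule fun_conv_assoc[OF gi Lh, symmetric])
      also have "\<dots> = h x"
        using fun_conv_bessel_density[OF \<alpha> h, of x] by (simp add: bessel_density_def k_def \<beta>_def)
      finally show ?thesis .
    qed
    finally show ?thesis .
  qed
  define E where "E = fun_conv (bessel_kernel_real \<beta>) D"
  have E: "bdint E" unfolding E_def by (rule bdint_fun_conv[OF gi(2) D])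
  have bE: "\<bar>f n x\<bar> \<le> E x" for n x
  proof -
    have "\<bar>f n x\<bar> \<le> (LINT y|lborel. \<bar>bessel_kernel_real \<beta> (x - y) * ?L (\<phi> n) y\<bar>)"
      unfolding f_eq fun_conv_def by (rule integral_abs_bound)
    also have "\<dots> \<le> E x" unfolding E_def fun_conv_def
      by (rule integral_mono'[OF ci]) (auto simp: abs_mult bessel_kernel_real_nonneg Dn intro!: mult_left_mono bD)
    finally show ?thesis .
  qed
  have [measurable]: "f n \<in> borel_measurable borel" "E \<in> borel_measurable borel" for n
    unfolding f_def by (intro bdint_measurable bdint_bessel_density \<alpha> \<phi> E)+
  have "(\<lambda>n. LINT x|lborel. \<bar>f n x\<bar> powr p) \<longlonglongrightarrow> (LINT x|lborel. \<bar>h x\<bar> powr p)"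
  proof (rule integral_dominated_convergence[where w="\<lambda>x. \<bar>E x\<bar> powr p"])
    show "integrable lborel (\<lambda>x. \<bar>E x\<bar> powr p)" using bdint_Lp_space[OF E p] by (simp add: Lp_space_def)
    show "AE x in lborel. (\<lambda>n. \<bar>f n x\<bar> powr p) \<longlonglongrightarrow> \<bar>h x\<bar> powr p"
      using p by (intro AE_I2 tendsto_powr' tendsto_rabs limf tendsto_const) auto
    show "AE x in lborel. norm (\<bar>f n x\<bar> powr p) \<le> \<bar>E x\<bar> powr p" for n
    proof (rule AE_I2)
      fix x
      have "\<bar>f n x\<bar> \<le> \<bar>E x\<bar>" using bE[of n x] by linarith
      then have "\<bar>f n x\<bar> powr p \<le> \<bar>E x\<bar> powr p" using p by (intro powr_mono2) auto
      then show "norm (\<bar>f n x\<bar> powr p) \<le> \<bar>E x\<bar> powr p" by simp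
    qed
  qed measurable
  then have "(\<lambda>n. Lp_norm p (f n)) \<longlonglongrightarrow> Lp_norm p h"
    unfolding Lp_norm_def using p by (intro tendsto_powr' tendsto_const) auto
  then show ?thesis by (simp only: f_def \<phi>_def)
qed

section \<open>The dual norm controls the potential\<close>

text \<open>The common setting for \<mu> and its image: both are instances as soon as the
  pushforward is finite on compact sets, so that one set of estimates serves both sides of the
  comparison.\<close>

locale locally_finite_measure =
  fixes M :: "'a::euclidean_space measure"
  assumes sets_eq_borel[measurable_cong]: "sets M = sets borel"
    and finite_on_compacts: "finite_on_compacts M"
begin

lemma space_eq_UNIV: "space M = UNIV"
  using sets_eq_imp_space_eq[OF sets_eq_borel] by simp

lemma emeasure_compact_finite: "compact K \<Longrightarrow> emeasure M K < \<infinity>"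
  using finite_on_compacts by (simp add: finite_on_compacts_def)

lemma emeasure_bounded_finite: "bounded S \<Longrightarrow> emeasure M S < \<infinity>"
proof -
  assume "bounded S"
  then obtain e where "\<forall>x\<in>S. norm x \<le> e" unfolding bounded_iff ..
  then have "S \<subseteq> cball 0 e" by auto
  then have "emeasure M S \<le> emeasure M (cball 0 e)"
    by (intro emeasure_mono) (auto simp: sets_eq_borel)
  also have "\<dots> < \<infinity>" by (rule emeasure_compact_finite) simp
  finally show ?thesis .
qed

sublocale sigma_finite_measure M
proof
  show "\<exists>A. countable A \<and> A \<subseteq> sets M \<and> \<Union>A = space M \<and> (\<forall>a\<in>A. emeasure M a \<noteq> \<infinity>)"
  proof (intro exI conjI ballI)
    let ?A = "range (\<lambda>n::nat. cball (0::'a) (real n))"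
    show "countable ?A" by simp
    show "?A \<subseteq> sets M" by (auto simp: sets_eq_borel)
    show "\<Union>?A = space M" by (auto simp: space_eq_UNIV real_arch_simple)
    show "emeasure M a \<noteq> \<infinity>" if "a \<in> ?A" for a
      using that emeasure_bounded_finite[of a] by auto
  qed
qed

lemma integrable_test_function:
  assumes \<phi>: "\<phi> \<in> test_functions" shows "integrable M \<phi>"
proof -
  obtain B where B: "B > 0" "\<And>x. \<bar>\<phi> x\<bar> \<le> B" using test_functions_boundedE[OF \<phi>] by blast
  obtain R where R: "R > 0" "\<And>x. norm x \<ge> R \<Longrightarrow> \<phi> x = 0" using test_functions_supportE[OF \<phi>] by blast
  have [measurable]: "\<phi> \<in> borel_measurable borel" by (intro bdint_measurable test_functions_bdint \<phi>)
  show ?thesis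
  proof (rule integrableI_bounded_set[where A="cball 0 R" and B=B])
    show "emeasure M (cball 0 R) < \<infinity>" by (rule emeasure_compact_finite) simp
    show "AE x in M. x \<in> cball 0 R \<longrightarrow> norm (\<phi> x) \<le> B" using B by auto
    show "AE x in M. x \<notin> cball 0 R \<longrightarrow> \<phi> x = 0" using R(2) by auto
  qed (auto simp: sets_eq_borel)
qed

definition potential :: "real \<Rightarrow> 'a \<Rightarrow> ennreal" where
  "potential \<alpha> y = (\<integral>\<^sup>+x. bessel_kernel_nn \<alpha> (y - x) \<partial>M)"

lemma potential_measurable[measurable]: "potential \<alpha> \<in> borel_measurable borel"
  unfolding potential_def[abs_def] by measurable

end

lemma nn_integral_bessel_kernel_conv:
  fixes f :: "'a::euclidean_space \<Rightarrow> real"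
  assumes \<alpha>: "\<alpha> > 0" and [measurable]: "f \<in> borel_measurable borel" and B: "\<And>x. \<bar>f x\<bar> \<le> B" and nn: "\<And>x. f x \<ge> 0"
  shows "ennreal (fun_conv (bessel_kernel_real \<alpha>) f x) = (\<integral>\<^sup>+y. bessel_kernel_nn \<alpha> (x - y) * ennreal (f y) \<partial>lborel)"
proof -
  have "integrable lborel (\<lambda>y. bessel_kernel_real \<alpha> (x - y) * f y)"
    by (rule integrable_conv_integrand[OF integrable_bessel_kernel_real[OF \<alpha>] _ B]) measurable
  then have "ennreal (fun_conv (bessel_kernel_real \<alpha>) f x) = (\<integral>\<^sup>+y. ennreal (bessel_kernel_real \<alpha> (x - y) * f y) \<partial>lborel)"
    unfolding fun_conv_def by (intro nn_integral_eq_integral[symmetric]) (auto simp: bessel_kernel_real_nonneg nn)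
  also have "\<dots> = (\<integral>\<^sup>+y. bessel_kernel_nn \<alpha> (x - y) * ennreal (f y) \<partial>lborel)"
  proof (rule nn_integral_cong_AE)
    show "AE y in lborel. ennreal (bessel_kernel_real \<alpha> (x - y) * f y) = bessel_kernel_nn \<alpha> (x - y) * ennreal (f y)"
      using AE_lborel_reflect[OF AE_bessel_kernel_real[OF \<alpha>], of x]
      by eventually_elim (simp add: ennreal_mult'[OF nn] mult.commute ennreal_mult bessel_kernel_real_nonneg nn)
  qed
  finally show ?thesis .
qed

text \<open>For fixed heat time the integrand is continuous in space, and Fatou's lemma integrates
  this to lower semicontinuity. The origin, where the value may be infinite, is included.\<close>

lemma bessel_kernel_nn_lsc:
  fixes z :: "'a::euclidean_space"
  assumes \<alpha>: "\<alpha> > 0" and lim: "Z \<longlonglongrightarrow> z"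
  shows "bessel_kernel_nn \<alpha> z \<le> liminf (\<lambda>n. bessel_kernel_nn \<alpha> (Z n))"
proof -
  have "(\<lambda>n. ennreal (bessel_weight \<alpha> t * gauss t (Z n))) \<longlonglongrightarrow> ennreal (bessel_weight \<alpha> t * gauss t z)" for t
  proof (cases "t > 0")
    case True
    then show ?thesis
      by (auto simp: gauss_eq intro!: tendsto_ennrealI tendsto_intros lim)
  next
    case False
    then show ?thesis by (simp add: bessel_weight_def)
  qed
  then have "ennreal (bessel_weight \<alpha> t * gauss t z) = liminf (\<lambda>n. ennreal (bessel_weight \<alpha> t * gauss t (Z n)))" for t
    by (intro lim_imp_Liminf[symmetric]) auto
  then have "bessel_kernel_nn \<alpha> z = (\<integral>\<^sup>+t. liminf (\<lambda>n. ennreal (bessel_weight \<alpha> t * gauss t (Z n))) \<partial>lborel)"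
    by (simp add: bessel_kernel_nn_def)
  also have "\<dots> \<le> liminf (\<lambda>n. bessel_kernel_nn \<alpha> (Z n))"
    unfolding bessel_kernel_nn_def by (rule nn_integral_liminf) measurable
  finally show ?thesis .
qed

lemma ennreal_mult_liminf_le: "(c::ennreal) * liminf u \<le> liminf (\<lambda>n. c * u n)"
proof -
  have "c * liminf u = (SUP n. c * (INF m\<in>{n..}. u m))"
    unfolding liminf_SUP_INF by (rule SUP_mult_left_ennreal)
  also have "\<dots> \<le> (SUP n. INF m\<in>{n..}. c * u m)"
    by (intro SUP_mono' INF_greatest mult_left_mono INF_lower) auto
  finally show ?thesis by (simp only: liminf_SUP_INF)
qed

section \<open>Mollification\<close>

definition mollifier :: "nat \<Rightarrow> 'a::euclidean_space \<Rightarrow> real" where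
  "mollifier n z = real (Suc n) ^ DIM('a) * (bump (real (Suc n) *\<^sub>R z) / (LINT x|lborel. bump (x::'a)))"

lemma integral_bump_pos: "(LINT x|lborel. bump (x::'a::euclidean_space)) > 0"
proof -
  have i: "integrable lborel (bump :: 'a \<Rightarrow> real)"
    by (intro bdint_integrable test_functions_bdint bump_test_function)
  have "(LINT x|lborel. bump (x::'a)) \<noteq> 0"
  proof
    assume "(LINT x|lborel. bump (x::'a)) = 0"
    then have "AE x in lborel. bump (x::'a) = 0"
      by (subst (asm) integral_nonneg_eq_0_iff_AE[OF i]) (auto simp: bump_nonneg)
    then have "bump (0::'a) = 0"
      by (rule AE_eq_continuous_imp_eq) (auto intro: test_functions_continuous bump_test_function)
    with bump_pos[of "0::'a"] show False by simp
  qed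
  moreover have "(LINT x|lborel. bump (x::'a)) \<ge> 0" by (simp add: bump_nonneg)
  ultimately show ?thesis by simp
qed

lemma mollifier_test_function: "mollifier n \<in> test_functions"
proof -
  have "(\<lambda>z::'a. bump (0 + real (Suc n) *\<^sub>R z)) \<in> test_functions"
    by (rule test_functions_affine[OF bump_test_function]) simp
  from test_functions_cmult[OF this, of "real (Suc n) ^ DIM('a) / (LINT x|lborel. bump (x::'a))"]
  show ?thesis by (simp add: mollifier_def[abs_def])
qed

lemma mollifier_measurable[measurable]: "mollifier n \<in> borel_measurable borel"
  by (intro bdint_measurable test_functions_bdint mollifier_test_function)

lemma mollifier_nonneg: "mollifier n z \<ge> 0"
  using integral_bump_pos[where ?'a='a] by (simp add: mollifier_def bump_nonneg)

lemma mollifier_eq_0: "norm z \<ge> 1 \<Longrightarrow> mollifier n z = 0"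
proof -
  assume "norm z \<ge> 1"
  then have "1 * 1 \<le> real (Suc n) * norm z" by (intro mult_mono) auto
  then show ?thesis by (simp add: mollifier_def bump_eq_0)
qed

text \<open>The substitution moves all dependence on \<open>n\<close> into the argument of
  \<open>F\<close>, so that Fatou's lemma can act under the fixed weight
  \<open>mollifier 0\<close>.\<close>

lemma nn_integral_mollifier:
  fixes F :: "'a::euclidean_space \<Rightarrow> ennreal"
  assumes [measurable]: "F \<in> borel_measurable borel"
  shows "(\<integral>\<^sup>+z. ennreal (mollifier n z) * F z \<partial>lborel) = (\<integral>\<^sup>+z. ennreal (mollifier 0 z) * F ((1 / real (Suc n)) *\<^sub>R z) \<partial>lborel)"
proof -
  define c where "c = 1 / real (Suc n)"
  have c: "c > 0" "real (Suc n) = 1 / c" by (auto simp: c_def)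
  have "(\<integral>\<^sup>+z. ennreal (mollifier n z) * F z \<partial>lborel) =
      ennreal (\<bar>c\<bar> ^ DIM('a)) * (\<integral>\<^sup>+z. ennreal (mollifier n (0 + c *\<^sub>R z)) * F (0 + c *\<^sub>R z) \<partial>lborel)"
    using c by (intro nn_integral_lborel_affine) auto
  also have "\<dots> = (\<integral>\<^sup>+z. ennreal (c ^ DIM('a)) * (ennreal (mollifier n (c *\<^sub>R z)) * F (c *\<^sub>R z)) \<partial>lborel)"
    using c(1) by (subst nn_integral_cmult) auto
  also have "\<dots> = (\<integral>\<^sup>+z. ennreal (mollifier 0 z) * F (c *\<^sub>R z) \<partial>lborel)"
  proof (rule nn_integral_cong)
    fix z :: 'a
    have "c ^ DIM('a) * mollifier n (c *\<^sub>R z) = mollifier 0 z"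
      unfolding mollifier_def c(2) using c(1) by (simp add: power_divide)
    then show "ennreal (c ^ DIM('a)) * (ennreal (mollifier n (c *\<^sub>R z)) * F (c *\<^sub>R z)) = ennreal (mollifier 0 z) * F (c *\<^sub>R z)"
      using c(1) by (simp add: mollifier_nonneg flip: mult.assoc ennreal_mult)
  qed
  finally show ?thesis by (simp only: c_def)
qed

lemma nn_integral_mollifier_1: "(\<integral>\<^sup>+z. ennreal (mollifier n (z::'a::euclidean_space)) \<partial>lborel) = 1"
proof -
  have i: "integrable lborel (mollifier 0 :: 'a \<Rightarrow> real)"
    by (intro bdint_integrable test_functions_bdint mollifier_test_function)
  have "(LINT z|lborel. mollifier 0 (z::'a)) = 1"
    using integral_bump_pos[where ?'a='a] by (simp add: mollifier_def)
  then have "(\<integral>\<^sup>+z. ennreal (mollifier 0 (z::'a)) \<partial>lborel) = 1"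
    by (subst nn_integral_eq_integral[OF i]) (auto simp: mollifier_nonneg)
  then show ?thesis using nn_integral_mollifier[of "\<lambda>z::'a. 1" n] by simp
qed

lemma Lp_norm_nn:
  fixes f :: "'a::euclidean_space \<Rightarrow> real"
  assumes "f \<in> Lp_space p" and p: "p \<ge> 1"
  shows "ennreal (Lp_norm p f) = epow (\<integral>\<^sup>+x. epow (ennreal \<bar>f x\<bar>) p \<partial>lborel) (1 / p)"
proof -
  have "(\<integral>\<^sup>+x. epow (ennreal \<bar>f x\<bar>) p \<partial>lborel) = ennreal (LINT x|lborel. \<bar>f x\<bar> powr p)"
    using assms(1) by (simp add: epow_ennreal Lp_space_def nn_integral_eq_integral)
  then show ?thesis by (simp add: epow_ennreal Lp_norm_def)
qed

lemma Lp_norm_nonneg: "Lp_norm p f \<ge> 0"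
  by (simp add: Lp_norm_def)

context locally_finite_measure
begin

lemma potential_lsc:
  assumes \<alpha>: "\<alpha> > 0" and lim: "Y \<longlonglongrightarrow> y"
  shows "potential \<alpha> y \<le> liminf (\<lambda>n. potential \<alpha> (Y n))"
proof -
  have "potential \<alpha> y \<le> (\<integral>\<^sup>+x. liminf (\<lambda>n. bessel_kernel_nn \<alpha> (Y n - x)) \<partial>M)"
    unfolding potential_def
    by (intro nn_integral_mono bessel_kernel_nn_lsc \<alpha> tendsto_diff lim tendsto_const)
  also have "\<dots> \<le> liminf (\<lambda>n. potential \<alpha> (Y n))"
    unfolding potential_def by (rule nn_integral_liminf) measurable
  finally show ?thesis .
qed

lemma nn_integral_conv_eq_potential:
  assumes \<alpha>: "\<alpha> > 0" and [measurable]: "f \<in> borel_measurable borel" and B: "\<And>x. \<bar>f x\<bar> \<le> B" and nn: "\<And>x. f x \<ge> 0"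
  shows "(\<integral>\<^sup>+x. ennreal (fun_conv (bessel_kernel_real \<alpha>) f x) \<partial>M) = (\<integral>\<^sup>+y. ennreal (f y) * potential \<alpha> y \<partial>lborel)"
proof -
  interpret pair_sigma_finite lborel M ..
  have sym: "bessel_kernel_nn \<alpha> (x - y) = bessel_kernel_nn \<alpha> (y - x)" for x y :: 'a
    using bessel_kernel_nn_uminus[of \<alpha> "x - y"] by simp
  have "(\<integral>\<^sup>+x. ennreal (fun_conv (bessel_kernel_real \<alpha>) f x) \<partial>M) =
      (\<integral>\<^sup>+x. \<integral>\<^sup>+y. bessel_kernel_nn \<alpha> (x - y) * ennreal (f y) \<partial>lborel \<partial>M)"
    by (simp only: nn_integral_bessel_kernel_conv[OF \<alpha> assms(2) B nn])
  also have "\<dots> = (\<integral>\<^sup>+y. \<integral>\<^sup>+x. bessel_kernel_nn \<alpha> (x - y) * ennreal (f y) \<partial>M \<partial>lborel)"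
    by (rule Fubini'[of "\<lambda>y x. bessel_kernel_nn \<alpha> (x - y) * ennreal (f y)"]) measurable
  also have "\<dots> = (\<integral>\<^sup>+y. ennreal (f y) * potential \<alpha> y \<partial>lborel)"
    unfolding potential_def by (subst sym) (simp add: nn_integral_cmult mult.commute)
  finally show ?thesis .
qed

section \<open>From the dual bound to the potential\<close>

context
  fixes \<alpha> p A :: real
  assumes \<alpha>: "\<alpha> > 0" and p: "p > 1" and A: "A \<ge> 0"
    and dual: "\<And>\<phi>. \<phi> \<in> test_functions \<Longrightarrow> \<bar>LINT x|M. \<phi> x\<bar> \<le> A * bessel_norm \<alpha> p \<phi>"
begin

text \<open>By Tonelli the left side is the integral of \<open>u\<close>, the potential of
  \<open>h\<close>, against the measure. The dual bound is available for the cutoffs of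
  \<open>u\<close>, whose norms tend to \<open>Lp_norm p h\<close>; as everything is nonnegative,
  Fatou's lemma gives the bound for \<open>u\<close>.\<close>

lemma nn_integral_test_function_potential_le:
  assumes h: "h \<in> test_functions" and nn: "\<And>x. h x \<ge> 0"
  shows "(\<integral>\<^sup>+y. ennreal (h y) * potential \<alpha> y \<partial>lborel) \<le> ennreal (A * Lp_norm p h)"
proof -
  define u where "u = fun_conv (bessel_kernel_real \<alpha>) h"
  have [measurable]: "h \<in> borel_measurable borel" by (intro bdint_measurable test_functions_bdint h)
  obtain B where B: "B > 0" "\<And>x. \<bar>h x\<bar> \<le> B" using test_functions_boundedE[OF h] by blast
  have u0: "u x \<ge> 0" for x unfolding u_def fun_conv_def by (simp add: bessel_kernel_real_nonneg nn)
  have su: "smooth u" unfolding u_def by (rule smooth_fun_conv[OF integrable_bessel_kernel_real[OF \<alpha>] h])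
  have [measurable]: "u \<in> borel_measurable borel"
    unfolding u_def by (intro bdint_measurable bdint_fun_conv integrable_bessel_kernel_real \<alpha> test_functions_bdint h)
  define \<phi> where "\<phi> n = (\<lambda>y. cutoff ((1 / real (Suc n)) *\<^sub>R y) * u y)" for n
  have \<phi>: "\<phi> n \<in> test_functions" for n
    unfolding \<phi>_def using test_functions_affine[OF cutoff_test_function, of "1 / real (Suc n)" 0] su
    by (intro test_functions_mult) auto
  have \<phi>0: "\<phi> n x \<ge> 0" for n x by (simp add: \<phi>_def cutoff_nonneg u0)
  have \<phi>m: "\<phi> n \<in> borel_measurable borel" for n by (intro bdint_measurable test_functions_bdint \<phi>)
  then have \<phi>m': "(\<lambda>x. ennreal (\<phi> n x)) \<in> borel_measurable M" for n by measurable
  have "(\<integral>\<^sup>+y. ennreal (h y) * potential \<alpha> y \<partial>lborel) = (\<integral>\<^sup>+x. ennreal (u x) \<partial>M)"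
    unfolding u_def by (rule nn_integral_conv_eq_potential[OF \<alpha> _ B(2) nn, symmetric]) measurable
  also have "\<dots> = (\<integral>\<^sup>+x. liminf (\<lambda>n. ennreal (\<phi> n x)) \<partial>M)"
  proof (rule nn_integral_cong)
    fix x :: 'a
    have "(\<lambda>n. 1 / real (Suc n)) \<longlonglongrightarrow> 0" by (rule lim_1_over_n[THEN LIMSEQ_Suc])
    then have "(\<lambda>n. (1 / real (Suc n)) *\<^sub>R x) \<longlonglongrightarrow> 0 *\<^sub>R x"
      by (intro tendsto_scaleR tendsto_const)
    then have "(\<lambda>n. cutoff ((1 / real (Suc n)) *\<^sub>R x)) \<longlonglongrightarrow> cutoff (0 *\<^sub>R x)"
      by (rule continuous_on_tendsto_compose[OF test_functions_continuous[OF cutoff_test_function, of UNIV]]) auto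
    then have "(\<lambda>n. \<phi> n x) \<longlonglongrightarrow> cutoff (0 *\<^sub>R x) * u x"
      unfolding \<phi>_def by (intro tendsto_mult tendsto_const)
    then have "(\<lambda>n. ennreal (\<phi> n x)) \<longlonglongrightarrow> ennreal (u x)"
      by (intro tendsto_ennrealI) (simp add: cutoff_0)
    then show "ennreal (u x) = liminf (\<lambda>n. ennreal (\<phi> n x))"
      by (intro lim_imp_Liminf[symmetric]) auto
  qed
  also have "\<dots> \<le> liminf (\<lambda>n. \<integral>\<^sup>+x. ennreal (\<phi> n x) \<partial>M)"
    by (rule nn_integral_liminf) (rule \<phi>m')
  also have "\<dots> \<le> liminf (\<lambda>n. ennreal (A * Lp_norm p (bessel_density \<alpha> (\<phi> n))))"
  proof (rule Liminf_mono, rule always_eventually, rule allI)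
    fix n
    have "(\<integral>\<^sup>+x. ennreal (\<phi> n x) \<partial>M) = ennreal (LINT x|M. \<phi> n x)"
      by (intro nn_integral_eq_integral integrable_test_function \<phi>) (simp add: \<phi>0)
    also have "\<dots> \<le> ennreal (A * Lp_norm p (bessel_density \<alpha> (\<phi> n)))"
      using dual[OF \<phi>, of n] bessel_norm_test_function[OF \<alpha> _ \<phi>, of p n] p by (intro ennreal_leI) simp
    finally show "(\<integral>\<^sup>+x. ennreal (\<phi> n x) \<partial>M) \<le> ennreal (A * Lp_norm p (bessel_density \<alpha> (\<phi> n)))" .
  qed
  also have "\<dots> = ennreal (A * Lp_norm p h)"
    unfolding \<phi>_def u_def using p
    by (intro lim_imp_Liminf tendsto_ennrealI tendsto_mult tendsto_const Lp_norm_bessel_density_cutoff_tendsto[OF \<alpha> _ h]) auto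
  finally show ?thesis .
qed

text \<open>Mollifying \<open>f\<close> yields test functions whose L^p norm is no larger, by
  Young's inequality. Tonelli moves the mollifier from \<open>f\<close> onto the potential, where
  lower semicontinuity replaces any convergence statement for the mollified
  \<open>f\<close>.\<close>

lemma nn_integral_mult_potential_le:
  assumes [measurable]: "f \<in> borel_measurable borel" and B: "\<And>x. \<bar>f x\<bar> \<le> B" and nn: "\<And>x. f x \<ge> 0"
    and R: "\<And>x. norm x \<ge> R \<Longrightarrow> f x = 0"
  shows "(\<integral>\<^sup>+y. ennreal (f y) * potential \<alpha> y \<partial>lborel) \<le> ennreal (A * Lp_norm p f)"
proof -
  have fint: "integrable lborel f"
  proof (rule integrableI_bounded_set[where A="cball 0 R" and B=B])
    show "emeasure lborel (cball (0::'a) R) < \<infinity>" by (rule Lebesgue_Measure.emeasure_compact_finite) simp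
  qed (use B R in auto)
  have bf: "bdint f" by (rule bdintI[OF fint B])
  have fL: "f \<in> Lp_space p" using p by (intro bdint_Lp_space bf) simp
  define h where "h n = fun_conv (mollifier n) f" for n
  have mint: "integrable lborel (mollifier n :: 'a \<Rightarrow> real)" for n
    by (intro bdint_integrable test_functions_bdint mollifier_test_function)
  have h0: "h n x \<ge> 0" for n x unfolding h_def fun_conv_def by (simp add: mollifier_nonneg nn)
  have h: "h n \<in> test_functions" for n
  proof (rule test_functionsI[of _ "R + 1"])
    have "h n = fun_conv f (mollifier n)" by (rule ext) (simp only: h_def fun_conv_commute)
    then show "smooth (h n)" using smooth_fun_conv[OF fint mollifier_test_function] by simp
    fix x :: 'a assume x: "R + 1 \<le> norm x"
    have "mollifier n (x - y) * f y = 0" for y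
    proof (cases "norm y \<ge> R")
      case True then show ?thesis by (simp add: R)
    next
      case False
      then have "norm (x - y) \<ge> 1" using x norm_triangle_ineq2[of x y] by linarith
      then show ?thesis by (simp add: mollifier_eq_0)
    qed
    then show "h n x = 0" by (simp only: h_def fun_conv_def integral_zero)
  qed
  have [measurable]: "h n \<in> borel_measurable borel" for n by (intro bdint_measurable test_functions_bdint h)
  have hn: "ennreal (h n x) = (\<integral>\<^sup>+y. ennreal (mollifier n (x - y)) * ennreal (f y) \<partial>lborel)" for n x
  proof -
    have "integrable lborel (\<lambda>y. mollifier n (x - y) * f y)"
      by (rule integrable_conv_integrand[OF mint _ B]) measurable
    then have "ennreal (h n x) = (\<integral>\<^sup>+y. ennreal (mollifier n (x - y) * f y) \<partial>lborel)"
      unfolding h_def fun_conv_def by (intro nn_integral_eq_integral[symmetric]) (auto simp: mollifier_nonneg nn)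
    then show ?thesis by (simp add: ennreal_mult mollifier_nonneg nn)
  qed
  have hL: "Lp_norm p (h n) \<le> Lp_norm p f" for n
  proof -
    have "h n \<in> Lp_space p" using p by (intro bdint_Lp_space test_functions_bdint h) simp
    then have "ennreal (Lp_norm p (h n)) = epow (\<integral>\<^sup>+x. epow (\<integral>\<^sup>+y. ennreal (mollifier n (x - y)) * ennreal (f y) \<partial>lborel) p \<partial>lborel) (1 / p)"
      using p by (simp add: Lp_norm_nn h0 hn[symmetric])
    also have "\<dots> \<le> epow (epow (\<integral>\<^sup>+x. ennreal (mollifier n (x::'a)) \<partial>lborel) p * (\<integral>\<^sup>+x. epow (ennreal (f x)) p \<partial>lborel)) (1 / p)"
      using p by (intro epow_mono nn_integral_Young_convolution) auto
    also have "\<dots> = ennreal (Lp_norm p f)"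
      using p fL by (simp add: Lp_norm_nn nn nn_integral_mollifier_1)
    finally show ?thesis by (simp add: Lp_norm_nonneg)
  qed
  define c where "c n = 1 / real (Suc n)" for n
  have c: "c \<longlonglongrightarrow> 0" unfolding c_def by (rule lim_1_over_n[THEN LIMSEQ_Suc])
  \<comment> \<open>One inequality suffices: after rescaling, the mollified potential averages
    values at points that tend to \<open>y\<close>, and lower semicontinuity with Fatou's lemma
    bounds \<open>potential \<alpha> y\<close> by the lower limit of these averages.\<close>
  have w: "potential \<alpha> y \<le> liminf (\<lambda>n. \<integral>\<^sup>+x. ennreal (mollifier n (x - y)) * potential \<alpha> x \<partial>lborel)" for y
  proof -
    have "potential \<alpha> y = (\<integral>\<^sup>+z. ennreal (mollifier 0 (z::'a)) * potential \<alpha> y \<partial>lborel)"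
      by (subst nn_integral_multc) (simp_all add: nn_integral_mollifier_1)
    also have "\<dots> \<le> (\<integral>\<^sup>+z. ennreal (mollifier 0 (z::'a)) * liminf (\<lambda>n. potential \<alpha> (y + c n *\<^sub>R z)) \<partial>lborel)"
    proof (intro nn_integral_mono mult_left_mono potential_lsc \<alpha>)
      fix z
      have "(\<lambda>n. y + c n *\<^sub>R z) \<longlonglongrightarrow> y + 0 *\<^sub>R z" by (intro tendsto_intros c)
      then show "(\<lambda>n. y + c n *\<^sub>R z) \<longlonglongrightarrow> y" by simp
    qed simp
    also have "\<dots> \<le> (\<integral>\<^sup>+z. liminf (\<lambda>n. ennreal (mollifier 0 (z::'a)) * potential \<alpha> (y + c n *\<^sub>R z)) \<partial>lborel)"
      by (intro nn_integral_mono ennreal_mult_liminf_le)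
    also have "\<dots> \<le> liminf (\<lambda>n. \<integral>\<^sup>+z. ennreal (mollifier 0 (z::'a)) * potential \<alpha> (y + c n *\<^sub>R z) \<partial>lborel)"
      by (rule nn_integral_liminf) measurable
    also have "(\<lambda>n. \<integral>\<^sup>+z. ennreal (mollifier 0 (z::'a)) * potential \<alpha> (y + c n *\<^sub>R z) \<partial>lborel) =
       (\<lambda>n. \<integral>\<^sup>+x. ennreal (mollifier n (x - y)) * potential \<alpha> x \<partial>lborel)"
    proof
      fix n
      have "(\<integral>\<^sup>+z. ennreal (mollifier 0 (z::'a)) * potential \<alpha> (y + c n *\<^sub>R z) \<partial>lborel) =
         (\<integral>\<^sup>+z. ennreal (mollifier n z) * potential \<alpha> (y + z) \<partial>lborel)"
        unfolding c_def by (rule nn_integral_mollifier[symmetric]) measurable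
      also have "\<dots> = (\<integral>\<^sup>+x. ennreal (mollifier n (x - y)) * potential \<alpha> x \<partial>lborel)"
        using nn_integral_lborel_translate[of "\<lambda>x. ennreal (mollifier n (x - y)) * potential \<alpha> x" y] by simp
      finally show "(\<integral>\<^sup>+z. ennreal (mollifier 0 (z::'a)) * potential \<alpha> (y + c n *\<^sub>R z) \<partial>lborel) =
         (\<integral>\<^sup>+x. ennreal (mollifier n (x - y)) * potential \<alpha> x \<partial>lborel)" .
    qed
    finally show ?thesis .
  qed
  have "(\<integral>\<^sup>+y. ennreal (f y) * potential \<alpha> y \<partial>lborel) \<le>
      (\<integral>\<^sup>+y. liminf (\<lambda>n. ennreal (f y) * (\<integral>\<^sup>+x. ennreal (mollifier n (x - y)) * potential \<alpha> x \<partial>lborel)) \<partial>lborel)"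
    by (intro nn_integral_mono order_trans[OF mult_left_mono[OF w] ennreal_mult_liminf_le]) simp
  also have "\<dots> \<le> liminf (\<lambda>n. \<integral>\<^sup>+y. ennreal (f y) * (\<integral>\<^sup>+x. ennreal (mollifier n (x - y)) * potential \<alpha> x \<partial>lborel) \<partial>lborel)"
    by (rule nn_integral_liminf) measurable
  also have "\<dots> \<le> liminf (\<lambda>n::nat. ennreal (A * Lp_norm p f))"
  proof (rule Liminf_mono, rule always_eventually, rule allI)
    fix n
    have "(\<integral>\<^sup>+y. ennreal (f y) * (\<integral>\<^sup>+x. ennreal (mollifier n (x - y)) * potential \<alpha> x \<partial>lborel) \<partial>lborel) =
       (\<integral>\<^sup>+y. \<integral>\<^sup>+x. ennreal (mollifier n (x - y)) * ennreal (f y) * potential \<alpha> x \<partial>lborel \<partial>lborel)"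
      by (subst nn_integral_cmult[symmetric]) (auto simp: mult_ac)
    also have "\<dots> = (\<integral>\<^sup>+x. \<integral>\<^sup>+y. ennreal (mollifier n (x - y)) * ennreal (f y) * potential \<alpha> x \<partial>lborel \<partial>lborel)"
      by (rule lborel_pair.Fubini') measurable
    also have "\<dots> = (\<integral>\<^sup>+x. ennreal (h n x) * potential \<alpha> x \<partial>lborel)"
      by (subst nn_integral_multc) (auto simp: hn)
    also have "\<dots> \<le> ennreal (A * Lp_norm p (h n))"
      by (rule nn_integral_test_function_potential_le[OF h h0])
    also have "\<dots> \<le> ennreal (A * Lp_norm p f)" by (intro ennreal_leI mult_left_mono hL A)
    finally show "(\<integral>\<^sup>+y. ennreal (f y) * (\<integral>\<^sup>+x. ennreal (mollifier n (x - y)) * potential \<alpha> x \<partial>lborel) \<partial>lborel)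
       \<le> ennreal (A * Lp_norm p f)" .
  qed
  also have "\<dots> = ennreal (A * Lp_norm p f)" by (intro lim_imp_Liminf tendsto_const) simp
  finally show ?thesis .
qed

text \<open>Converse of Hoelder's inequality with the extremal density, the power q - 1 of the
  potential. Truncation in height and to a ball makes this density admissible. Since
  \<open>(q - 1) * p = q\<close>, its p-norm is a power of the very integral \<open>j\<close> to be
  bounded, and \<open>j \<le> A * j powr (1 / p)\<close> can be solved for \<open>j\<close>.
  Monotone convergence removes the truncation.\<close>

lemma nn_integral_epow_potential_le:
  assumes q: "1 / p + 1 / q = 1" "q > 1"
  shows "(\<integral>\<^sup>+y. epow (potential \<alpha> y) q \<partial>lborel) \<le> ennreal (A powr q)"
proof -
  define g where "g N y = epow (min (potential \<alpha> y) (of_nat N)) q * indicator (ball 0 (real N)) y" for N y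
  have [measurable]: "ball (0::'a) r \<in> sets borel" for r by simp
  have [measurable]: "g N \<in> borel_measurable borel" for N unfolding g_def[abs_def] by measurable
  have le: "(\<integral>\<^sup>+y. g N y \<partial>lborel) \<le> ennreal (A powr q)" for N
  proof -
    define m where "m y = enn2real (min (potential \<alpha> y) (of_nat N))" for y
    have mtop: "min (potential \<alpha> y) (of_nat N) \<noteq> top" for y
      by (simp add: min_def) (metis ennreal_of_nat_neq_top top_unique)
    have m: "ennreal (m y) = min (potential \<alpha> y) (of_nat N)" for y
      using mtop[of y] by (simp add: m_def less_top)
    have m0: "m y \<ge> 0" for y by (simp add: m_def)
    have mN: "m y \<le> real N" for y
    proof -
      have "ennreal (m y) \<le> ennreal (real N)" by (simp add: m ennreal_of_nat_eq_real_of_nat)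
      then show ?thesis by (simp add: m0)
    qed
    have [measurable]: "m \<in> borel_measurable borel" unfolding m_def[abs_def] by measurable
    define f where "f y = m y powr (q - 1) * indicator (ball 0 (real N)) y" for y
    have [measurable]: "f \<in> borel_measurable borel" unfolding f_def[abs_def] by measurable
    have f0: "f y \<ge> 0" for y by (simp add: f_def)
    have fB: "\<bar>f y\<bar> \<le> real N powr (q - 1)" for y
      using mN[of y] m0[of y] q by (auto simp: f_def indicator_def intro!: powr_mono2)
    have fR: "norm x \<ge> real N \<Longrightarrow> f x = 0" for x by (simp add: f_def)
    have gN: "g N y = ennreal (m y powr q) * indicator (ball 0 (real N)) y" for y
      by (simp add: g_def m[symmetric] epow_ennreal m0)
    \<comment> \<open>Finiteness of the truncated integral is secured before anything else: only
      then may the factor \<open>j powr (1 / p)\<close> be cancelled below.\<close>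
    have "(\<integral>\<^sup>+y. g N y \<partial>lborel) \<le> (\<integral>\<^sup>+y. ennreal (real N powr q) * indicator (ball (0::'a) (real N)) y \<partial>lborel)"
      unfolding gN using q by (intro nn_integral_mono mult_right_mono ennreal_leI powr_mono2 m0 mN) auto
    also have "\<dots> < \<infinity>"
    proof -
      have "emeasure lborel (ball (0::'a) (real N)) < \<infinity>" by (rule Lebesgue_Measure.emeasure_bounded_finite[OF bounded_ball])
      then show ?thesis by (subst nn_integral_cmult_indicator) (auto simp: ennreal_mult_less_top)
    qed
    finally obtain j where j: "(\<integral>\<^sup>+y. g N y \<partial>lborel) = ennreal j" "j \<ge> 0"
      by (cases "\<integral>\<^sup>+y. g N y \<partial>lborel") auto
    have qp: "(q - 1) * p = q" using q p by (simp add: field_simps)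
    have fL: "f \<in> Lp_space p"
    proof (rule bdint_Lp_space)
      have "integrable lborel f"
      proof (rule integrableI_bounded_set[where A="ball 0 (real N)" and B="real N powr (q - 1)"])
        show "emeasure lborel (ball (0::'a) (real N)) < \<infinity>" by (rule Lebesgue_Measure.emeasure_bounded_finite[OF bounded_ball])
      qed (use fB fR in auto)
      then show "bdint f" by (rule bdintI[OF _ fB])
    qed (use p in simp)
    have "(\<integral>\<^sup>+x. epow (ennreal \<bar>f x\<bar>) p \<partial>lborel) = ennreal j"
    proof -
      have "epow (ennreal \<bar>f x\<bar>) p = g N x" for x
        using p by (auto simp: gN f_def epow_ennreal indicator_def powr_powr qp)
      then show ?thesis by (simp add: j)
    qed
    then have fn: "Lp_norm p f = j powr (1 / p)"
      using Lp_norm_nn[OF fL] p j(2) by (simp add: epow_ennreal Lp_norm_nonneg)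
    have "ennreal j \<le> (\<integral>\<^sup>+y. ennreal (f y) * potential \<alpha> y \<partial>lborel)"
      unfolding j(1)[symmetric]
    proof (rule nn_integral_mono)
      fix y
      have "m y powr q = m y powr (q - 1) * m y"
        using m0[of y] by (cases "m y = 0") (auto simp: powr_diff)
      then have "g N y = ennreal (f y) * ennreal (m y)"
        by (auto simp: gN f_def indicator_def m0 ennreal_mult)
      also have "\<dots> \<le> ennreal (f y) * potential \<alpha> y" by (intro mult_left_mono) (simp_all add: m)
      finally show "g N y \<le> ennreal (f y) * potential \<alpha> y" .
    qed
    also have "\<dots> \<le> ennreal (A * Lp_norm p f)" by (rule nn_integral_mult_potential_le[OF _ fB f0 fR]) measurable
    finally have le: "j \<le> A * j powr (1 / p)" using A by (simp add: fn)
    have "j \<le> A powr q"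
    proof (cases "j = 0")
      case False
      then have j: "j > 0" using \<open>j \<ge> 0\<close> by simp
      have "j powr (1 / q) * j powr (1 / p) = j" using q j by (simp add: add.commute flip: powr_add)
      with le have "j powr (1 / q) * j powr (1 / p) \<le> A * j powr (1 / p)" by simp
      then have "j powr (1 / q) \<le> A" using j by simp
      then have "(j powr (1 / q)) powr q \<le> A powr q" using q by (intro powr_mono2) auto
      then show ?thesis using q j by (simp add: powr_powr)
    qed simp
    then show ?thesis by (simp add: j(1) ennreal_leI)
  qed
  have inc: "incseq g"
  proof (rule incseq_SucI, rule le_funI)
    fix N y
    show "g N y \<le> g (Suc N) y"
      unfolding g_def using q
      by (intro mult_mono epow_mono min.mono) (auto simp: indicator_def)
  qed
  have "epow (potential \<alpha> y) q \<le> (SUP N. g N y)" for y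
  proof -
    obtain N0 where N0: "norm y < real N0" using reals_Archimedean2 by blast
    show ?thesis
    proof (cases "potential \<alpha> y")
      case (real r)
      obtain N1 where N1: "r < real N1" using reals_Archimedean2 by blast
      have "epow (potential \<alpha> y) q = g (max N0 N1) y"
      proof -
        have "ennreal r \<le> of_nat (max N0 N1)"
          using N1 real by (simp add: ennreal_of_nat_eq_real_of_nat ennreal_leI)
        then show ?thesis using N0 real by (simp add: g_def min_absorb1)
      qed
      then show ?thesis using SUP_upper[of "max N0 N1" UNIV "\<lambda>N. g N y"] by simp
    next
      case top
      have "of_nat n \<le> (SUP N. g N y)" for n
      proof -
        \<comment> \<open>The entry 1 ensures \<open>N \<ge> 1\<close>, so that
          \<open>N powr q\<close> is at least \<open>N\<close>; the entry \<open>N0\<close> puts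
          \<open>y\<close> inside the truncation ball.\<close>
        define N where "N = max 1 (max n N0)"
        have "real n \<le> real N powr 1" by (simp add: N_def)
        also have "\<dots> \<le> real N powr q" using q by (intro powr_mono) (auto simp: N_def)
        finally have "of_nat n \<le> ennreal (real N powr q)" by (simp add: ennreal_of_nat_eq_real_of_nat ennreal_leI)
        also have "\<dots> = g N y"
          using N0 by (simp add: g_def top N_def epow_ennreal[symmetric] ennreal_of_nat_eq_real_of_nat)
        also have "\<dots> \<le> (SUP N. g N y)" by (rule SUP_upper) simp
        finally show ?thesis .
      qed
      then have "(SUP n. of_nat n) \<le> (SUP N. g N y)" by (rule SUP_least)
      then have "top \<le> (SUP N. g N y)" by (simp only: ennreal_SUP_of_nat_eq_top)
      with top_greatest show ?thesis by (rule order_trans)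
    qed
  qed
  then have "(\<integral>\<^sup>+y. epow (potential \<alpha> y) q \<partial>lborel) \<le> (\<integral>\<^sup>+y. (SUP N. g N y) \<partial>lborel)"
    by (rule nn_integral_mono)
  also have "\<dots> = (SUP N. \<integral>\<^sup>+y. g N y \<partial>lborel)"
    by (rule nn_integral_monotone_convergence_SUP[OF inc]) measurable
  also have "\<dots> \<le> ennreal (A powr q)" by (rule SUP_least) (rule le)
  finally show ?thesis .
qed

end

end

section \<open>The pointwise Wolff inequality\<close>

text \<open>The convex function \<open>t powr q\<close> lies above its tangent at
  \<open>x + y\<close>, here evaluated at \<open>y\<close>. Young's inequality for \<open>y\<close>
  and \<open>(x + y) powr (q - 1)\<close> yields this and covers the point 0 without
  differentiation.\<close>

lemma powr_add_le_tangent: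
  fixes x y q :: real
  assumes q: "q > 1" and x: "x \<ge> 0" and y: "y \<ge> 0"
  shows "(x + y) powr q \<le> y powr q + q * (x * (x + y) powr (q - 1))"
proof -
  define s where "s = x + y"
  have s: "s \<ge> 0" using x y by (simp add: s_def)
  define p where "p = q / (q - 1)"
  have p: "p > 1" "1 / p + 1 / q = 1" using q by (auto simp: p_def field_simps)
  have sp: "(s powr (q - 1)) powr p = s powr q" using q by (simp add: powr_powr p_def)
  have sq: "s * s powr (q - 1) = s powr q" using s by (cases "s = 0") (auto simp: powr_diff)
  have "s powr (q - 1) * y \<le> (s powr (q - 1)) powr p / p + y powr q / q"
    using p q y by (intro Youngs_inequality) auto
  then have "q * (s powr (q - 1) * y) \<le> q * (s powr q / p + y powr q / q)"
    unfolding sp using q by (intro mult_left_mono) auto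
  also have "\<dots> = (q - 1) * s powr q + y powr q"
  proof -
    have "q / p = q - 1" using q by (simp add: p_def)
    then show ?thesis using q by (simp add: distrib_left flip: times_divide_eq_left)
  qed
  finally have *: "q * (s powr (q - 1) * y) \<le> (q - 1) * s powr q + y powr q" .
  have "q * (x * s powr (q - 1)) = q * s powr q - q * (s powr (q - 1) * y)"
    unfolding sq[symmetric] by (simp add: s_def algebra_simps)
  then have "s powr q \<le> y powr q + q * (x * s powr (q - 1))"
    using * by (simp add: algebra_simps)
  then show ?thesis by (simp add: s_def)
qed

text \<open>The tangent inequality telescopes over the tails of the sum when the leading term is
  split off repeatedly. It is a discrete form of integrating the derivative of the q-th power, valid
  for every real q > 1.\<close>

lemma powr_sum_le_sum_tails:
  fixes a :: "nat \<Rightarrow> real"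
  assumes q: "q > 1" and a: "\<And>i. a i \<ge> 0" and "m \<le> n"
  shows "(\<Sum>j\<in>{m..<n}. a j) powr q \<le> q * (\<Sum>i\<in>{m..<n}. a i * (\<Sum>j\<in>{i..<n}. a j) powr (q - 1))"
  using \<open>m \<le> n\<close>
proof (induction m rule: inc_induct)
  case base
  then show ?case by simp
next
  case (step m)
  have e: "(\<Sum>j\<in>{m..<n}. f j) = f m + (\<Sum>j\<in>{Suc m..<n}. f j)" for f :: "nat \<Rightarrow> real"
    using step by (simp add: sum.atLeast_Suc_lessThan)
  have "(a m + (\<Sum>j\<in>{Suc m..<n}. a j)) powr q \<le> (\<Sum>j\<in>{Suc m..<n}. a j) powr q
      + q * (a m * (a m + (\<Sum>j\<in>{Suc m..<n}. a j)) powr (q - 1))"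
    by (intro powr_add_le_tangent q a sum_nonneg)
  also have "\<dots> \<le> q * (\<Sum>i\<in>{Suc m..<n}. a i * (\<Sum>j\<in>{i..<n}. a j) powr (q - 1))
      + q * (a m * (a m + (\<Sum>j\<in>{Suc m..<n}. a j)) powr (q - 1))"
    using step by simp
  also have "\<dots> = q * (\<Sum>i\<in>{m..<n}. a i * (\<Sum>j\<in>{i..<n}. a j) powr (q - 1))"
    unfolding e[of "\<lambda>i. a i * (\<Sum>j\<in>{i..<n}. a j) powr (q - 1)"] e[of a] by (simp add: algebra_simps)
  finally show ?case by (subst e)
qed

lemma sum_geometric_powr_le:
  assumes \<eta>: "\<eta> > 0"
  shows "(\<Sum>k<n. 2 powr (- \<eta> * real k)) \<le> 1 / (1 - 2 powr (- \<eta>))"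
proof -
  have e: "2 powr (- \<eta> * real k) = (2 powr (- \<eta>)) ^ k" for k
    by (simp add: powr_powr flip: powr_realpow)
  have lt: "2 powr (- \<eta>) < 1" using \<eta> powr_less_mono[of "- \<eta>" 0 2] by simp
  show ?thesis
    unfolding e
  proof -
    have "(\<Sum>k<n. (2 powr (- \<eta>)) ^ k) = (1 - (2 powr (- \<eta>)) ^ n) / (1 - 2 powr (- \<eta>))"
      using lt by (subst geometric_sum) (auto simp: divide_simps, simp add: algebra_simps)
    also have "\<dots> \<le> 1 / (1 - 2 powr (- \<eta>))" using lt by (intro divide_right_mono) auto
    finally show "(\<Sum>k<n. (2 powr (- \<eta>)) ^ k) \<le> 1 / (1 - 2 powr (- \<eta>))" .
  qed
qed

text \<open>With \<open>\<eta> = \<delta> / r\<close> and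
  \<open>b j = 2 powr (\<eta> * real (j - i)) * a j\<close> the sum is at most a geometric series
  times the largest \<open>b j\<close>; the r-th power of that maximum is one summand on the right.
  The growing weight is the price for a constant independent of \<open>n\<close>, and the argument
  covers all \<open>r > 0\<close>, including \<open>r < 1\<close>.\<close>

lemma powr_tail_sum_le:
  fixes a :: "nat \<Rightarrow> real"
  assumes r: "r > 0" and \<delta>: "\<delta> > 0" and a: "\<And>i. a i \<ge> 0"
  shows "(\<Sum>j\<in>{i..<n}. a j) powr r \<le>
    (1 / (1 - 2 powr (- (\<delta> / r)))) powr r * (\<Sum>j\<in>{i..<n}. 2 powr (\<delta> * real (j - i)) * a j powr r)"
proof (cases "i < n")
  case False then show ?thesis by simp
next
  case True
  define \<eta> where "\<eta> = \<delta> / r"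
  have \<eta>: "\<eta> > 0" using r \<delta> by (simp add: \<eta>_def)
  define b where "b j = 2 powr (\<eta> * real (j - i)) * a j" for j
  define G where "G = 1 / (1 - 2 powr (- \<eta>))"
  have G: "G > 0" using \<eta> powr_less_mono[of "- \<eta>" 0 2] by (simp add: G_def)
  have b: "b j \<ge> 0" for j by (simp add: b_def a)
  define B where "B = Max (b ` {i..<n})"
  have BM: "b j \<le> B" if "j \<in> {i..<n}" for j unfolding B_def using that by (intro Max_ge) auto
  have "B \<in> b ` {i..<n}" unfolding B_def using True by (intro Max_in) auto
  then obtain k where k: "k \<in> {i..<n}" "B = b k" by blast
  have "(\<Sum>j\<in>{i..<n}. a j) = (\<Sum>j\<in>{i..<n}. 2 powr (- \<eta> * real (j - i)) * b j)"
    by (intro sum.cong refl) (simp add: b_def powr_add[symmetric] flip: mult.assoc)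
  also have "\<dots> \<le> (\<Sum>j\<in>{i..<n}. 2 powr (- \<eta> * real (j - i)) * B)"
    by (intro sum_mono mult_left_mono BM) auto
  also have "\<dots> = (\<Sum>j\<in>{i..<n}. 2 powr (- \<eta> * real (j - i))) * B" by (simp add: sum_distrib_right)
  also have "(\<Sum>j\<in>{i..<n}. 2 powr (- \<eta> * real (j - i))) = (\<Sum>k<n - i. 2 powr (- \<eta> * real k))"
    using True by (intro sum.reindex_bij_witness[of _ "\<lambda>k. k + i" "\<lambda>j. j - i"]) auto
  also have "\<dots> * B \<le> G * B"
    unfolding G_def using b k(2) by (intro mult_right_mono sum_geometric_powr_le \<eta>) auto
  finally have "(\<Sum>j\<in>{i..<n}. a j) powr r \<le> (G * B) powr r"
    using r a by (intro powr_mono2 sum_nonneg) auto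
  also have "\<dots> = G powr r * B powr r" using G b k(2) by (simp add: powr_mult)
  also have "B powr r = 2 powr (\<delta> * real (k - i)) * a k powr r"
    using r a by (simp add: k(2) b_def powr_mult powr_powr \<eta>_def)
  also have "G powr r * \<dots> \<le> G powr r * (\<Sum>j\<in>{i..<n}. 2 powr (\<delta> * real (j - i)) * a j powr r)"
    using k(1) by (intro mult_left_mono member_le_sum[of k _ "\<lambda>j. 2 powr (\<delta> * real (j - i)) * a j powr r"]) auto
  finally show ?thesis by (simp add: G_def \<eta>_def)
qed

text \<open>The power r has to move from \<open>b\<close> to \<open>a\<close>. If the factor on
  which the smaller exponent sits is at most \<epsilon> times the other one, the product is a small
  multiple of a pure power; otherwise the ratio is bounded, and the power \<open>r - 1\<close> can
  be transferred at the cost \<open>\<epsilon> powr (- \<bar>r - 1\<bar>)\<close>.\<close>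

lemma mult_powr_interpolate:
  fixes a b r \<epsilon> :: real
  assumes a: "a \<ge> 0" and b: "b \<ge> 0" and r: "r > 0" and \<epsilon>: "0 < \<epsilon>" "\<epsilon> \<le> 1"
  shows "a * b powr r \<le> \<epsilon> powr (min 1 r) * (a powr (r + 1) + b powr (r + 1)) + \<epsilon> powr (- \<bar>r - 1\<bar>) * (a powr r * b)"
proof -
  have pw: "x * x powr r = x powr (r + 1)" if "x \<ge> 0" for x :: real
    using that by (cases "x = 0") (auto simp: powr_add)
  have nn: "0 \<le> \<epsilon> powr (min 1 r) * (a powr (r + 1) + b powr (r + 1))" "0 \<le> \<epsilon> powr (- \<bar>r - 1\<bar>) * (a powr r * b)"
    using b by (auto intro!: mult_nonneg_nonneg add_nonneg_nonneg)
  show ?thesis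
  proof (cases "a = 0 \<or> b = 0")
    case True
    then have "a * b powr r = 0" by auto
    then show ?thesis using nn by linarith
  next
    case False
    then have ab: "a > 0" "b > 0" using a b by auto
    show ?thesis
    proof (cases "r \<ge> 1")
      case True
      show ?thesis
      proof (cases "a \<le> \<epsilon> * b")
        case True
        have "a * b powr r \<le> \<epsilon> * b * b powr r" using True by (intro mult_right_mono) auto
        also have "\<dots> = \<epsilon> powr (min 1 r) * b powr (r + 1)" using \<open>r \<ge> 1\<close> \<epsilon> b by (simp add: mult.assoc pw)
        also have "\<dots> \<le> \<epsilon> powr (min 1 r) * (a powr (r + 1) + b powr (r + 1))" by (intro mult_left_mono) auto
        finally show ?thesis using nn by linarith
      next
        case False
        then have "b \<le> a / \<epsilon>" using \<epsilon> by (simp add: field_simps)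
        then have "b powr (r - 1) \<le> (a / \<epsilon>) powr (r - 1)" using \<open>r \<ge> 1\<close> b by (intro powr_mono2) auto
        then have h: "a * (b * b powr (r - 1)) \<le> a * (b * (a / \<epsilon>) powr (r - 1))" using a b by (intro mult_left_mono) auto
        have h2: "b * b powr (r - 1) = b powr r" using ab by (simp add: powr_diff)
        have h3: "a * (b * (a / \<epsilon>) powr (r - 1)) = \<epsilon> powr (- \<bar>r - 1\<bar>) * (a powr r * b)"
          using ab \<epsilon> \<open>r \<ge> 1\<close> by (simp add: powr_divide powr_diff powr_minus field_simps)
        show ?thesis by (rule add_increasing[OF nn(1) h[unfolded h2 h3]])
      qed
    next
      case False
      show ?thesis
      proof (cases "b \<le> \<epsilon> * a")
        case True
        have "a * b powr r \<le> a * (\<epsilon> * a) powr r" using True r a b by (intro mult_left_mono powr_mono2) auto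
        also have "\<dots> = \<epsilon> powr (min 1 r) * a powr (r + 1)"
          using False \<epsilon> a by (simp add: powr_mult pw[symmetric] mult_ac)
        also have "\<dots> \<le> \<epsilon> powr (min 1 r) * (a powr (r + 1) + b powr (r + 1))" by (intro mult_left_mono) auto
        finally show ?thesis using nn by linarith
      next
        case b': False
        then have "b powr (r - 1) \<le> (\<epsilon> * a) powr (r - 1)" using False ab \<epsilon> by (intro powr_mono2') auto
        then have h: "a * (b * b powr (r - 1)) \<le> a * (b * (\<epsilon> * a) powr (r - 1))" using a b by (intro mult_left_mono) auto
        have h2: "b * b powr (r - 1) = b powr r" using ab by (simp add: powr_diff)
        have h3: "a * (b * (\<epsilon> * a) powr (r - 1)) = \<epsilon> powr (- \<bar>r - 1\<bar>) * (a powr r * b)"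
          using ab \<epsilon> False by (simp add: powr_mult powr_diff field_simps)
        show ?thesis by (rule add_increasing[OF nn(1) h[unfolded h2 h3]])
      qed
    qed
  qed
qed

text \<open>The growth \<open>2\<^sup>\<beta>\<^sup>(\<^sup>j\<^sup>-\<^sup>i\<^sup>)\<close> of the mixed terms is affordable: for the dyadic averages to which the
  inequality is applied, \<open>\<integral>a\<^sub>i\<^sup>q\<^sup>-\<^sup>1a\<^sub>j\<close> decays like \<open>2\<^sup>-\<^sup>\<alpha>\<^sup>(\<^sup>j\<^sup>-\<^sup>i\<^sup>)\<close>.\<close>

lemma Wolff_pointwise:
  fixes q \<beta> :: real
  assumes q: "q > 1" and \<beta>: "\<beta> > 0"
  obtains C \<eta> where "C > 0" "\<eta> > 0"
    "\<And>(a :: nat \<Rightarrow> real) n. (\<And>i. a i \<ge> 0) \<Longrightarrow> (\<Sum>i<n. a i) powr q \<le>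
      C * (\<Sum>i<n. \<Sum>j\<in>{i..<n}. 2 powr (- \<eta> * real (j - i)) * (a i powr q + a j powr q)
        + 2 powr (\<beta> * real (j - i)) * (a i powr (q - 1) * a j))"
proof -
  \<comment> \<open>For the gap k the interpolation parameter will be 2^(-ck). Pure powers then
    carry the rate \<delta> - c m, which is at most -\<eta> since
    \<open>\<delta> \<le> c * m / 2\<close>. Mixed terms carry \<delta> + c |r - 1|, which is at
    most \<beta>: \<open>c\<close> is chosen so that c (r + 1) = \<beta>/2, and \<delta> takes at
    most the other half.\<close>
  define r m c \<delta> \<eta> where "r = q - 1" and "m = min 1 r" and "c = \<beta> / (2 * (r + 1))"
    and "\<delta> = min (c * m / 2) (\<beta> / 2)" and "\<eta> = c * m / 2"
  have r: "r > 0" "q = r + 1" using q by (auto simp: r_def)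
  have m: "m > 0" using r by (simp add: m_def)
  have c: "c > 0" using r \<beta> by (simp add: c_def)
  have \<eta>: "\<eta> > 0" using c m by (simp add: \<eta>_def)
  have \<delta>: "\<delta> > 0" using c m \<beta> by (simp add: \<delta>_def)
  have \<delta>1: "\<delta> - c * m \<le> - \<eta>" by (simp add: \<delta>_def \<eta>_def)
  have "c * \<bar>r - 1\<bar> \<le> c * (r + 1)" using c r by (intro mult_left_mono) auto
  also have "\<dots> = \<beta> / 2" using r by (simp add: c_def field_simps)
  finally have \<delta>2: "\<delta> + c * \<bar>r - 1\<bar> \<le> \<beta>" using min.cobounded2[of "c * m / 2" "\<beta> / 2"] unfolding \<delta>_def by linarith
  define G where "G = (1 / (1 - 2 powr (- (\<delta> / r)))) powr r"
  have G: "G > 0" unfolding G_def using r \<delta> powr_less_mono[of "- (\<delta> / r)" 0 2] by simp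
  show ?thesis
  proof (rule that[of "q * G" \<eta>])
    show "q * G > 0" using q G by simp
    fix a :: "nat \<Rightarrow> real" and n assume a: "\<And>i. a i \<ge> 0"
    have t: "2 powr (\<delta> * real (j - i)) * (a i * a j powr r) \<le>
        2 powr (- \<eta> * real (j - i)) * (a i powr q + a j powr q) + 2 powr (\<beta> * real (j - i)) * (a i powr r * a j)" for i j
    proof -
      define k where "k = real (j - i)"
      define \<epsilon> where "\<epsilon> = 2 powr (- c * k)"
      have \<epsilon>: "0 < \<epsilon>" "\<epsilon> \<le> 1" using c powr_mono[of "- c * k" 0 2] by (auto simp: \<epsilon>_def k_def)
      have "2 powr (\<delta> * k) * (a i * a j powr r) \<le>
          2 powr (\<delta> * k) * (\<epsilon> powr m * (a i powr q + a j powr q) + \<epsilon> powr (- \<bar>r - 1\<bar>) * (a i powr r * a j))"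
        unfolding m_def r(2) by (intro mult_left_mono mult_powr_interpolate a r \<epsilon>) auto
      also have "\<dots> = 2 powr ((\<delta> - c * m) * k) * (a i powr q + a j powr q) + 2 powr ((\<delta> + c * \<bar>r - 1\<bar>) * k) * (a i powr r * a j)"
      proof -
        have "2 powr (\<delta> * k) * \<epsilon> powr m = 2 powr ((\<delta> - c * m) * k)"
            "2 powr (\<delta> * k) * \<epsilon> powr (- \<bar>r - 1\<bar>) = 2 powr ((\<delta> + c * \<bar>r - 1\<bar>) * k)"
          unfolding \<epsilon>_def powr_powr powr_add[symmetric] by (simp_all add: algebra_simps)
        then show ?thesis by (simp only: distrib_left mult.assoc[symmetric])
      qed
      also have "\<dots> \<le> 2 powr (- \<eta> * k) * (a i powr q + a j powr q) + 2 powr (\<beta> * k) * (a i powr r * a j)"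
        by (intro add_mono mult_right_mono powr_mono \<delta>1 \<delta>2 mult_nonneg_nonneg add_nonneg_nonneg a) (auto simp: k_def)
      finally show ?thesis by (simp only: k_def)
    qed
    have "(\<Sum>i<n. a i) powr q \<le> q * (\<Sum>i<n. a i * (\<Sum>j\<in>{i..<n}. a j) powr r)"
      using powr_sum_le_sum_tails[OF q a, of 0 n] by (simp add: lessThan_atLeast0 r_def)
    also have "\<dots> \<le> q * (\<Sum>i<n. a i * (G * (\<Sum>j\<in>{i..<n}. 2 powr (\<delta> * real (j - i)) * a j powr r)))"
      unfolding G_def using q by (intro mult_left_mono sum_mono powr_tail_sum_le r(1) \<delta> a) auto
    also have "\<dots> = q * G * (\<Sum>i<n. \<Sum>j\<in>{i..<n}. 2 powr (\<delta> * real (j - i)) * (a i * a j powr r))"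
      by (simp add: sum_distrib_left mult_ac)
    also have "\<dots> \<le> q * G * (\<Sum>i<n. \<Sum>j\<in>{i..<n}. 2 powr (- \<eta> * real (j - i)) * (a i powr q + a j powr q)
        + 2 powr (\<beta> * real (j - i)) * (a i powr r * a j))"
      using q G by (intro mult_left_mono sum_mono t) auto
    finally show "(\<Sum>i<n. a i) powr q \<le> q * G * (\<Sum>i<n. \<Sum>j\<in>{i..<n}. 2 powr (- \<eta> * real (j - i)) * (a i powr q + a j powr q)
        + 2 powr (\<beta> * real (j - i)) * (a i powr (q - 1) * a j))" by (simp only: r_def)
  qed (rule \<eta>)
qed

lemma Wolff_pointwise_ennreal:
  fixes q \<beta> :: real
  assumes q: "q > 1" and \<beta>: "\<beta> > 0"
  obtains C \<eta> where "C > 0" "\<eta> > 0"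
    "\<And>(a :: nat \<Rightarrow> ennreal) n. (\<And>i. a i < top) \<Longrightarrow> epow (\<Sum>i<n. a i) q \<le>
      ennreal C * (\<Sum>i<n. \<Sum>j\<in>{i..<n}. ennreal (2 powr (- \<eta> * real (j - i))) * (epow (a i) q + epow (a j) q)
        + ennreal (2 powr (\<beta> * real (j - i))) * (epow (a i) (q - 1) * a j))"
proof (rule Wolff_pointwise[OF q \<beta>])
  fix C \<eta> :: real
  assume C: "C > 0" and \<eta>: "\<eta> > 0" and *: "\<And>(a :: nat \<Rightarrow> real) n. (\<And>i. a i \<ge> 0) \<Longrightarrow> (\<Sum>i<n. a i) powr q \<le>
      C * (\<Sum>i<n. \<Sum>j\<in>{i..<n}. 2 powr (- \<eta> * real (j - i)) * (a i powr q + a j powr q)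
        + 2 powr (\<beta> * real (j - i)) * (a i powr (q - 1) * a j))"
  show thesis
  proof (rule that[OF C \<eta>])
    fix a :: "nat \<Rightarrow> ennreal" and n assume "\<And>i. a i < top"
    then have ab: "\<And>i. a i = ennreal (enn2real (a i))" by simp
    define b where "b i = enn2real (a i)" for i
    have b: "a i = ennreal (b i)" "b i \<ge> 0" for i using ab by (auto simp: b_def)
    define T where "T i j = 2 powr (- \<eta> * real (j - i)) * (b i powr q + b j powr q)
        + 2 powr (\<beta> * real (j - i)) * (b i powr (q - 1) * b j)" for i j
    have T: "T i j \<ge> 0" for i j
      unfolding T_def by (intro add_nonneg_nonneg mult_nonneg_nonneg b) auto
    have eT: "ennreal (T i j) = ennreal (2 powr (- \<eta> * real (j - i))) * (epow (a i) q + epow (a j) q)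
        + ennreal (2 powr (\<beta> * real (j - i))) * (epow (a i) (q - 1) * a j)" for i j
      unfolding T_def b(1)
      by (subst ennreal_plus) (auto simp: epow_ennreal b(2) ennreal_mult intro!: mult_nonneg_nonneg add_nonneg_nonneg)
    have "epow (\<Sum>i<n. a i) q = ennreal ((\<Sum>i<n. b i) powr q)"
      by (simp add: b sum_nonneg epow_ennreal)
    also have "\<dots> \<le> ennreal (C * (\<Sum>i<n. \<Sum>j\<in>{i..<n}. T i j))"
      unfolding T_def by (intro ennreal_leI * b)
    also have "\<dots> = ennreal C * (\<Sum>i<n. \<Sum>j\<in>{i..<n}. ennreal (T i j))"
      using C T by (simp add: ennreal_mult sum_nonneg)
    also have "\<dots> = ennreal C * (\<Sum>i<n. \<Sum>j\<in>{i..<n}. ennreal (2 powr (- \<eta> * real (j - i))) * (epow (a i) q + epow (a j) q)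
        + ennreal (2 powr (\<beta> * real (j - i))) * (epow (a i) (q - 1) * a j))"
      by (simp only: eT)
    finally show "epow (\<Sum>i<n. a i) q \<le>
      ennreal C * (\<Sum>i<n. \<Sum>j\<in>{i..<n}. ennreal (2 powr (- \<eta> * real (j - i))) * (epow (a i) q + epow (a j) q)
        + ennreal (2 powr (\<beta> * real (j - i))) * (epow (a i) (q - 1) * a j))" .
  qed
qed

section \<open>Dyadic bounds for the Bessel kernel\<close>

lemma gauss_mono:
  fixes z z' :: "'a::euclidean_space"
  assumes "t > 0" "norm z \<le> norm z'"
  shows "gauss t z' \<le> gauss t z"
proof -
  have "(norm z)\<^sup>2 \<le> (norm z')\<^sup>2" using assms(2) by (intro power_mono) auto
  then have "- (norm z')\<^sup>2 / (4 * t) \<le> - (norm z)\<^sup>2 / (4 * t)" using assms(1) by (intro divide_right_mono) auto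
  then show ?thesis using assms(1) by (simp add: gauss_eq mult_left_mono)
qed

lemma bessel_kernel_nn_mono:
  fixes z z' :: "'a::euclidean_space"
  assumes \<alpha>: "\<alpha> > 0" and "norm z \<le> norm z'"
  shows "bessel_kernel_nn \<alpha> z' \<le> bessel_kernel_nn \<alpha> z"
  unfolding bessel_kernel_nn_def
proof (intro nn_integral_mono ennreal_leI)
  fix t
  show "bessel_weight \<alpha> t * gauss t z' \<le> bessel_weight \<alpha> t * gauss t z"
  proof (cases "t > 0")
    case True
    show ?thesis by (rule mult_left_mono[OF gauss_mono[OF True assms(2)] bessel_weight_nonneg[OF \<alpha>]])
  qed (simp add: bessel_weight_def)
qed

lemma emeasure_lborel_ball:
  "r \<ge> 0 \<Longrightarrow> emeasure lborel (ball (c::'a::euclidean_space) r) = ennreal (unit_ball_vol (real DIM('a)) * r ^ DIM('a))"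
  by (rule emeasure_ball)

text \<open>For \<open>s > 0\<close> a staircase version of
  \<open>(norm z / \<rho>) powr (- s)\<close> cut off outside the ball of radius \<rho>: the terms
  that see \<open>z\<close> form a geometric sum dominated by the last one. At the origin all terms
  count and the value is infinite.\<close>

definition dyadic_kernel :: "real \<Rightarrow> real \<Rightarrow> 'a::euclidean_space \<Rightarrow> ennreal" where
  "dyadic_kernel s \<rho> z = (\<Sum>i. ennreal (2 powr (s * real i)) * indicator (ball 0 (\<rho> * 2 powr (- real i))) z)"

text \<open>The heat-time integral defining the Bessel kernel is bounded below by its parts over the disjoint
  intervals \<open>(\<rho>\<^sub>i\<^sup>2/4, \<rho>\<^sub>i\<^sup>2]\<close>, \<open>\<rho>\<^sub>i = 2\<^sup>-\<^sup>i\<rho>\<close>, one for each term of the dyadic kernel; in this way the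
  bound also holds at the origin.\<close>

lemma dyadic_kernel_le_bessel_kernel:
  fixes \<alpha> \<rho> :: real
  assumes \<alpha>: "\<alpha> > 0" "\<alpha> < real DIM('a::euclidean_space)" and \<rho>: "\<rho> > 0"
  obtains C where "C > 0" "\<And>z::'a. dyadic_kernel (real DIM('a) - \<alpha>) \<rho> z \<le> ennreal C * bessel_kernel_nn \<alpha> z"
proof -
  let ?d = "real DIM('a)"
  define s where "s = ?d - \<alpha>"
  have s: "s > 0" using \<alpha> by (simp add: s_def)
  define \<rho>' where "\<rho>' i = \<rho> * 2 powr (- real i)" for i
  have \<rho>': "0 < \<rho>' i" "\<rho>' i \<le> \<rho>" for i
    using \<rho> powr_mono[of "- real i" 0 2] by (auto simp: \<rho>'_def mult_left_le)
  define I where "I i = {(\<rho>' i)\<^sup>2 / 4 <.. (\<rho>' i)\<^sup>2}" for i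
  define c0 where "c0 = (4 * pi) powr (- ?d / 2) / Gamma (\<alpha> / 2) * exp (- \<rho>\<^sup>2 - 1)"
  have G: "Gamma (\<alpha> / 2) > 0" using \<alpha> by (intro Gamma_real_pos) simp
  have c0: "c0 > 0" using G by (simp add: c0_def)
  \<comment> \<open>For times in \<open>I i\<close> the exponent
    \<open>(norm z)\<^sup>2 / (4 * t)\<close> is at most 1 and
    \<open>t \<le> \<rho>\<^sup>2\<close>, whence the factor
    \<open>exp (- \<rho>\<^sup>2 - 1)\<close> in \<open>c0\<close>. The total power of
    \<open>t\<close> is negative because \<alpha> < d, so it is smallest at the right end of the
    interval.\<close>
  have low: "c0 * \<rho>' i powr (\<alpha> - 2 - ?d) \<le> bessel_weight \<alpha> t * gauss t z"
    if t: "t \<in> I i" and z: "norm z < \<rho>' i" for i t and z :: 'a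
  proof -
    have t0: "0 < t" "t \<le> (\<rho>' i)\<^sup>2" "(\<rho>' i)\<^sup>2 / 4 < t"
      using t \<rho>'[of i] by (auto simp: I_def intro: le_less_trans[rotated])
    have "(norm z)\<^sup>2 \<le> (\<rho>' i)\<^sup>2" using z by (intro power_mono) auto
    then have "(norm z)\<^sup>2 / (4 * t) \<le> 1" using t0 by (simp add: field_simps)
    moreover have "t \<le> \<rho>\<^sup>2" using t0(2) power_mono[of "\<rho>' i" \<rho> 2] \<rho>'[of i] by linarith
    ultimately have e: "exp (- \<rho>\<^sup>2 - 1) \<le> exp (- t) * exp (- (norm z)\<^sup>2 / (4 * t))"
      by (simp flip: exp_add)
    have "\<rho>' i powr (\<alpha> - 2 - ?d) = ((\<rho>' i)\<^sup>2) powr (\<alpha> / 2 - 1 - ?d / 2)"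
    proof -
      have "(\<rho>' i)\<^sup>2 = \<rho>' i powr 2" using \<rho>'[of i] by simp
      moreover have "2 * (\<alpha> / 2 - 1 - ?d / 2) = \<alpha> - 2 - ?d" by (simp add: field_simps)
      ultimately show ?thesis by (simp only: powr_powr)
    qed
    also have "\<dots> \<le> t powr (\<alpha> / 2 - 1 - ?d / 2)" using t0 \<alpha> by (intro powr_mono2') auto
    also have "\<dots> = t powr (\<alpha> / 2 - 1) * t powr (- ?d / 2)" by (simp flip: powr_add)
    finally have p: "\<rho>' i powr (\<alpha> - 2 - ?d) \<le> t powr (\<alpha> / 2 - 1) * t powr (- ?d / 2)" .
    have "c0 * \<rho>' i powr (\<alpha> - 2 - ?d) = (4 * pi) powr (- ?d / 2) / Gamma (\<alpha> / 2) * (exp (- \<rho>\<^sup>2 - 1) * \<rho>' i powr (\<alpha> - 2 - ?d))"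
      by (simp add: c0_def)
    also have "\<dots> \<le> (4 * pi) powr (- ?d / 2) / Gamma (\<alpha> / 2) * ((exp (- t) * exp (- (norm z)\<^sup>2 / (4 * t))) * (t powr (\<alpha> / 2 - 1) * t powr (- ?d / 2)))"
      using G by (intro mult_left_mono mult_mono e p) auto
    also have "\<dots> = bessel_weight \<alpha> t * gauss t z"
      using t0 by (simp add: bessel_weight_def gauss_eq powr_mult)
    finally show ?thesis .
  qed
  \<comment> \<open>The factor 3/4 is the length of \<open>I i\<close> relative to
    \<open>(\<rho>' i)\<^sup>2\<close>. The remaining power \<open>\<rho>' i powr (- s)\<close>
    splits into \<open>\<rho> powr (- s)\<close> and the dyadic weight
    \<open>2 powr (s * real i)\<close>.\<close>
  define c1 where "c1 = c0 * (3 / 4) * \<rho> powr (- s)"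
  have c1: "c1 > 0" using c0 \<rho> by (simp add: c1_def)
  have main: "ennreal c1 * (\<Sum>i<n. ennreal (2 powr (s * real i)) * indicator (ball 0 (\<rho>' i)) z) \<le> bessel_kernel_nn \<alpha> z" for n and z :: 'a
  proof -
    have e1: "ennreal c1 * (ennreal (2 powr (s * real i)) * indicator (ball 0 (\<rho>' i)) z) =
       (\<integral>\<^sup>+t. ennreal (c0 * \<rho>' i powr (\<alpha> - 2 - ?d)) * indicator (ball 0 (\<rho>' i)) z * indicator (I i) t \<partial>lborel)" for i
    proof -
      have "emeasure lborel (I i) = ennreal (3 / 4 * (\<rho>' i)\<^sup>2)" by (simp add: I_def field_simps)
      moreover have "c0 * \<rho>' i powr (\<alpha> - 2 - ?d) * (3 / 4 * (\<rho>' i)\<^sup>2) = c1 * 2 powr (s * real i)"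
      proof -
        have "(\<rho>' i)\<^sup>2 = \<rho>' i powr 2" using \<rho>'[of i] by simp
        then have "\<rho>' i powr (\<alpha> - 2 - ?d) * (\<rho>' i)\<^sup>2 = \<rho>' i powr (- s)"
          by (simp add: s_def flip: powr_add)
        also have "\<dots> = \<rho> powr (- s) * 2 powr (s * real i)"
          using \<rho> by (simp add: \<rho>'_def powr_mult powr_powr mult.commute)
        finally show ?thesis by (simp add: c1_def mult_ac)
      qed
      ultimately show ?thesis using c0 c1
        by (subst nn_integral_cmult_indicator) (auto simp: I_def indicator_def simp flip: ennreal_mult')
    qed
    have disj: "disjoint_family I"
    proof -
      have "I i \<inter> I j = {}" if "i < j" for i j
      proof -
        have "2 powr (- real j) \<le> 2 powr (- real i - 1)" using that by (intro powr_mono) auto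
        then have "\<rho>' j \<le> \<rho>' i / 2" using \<rho> by (simp add: \<rho>'_def powr_diff)
        then have "(\<rho>' j)\<^sup>2 \<le> (\<rho>' i / 2)\<^sup>2" using \<rho>'[of j] by (intro power_mono) auto
        then show ?thesis by (auto simp: I_def power_divide)
      qed
      then show ?thesis unfolding disjoint_family_on_def by (metis Int_commute linorder_neqE_nat)
    qed
    have "ennreal c1 * (\<Sum>i<n. ennreal (2 powr (s * real i)) * indicator (ball 0 (\<rho>' i)) z) =
       (\<integral>\<^sup>+t. (\<Sum>i<n. ennreal (c0 * \<rho>' i powr (\<alpha> - 2 - ?d)) * indicator (ball 0 (\<rho>' i)) z * indicator (I i) t) \<partial>lborel)"
      unfolding sum_distrib_left e1 by (rule nn_integral_sum[symmetric]) (simp add: I_def)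
    also have "\<dots> \<le> (\<integral>\<^sup>+t. ennreal (bessel_weight \<alpha> t * gauss t z) \<partial>lborel)"
    proof (rule nn_integral_mono)
      fix t
      have "(\<Sum>i<n. ennreal (c0 * \<rho>' i powr (\<alpha> - 2 - ?d)) * indicator (ball 0 (\<rho>' i)) z * indicator (I i) t)
         \<le> (\<Sum>i<n. ennreal (bessel_weight \<alpha> t * gauss t z) * indicator (I i) t)"
        by (intro sum_mono) (auto simp: indicator_def intro!: ennreal_leI low)
      also have "\<dots> = ennreal (bessel_weight \<alpha> t * gauss t z) * indicator (\<Union>i<n. I i) t"
        using disjoint_family_on_mono[OF subset_UNIV disj]
        by (subst indicator_UN_disjoint) (auto simp: sum_distrib_left)
      also have "\<dots> \<le> ennreal (bessel_weight \<alpha> t * gauss t z)" by (auto simp: indicator_def)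
      finally show "(\<Sum>i<n. ennreal (c0 * \<rho>' i powr (\<alpha> - 2 - ?d)) * indicator (ball 0 (\<rho>' i)) z * indicator (I i) t)
         \<le> ennreal (bessel_weight \<alpha> t * gauss t z)" .
    qed
    finally show ?thesis by (simp add: bessel_kernel_nn_def)
  qed
  show ?thesis
  proof (rule that[of "1 / c1"])
    show "1 / c1 > 0" using c1 by simp
    fix z :: 'a
    have "(\<Sum>i<n. ennreal (2 powr (s * real i)) * indicator (ball 0 (\<rho>' i)) z) \<le> ennreal (1 / c1) * bessel_kernel_nn \<alpha> z" for n
    proof -
      have "ennreal (1 / c1) * ennreal c1 = 1" using c1 by (simp flip: ennreal_mult')
      then have "(\<Sum>i<n. ennreal (2 powr (s * real i)) * indicator (ball 0 (\<rho>' i)) z) =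
         ennreal (1 / c1) * (ennreal c1 * (\<Sum>i<n. ennreal (2 powr (s * real i)) * indicator (ball 0 (\<rho>' i)) z))"
        by (simp flip: mult.assoc)
      also have "\<dots> \<le> ennreal (1 / c1) * bessel_kernel_nn \<alpha> z" by (intro mult_left_mono main) simp
      finally show ?thesis .
    qed
    then show "dyadic_kernel (real DIM('a) - \<alpha>) \<rho> z \<le> ennreal (1 / c1) * bessel_kernel_nn \<alpha> z"
      unfolding dyadic_kernel_def suminf_eq_SUP s_def[symmetric] \<rho>'_def[symmetric] by (intro SUP_least)
  qed
qed

text \<open>Substituting \<open>(norm z)\<^sup>2 * u\<close> for the heat time extracts the power of
  \<open>norm z\<close>; dropping the factor \<open>exp (- t)\<close> leaves the integral of
  \<open>H\<close>, which no longer depends on \<open>z\<close>. Its part over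
  \<open>u \<ge> 1\<close> is finite since the exponent \<alpha>/2 - 1 - d/2 is below -1, which is
  \<alpha> < d.\<close>

lemma bessel_kernel_le_powr:
  fixes \<alpha> :: real
  assumes \<alpha>: "\<alpha> > 0" "\<alpha> < real DIM('a::euclidean_space)"
  obtains C where "C > 0" "\<And>z::'a. z \<noteq> 0 \<Longrightarrow> bessel_kernel_nn \<alpha> z \<le> ennreal (C * norm z powr (\<alpha> - real DIM('a)))"
proof -
  let ?d = "real DIM('a)"
  have G: "Gamma (\<alpha> / 2) > 0" using \<alpha> by (intro Gamma_real_pos) simp
  define H where "H u = indicator {0<..} u * (u powr (\<alpha> / 2 - 1) / Gamma (\<alpha> / 2) * ((4 * pi * u) powr (- ?d / 2) * exp (- 1 / (4 * u))))" for u
  have [measurable]: "H \<in> borel_measurable borel" unfolding H_def[abs_def] by measurable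
  have H0: "H u \<ge> 0" for u using G by (auto simp: H_def indicator_def)
  \<comment> \<open>Finiteness of the scaled integral on \<open>(0, 1]\<close> is read off from finiteness of the kernel at one point.\<close>
  obtain z1 :: 'a where z1: "norm z1 < 1" "bessel_kernel_nn \<alpha> z1 < top"
  proof -
    have "\<exists>z1::'a. norm z1 < 1 \<and> bessel_kernel_nn \<alpha> z1 < top"
    proof (rule ccontr)
      assume "\<not> ?thesis"
      then have sub: "ball (0::'a) 1 \<subseteq> {z \<in> space lborel. \<not> (bessel_kernel_nn \<alpha> z \<noteq> \<infinity>)}" by (auto simp: less_top)
      have "AE z in lborel. bessel_kernel_nn \<alpha> (z::'a) \<noteq> \<infinity>"
        by (rule nn_integral_PInf_AE) (auto simp: nn_integral_bessel_kernel_nn[OF \<alpha>(1)])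
      then have "emeasure lborel {z \<in> space lborel. \<not> (bessel_kernel_nn \<alpha> (z::'a) \<noteq> \<infinity>)} = 0"
        by (subst (asm) AE_iff_measurable[OF _ refl]) auto
      then have "emeasure lborel (ball (0::'a) 1) = 0"
        using emeasure_mono[OF sub, of lborel] by simp
      then show False using content_ball_pos[of 1 "0::'a"] by (simp add: measure_def)
    qed
    with that show thesis by blast
  qed
  define e where "e = \<alpha> / 2 - 1 - ?d / 2"
  have e: "e < -1" using \<alpha> by (simp add: e_def)
  define c where "c = (4 * pi) powr (- ?d / 2) / Gamma (\<alpha> / 2)"
  have c: "c > 0" using G by (simp add: c_def)
  have "(\<integral>\<^sup>+u. ennreal (H u) \<partial>lborel) \<le>
     (\<integral>\<^sup>+u. ennreal (exp 1) * ennreal (bessel_weight \<alpha> u * gauss u z1) + ennreal c * ennreal (indicator {1..} u * u powr e) \<partial>lborel)"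
  proof (rule nn_integral_mono)
    fix u
    have "H u \<le> exp 1 * (bessel_weight \<alpha> u * gauss u z1) + c * (indicator {1..} u * u powr e)"
    proof (cases "u > 0")
      case False then show ?thesis by (simp add: H_def bessel_weight_def)
    next
      case u: True
      have ue: "u powr e = u powr (\<alpha> / 2 - 1) * u powr (- ?d / 2)" by (simp add: e_def flip: powr_add)
      have gu: "(4 * pi * u) powr (- ?d / 2) = (4 * pi) powr (- ?d / 2) * u powr (- ?d / 2)"
        by (rule powr_mult)
      have Hu: "H u = c * (u powr e * exp (- 1 / (4 * u)))"
        using u unfolding H_def c_def ue gu by simp
      have nn: "bessel_weight \<alpha> u * gauss u z1 \<ge> 0" using \<alpha> by (simp add: bessel_weight_nonneg gauss_nonneg)
      show ?thesis
      proof (cases "u \<ge> 1")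
        case True
        have "u powr e * exp (- 1 / (4 * u)) \<le> u powr e * 1" using u by (intro mult_left_mono) auto
        then have "H u \<le> c * u powr e" unfolding Hu using c by simp
        then show ?thesis using True nn by (simp add: add_increasing)
      next
        case False
        \<comment> \<open>For \<open>u \<le> 1\<close> the integrand of the kernel at
          \<open>z1\<close> dominates \<open>H u\<close> up to \<open>exp 1\<close>: a point of norm
          below 1 has the larger Gaussian factor, and \<open>exp 1\<close> compensates
          \<open>exp (- u)\<close>.\<close>
        have "(norm z1)\<^sup>2 \<le> 1" using z1(1) by (simp add: abs_square_le_1)
        then have "- 1 / (4 * u) \<le> - (norm z1)\<^sup>2 / (4 * u)" using u by (intro divide_right_mono) auto
        moreover have "u \<le> 1" using False by simp
        ultimately have "exp (- 1 / (4 * u)) \<le> exp 1 * (exp (- u) * exp (- (norm z1)\<^sup>2 / (4 * u)))"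
          by (simp flip: exp_add)
        then have "H u \<le> c * (u powr e * (exp 1 * (exp (- u) * exp (- (norm z1)\<^sup>2 / (4 * u)))))"
          unfolding Hu using c by (intro mult_left_mono) auto
        also have "\<dots> = exp 1 * (bessel_weight \<alpha> u * gauss u z1)"
          using u unfolding bessel_weight_def gauss_eq[OF u] c_def ue gu by simp
        finally show ?thesis using False by simp
      qed
    qed
    then have "ennreal (H u) \<le> ennreal (exp 1 * (bessel_weight \<alpha> u * gauss u z1) + c * (indicator {1..} u * u powr e))"
      by (rule ennreal_leI)
    also have "\<dots> = ennreal (exp 1) * ennreal (bessel_weight \<alpha> u * gauss u z1) + ennreal c * ennreal (indicator {1..} u * u powr e)"
      using \<alpha> c by (subst ennreal_plus) (auto simp: bessel_weight_nonneg gauss_nonneg ennreal_mult)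
    finally show "ennreal (H u) \<le> ennreal (exp 1) * ennreal (bessel_weight \<alpha> u * gauss u z1) + ennreal c * ennreal (indicator {1..} u * u powr e)" .
  qed
  also have "\<dots> = ennreal (exp 1) * bessel_kernel_nn \<alpha> z1 + ennreal c * (\<integral>\<^sup>+u. ennreal (indicator {1..} u * u powr e) \<partial>lborel)"
    unfolding bessel_kernel_nn_def by (subst nn_integral_add) (auto simp: nn_integral_cmult)
  also have "\<dots> < top"
  proof -
    have "((\<lambda>u::real. u powr e) has_integral - (1 powr (e + 1)) / (e + 1)) {1..}"
      by (rule has_integral_powr_to_inf) (use e in auto)
    then have "(\<integral>\<^sup>+u. ennreal (indicator {1..} u * u powr e) \<partial>lborel) = ennreal (- (1 powr (e + 1)) / (e + 1))"
      by (intro nn_integral_has_integral_lebesgue) auto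
    then show ?thesis using z1(2) by (simp add: ennreal_mult_less_top)
  qed
  finally have fin: "(\<integral>\<^sup>+u. ennreal (H u) \<partial>lborel) < top" .
  then obtain h where h: "(\<integral>\<^sup>+u. ennreal (H u) \<partial>lborel) = ennreal h" "h \<ge> 0"
    by (cases "\<integral>\<^sup>+u. ennreal (H u) \<partial>lborel") auto
  show ?thesis
  proof (rule that[of "h + 1"])
    show "h + 1 > 0" using h by simp
    fix z :: 'a assume z: "z \<noteq> 0"
    define \<rho> where "\<rho> = norm z"
    have \<rho>: "\<rho> > 0" using z by (simp add: \<rho>_def)
    have "bessel_kernel_nn \<alpha> z = ennreal \<bar>\<rho>\<^sup>2\<bar> * (\<integral>\<^sup>+u. ennreal (bessel_weight \<alpha> (0 + \<rho>\<^sup>2 * u) * gauss (0 + \<rho>\<^sup>2 * u) z) \<partial>lborel)"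
      unfolding bessel_kernel_nn_def using \<rho> by (intro nn_integral_real_affine) auto
    also have "\<dots> \<le> ennreal \<bar>\<rho>\<^sup>2\<bar> * (\<integral>\<^sup>+u. ennreal (\<rho> powr (\<alpha> - 2 - ?d)) * ennreal (H u) \<partial>lborel)"
    proof (intro mult_left_mono nn_integral_mono)
      fix u
      have "bessel_weight \<alpha> (\<rho>\<^sup>2 * u) * gauss (\<rho>\<^sup>2 * u) z \<le> \<rho> powr (\<alpha> - 2 - ?d) * H u"
      proof (cases "u > 0")
        case False
        then have "\<not> (\<rho>\<^sup>2 * u > 0)" using \<rho> by (simp add: zero_less_mult_iff)
        then show ?thesis using False by (simp add: bessel_weight_def H_def)
      next
        case u: True
        have pos: "\<rho>\<^sup>2 * u > 0" using u \<rho> by simp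
        have r2: "\<rho>\<^sup>2 = \<rho> powr 2" using \<rho> by simp
        have r2p: "\<rho>\<^sup>2 powr x = \<rho> powr (2 * x)" for x by (simp only: r2 powr_powr)
        have E: "exp (- (norm z)\<^sup>2 / (4 * (\<rho>\<^sup>2 * u))) = exp (- 1 / (4 * u))"
          using \<rho> u by (simp add: \<rho>_def[symmetric] field_simps)
        have P: "(\<rho>\<^sup>2 * u) powr (\<alpha> / 2 - 1) * (4 * pi * (\<rho>\<^sup>2 * u)) powr (- ?d / 2) =
            \<rho> powr (\<alpha> - 2 - ?d) * (u powr (\<alpha> / 2 - 1) * (4 * pi * u) powr (- ?d / 2))"
        proof -
          have "(\<rho>\<^sup>2 * u) powr (\<alpha> / 2 - 1) = \<rho> powr (\<alpha> - 2) * u powr (\<alpha> / 2 - 1)"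
            using r2p[of "\<alpha> / 2 - 1"] by (simp add: powr_mult right_diff_distrib)
          moreover have "(4 * pi * (\<rho>\<^sup>2 * u)) powr (- ?d / 2) = \<rho> powr (- ?d) * (4 * pi * u) powr (- ?d / 2)"
            using r2p[of "- ?d / 2"] by (simp add: powr_mult)
          moreover have "\<rho> powr (\<alpha> - 2 - ?d) = \<rho> powr (\<alpha> - 2) * \<rho> powr (- ?d)" by (simp flip: powr_add)
          ultimately show ?thesis by simp
        qed
        have "bessel_weight \<alpha> (\<rho>\<^sup>2 * u) * gauss (\<rho>\<^sup>2 * u) z =
           exp (- (\<rho>\<^sup>2 * u)) * (((\<rho>\<^sup>2 * u) powr (\<alpha> / 2 - 1) * (4 * pi * (\<rho>\<^sup>2 * u)) powr (- ?d / 2)) / Gamma (\<alpha> / 2) * exp (- 1 / (4 * u)))"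
          unfolding gauss_eq[OF pos] E using pos by (simp add: bessel_weight_def)
        also have "\<dots> = exp (- (\<rho>\<^sup>2 * u)) * (\<rho> powr (\<alpha> - 2 - ?d) * H u)"
          unfolding P using u by (simp add: H_def)
        also have "\<dots> \<le> 1 * (\<rho> powr (\<alpha> - 2 - ?d) * H u)"
          using pos H0 by (intro mult_right_mono) auto
        finally show ?thesis by simp
      qed
      then show "ennreal (bessel_weight \<alpha> (0 + \<rho>\<^sup>2 * u) * gauss (0 + \<rho>\<^sup>2 * u) z) \<le> ennreal (\<rho> powr (\<alpha> - 2 - ?d)) * ennreal (H u)"
        by (simp add: ennreal_leI flip: ennreal_mult')
    qed simp
    also have "\<dots> = ennreal (\<rho>\<^sup>2) * (ennreal (\<rho> powr (\<alpha> - 2 - ?d)) * ennreal h)"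
      by (subst nn_integral_cmult) (auto simp: h)
    also have "\<dots> = ennreal (h * \<rho> powr (\<alpha> - ?d))"
    proof -
      have "\<rho>\<^sup>2 * \<rho> powr (\<alpha> - 2 - ?d) = \<rho> powr (2 + (\<alpha> - 2 - ?d))"
        using \<rho> by (subst powr_add) simp
      then have "\<rho>\<^sup>2 * (\<rho> powr (\<alpha> - 2 - ?d) * h) = h * \<rho> powr (\<alpha> - ?d)" by (simp add: mult_ac)
      then show ?thesis using h by (simp flip: ennreal_mult')
    qed
    also have "\<dots> \<le> ennreal ((h + 1) * norm z powr (\<alpha> - ?d))"
      unfolding \<rho>_def by (intro ennreal_leI mult_right_mono) auto
    finally show "bessel_kernel_nn \<alpha> z \<le> ennreal ((h + 1) * norm z powr (\<alpha> - ?d))" .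
  qed
qed

text \<open>Away from the origin the radially decreasing kernel is dominated by its own local averages, which
  Young's inequality handles; hence no decay estimate is needed.\<close>

lemma bessel_kernel_le_dyadic_kernel:
  fixes \<alpha> :: real
  assumes \<alpha>: "\<alpha> > 0" "\<alpha> < real DIM('a::euclidean_space)"
  obtains C where "C > 0" "\<And>z::'a. bessel_kernel_nn \<alpha> z \<le> ennreal C * (dyadic_kernel (real DIM('a) - \<alpha>) 1 z
      + (\<integral>\<^sup>+w. bessel_kernel_nn \<alpha> (z - w) * indicator (ball 0 (1 / 2)) w \<partial>lborel))"
proof -
  let ?d = "real DIM('a)"
  define s where "s = ?d - \<alpha>"
  have s: "s > 0" using \<alpha> by (simp add: s_def)
  obtain C1 where C1: "C1 > 0" "\<And>z::'a. z \<noteq> 0 \<Longrightarrow> bessel_kernel_nn \<alpha> z \<le> ennreal (C1 * norm z powr (\<alpha> - ?d))"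
    using bessel_kernel_le_powr[OF \<alpha>] by blast
  have near: "bessel_kernel_nn \<alpha> z \<le> ennreal (C1 * 2 powr s) * dyadic_kernel s 1 z" if z: "norm z < 1" for z :: 'a
  proof (cases "z = 0")
    case True
    \<comment> \<open>At the origin every summand is at least 1, so the dyadic kernel is infinite
      there and the bound is trivial.\<close>
    have "of_nat n \<le> dyadic_kernel s 1 (0::'a)" for n
    proof -
      have "of_nat n = (\<Sum>i<n. 1 :: ennreal)" by simp
      also have "\<dots> \<le> (\<Sum>i<n. ennreal (2 powr (s * real i)) * indicator (ball 0 (1 * 2 powr (- real i))) (0::'a))"
      proof (rule sum_mono)
        fix i
        have "1 \<le> 2 powr (s * real i)" using s by (intro ge_one_powr_ge_zero) auto
        then show "(1::ennreal) \<le> ennreal (2 powr (s * real i)) * indicator (ball 0 (1 * 2 powr (- real i))) (0::'a)"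
          by simp
      qed
      also have "\<dots> \<le> dyadic_kernel s 1 (0::'a)" unfolding dyadic_kernel_def by (intro sum_le_suminf) auto
      finally show ?thesis .
    qed
    then have "(SUP n. of_nat n) \<le> dyadic_kernel s 1 (0::'a)" by (rule SUP_least)
    then have "dyadic_kernel s 1 (0::'a) = top" by (simp only: ennreal_SUP_of_nat_eq_top top_unique)
    then show ?thesis using True C1 by (simp add: ennreal_mult_top)
  next
    case False
    \<comment> \<open>The first dyadic radius not exceeding \<open>norm z\<close>. Since
      \<open>norm z < 1\<close> it has a predecessor \<open>i\<close>, the finest scale whose ball
      still contains \<open>z\<close>; the single term \<open>i\<close> already dominates the power
      of \<open>norm z\<close>, up to the factor \<open>2 powr s\<close>.\<close>
    define n where "n = (LEAST n. 2 powr (- real n) \<le> norm z)"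
    have "\<exists>n. 2 powr (- real n) \<le> norm z"
    proof -
      obtain n where "(1 / 2) ^ n < norm z" using real_arch_pow_inv[of "norm z" "1/2"] False by auto
      moreover have "2 powr (- real n) = (1 / 2) ^ n"
        by (simp add: powr_minus powr_realpow power_one_over inverse_eq_divide)
      ultimately have "2 powr (- real n) \<le> norm z" by linarith
      then show ?thesis ..
    qed
    then have n: "2 powr (- real n) \<le> norm z" unfolding n_def by (rule LeastI_ex)
    have "n \<noteq> 0" using n z by (cases n) auto
    then obtain i where i: "n = Suc i" using not0_implies_Suc by blast
    have "\<not> 2 powr (- real i) \<le> norm z" using not_less_Least[of i "\<lambda>n. 2 powr (- real n) \<le> norm z"] i by (simp add: n_def)
    then have zi: "z \<in> ball 0 (1 * 2 powr (- real i))" by simp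
    have "norm z powr (- s) \<le> (2 powr (- real n)) powr (- s)" using n s by (intro powr_mono2') auto
    also have "\<dots> = 2 powr s * 2 powr (s * real i)" by (simp add: powr_powr i algebra_simps flip: powr_add)
    finally have "C1 * norm z powr (\<alpha> - ?d) \<le> C1 * (2 powr s * 2 powr (s * real i))" using C1(1) by (simp add: s_def)
    then have "bessel_kernel_nn \<alpha> z \<le> ennreal (C1 * (2 powr s * 2 powr (s * real i)))"
      using C1(2)[OF False] by (meson ennreal_leI order_trans)
    also have "\<dots> = ennreal (C1 * 2 powr s) * (ennreal (2 powr (s * real i)) * indicator (ball 0 (1 * 2 powr (- real i))) z)"
      using zi C1(1) by (simp add: mult.assoc flip: ennreal_mult')
    also have "\<dots> \<le> ennreal (C1 * 2 powr s) * dyadic_kernel s 1 z"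
    proof (intro mult_left_mono)
      have "f i \<le> (\<Sum>i. f i)" for f :: "nat \<Rightarrow> ennreal"
        using sum_le_suminf[of f "{i}"] by simp
      then show "ennreal (2 powr (s * real i)) * indicator (ball 0 (1 * 2 powr (- real i))) z \<le> dyadic_kernel s 1 z"
        unfolding dyadic_kernel_def .
    qed simp
    finally show ?thesis .
  qed
  define v where "v = unit_ball_vol ?d * (1 / 4) ^ DIM('a)"
  have v: "v > 0" by (simp add: v_def)
  have far: "bessel_kernel_nn \<alpha> z \<le> ennreal (1 / v) * (\<integral>\<^sup>+w. bessel_kernel_nn \<alpha> (z - w) * indicator (ball 0 (1 / 2)) w \<partial>lborel)"
    if z: "norm z \<ge> 1" for z :: 'a
  proof -
    \<comment> \<open>The point at distance 1/4 from the origin in the direction of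
      \<open>z\<close>. The ball of radius 1/4 about it lies in \<open>ball 0 (1 / 2)\<close>, and
      each \<open>w\<close> in it satisfies \<open>norm (z - w) \<le> norm z\<close>, so radial
      monotonicity bounds the kernel at \<open>z\<close> by its values at
      \<open>z - w\<close>.\<close>
    define z0 where "z0 = (1 / (4 * norm z)) *\<^sub>R z"
    have z0: "norm z0 = 1 / 4" using z by (auto simp: z0_def)
    have zz0: "norm (z - z0) = norm z - 1 / 4"
    proof -
      have "z - z0 = (1 - 1 / (4 * norm z)) *\<^sub>R z" by (simp add: z0_def scaleR_diff_left)
      moreover have "1 - 1 / (4 * norm z) \<ge> 0" using z by (simp add: divide_le_eq)
      moreover have "norm z \<noteq> 0" using z by linarith
      ultimately show ?thesis by (simp add: left_diff_distrib)
    qed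
    have "ennreal v * bessel_kernel_nn \<alpha> z = (\<integral>\<^sup>+w. bessel_kernel_nn \<alpha> z * indicator (ball z0 (1 / 4)) w \<partial>lborel)"
      by (subst nn_integral_cmult_indicator) (auto simp: emeasure_lborel_ball v_def mult.commute)
    also have "\<dots> \<le> (\<integral>\<^sup>+w. bessel_kernel_nn \<alpha> (z - w) * indicator (ball 0 (1 / 2)) w \<partial>lborel)"
    proof (rule nn_integral_mono)
      fix w
      show "bessel_kernel_nn \<alpha> z * indicator (ball z0 (1 / 4)) w \<le> bessel_kernel_nn \<alpha> (z - w) * indicator (ball 0 (1 / 2)) w"
      proof (cases "w \<in> ball z0 (1 / 4)")
        case True
        then have w: "norm (z0 - w) < 1 / 4" by (simp add: dist_norm)
        have "norm w \<le> norm z0 + norm (z0 - w)" using norm_triangle_ineq4[of z0 "z0 - w"] by simp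
        then have "norm w < 1 / 2" using w z0 by linarith
        moreover have "norm (z - w) \<le> norm (z - z0) + norm (z0 - w)" using norm_triangle_ineq[of "z - z0" "z0 - w"] by simp
        then have "norm (z - w) \<le> norm z" using w zz0 by linarith
        then have "bessel_kernel_nn \<alpha> z \<le> bessel_kernel_nn \<alpha> (z - w)" by (rule bessel_kernel_nn_mono[OF \<alpha>(1)])
        ultimately show ?thesis using True by simp
      qed simp
    qed
    finally have *: "ennreal v * bessel_kernel_nn \<alpha> z \<le> (\<integral>\<^sup>+w. bessel_kernel_nn \<alpha> (z - w) * indicator (ball 0 (1 / 2)) w \<partial>lborel)" .
    have "ennreal (1 / v) * ennreal v = 1" using v by (simp flip: ennreal_mult')
    then have "bessel_kernel_nn \<alpha> z = ennreal (1 / v) * (ennreal v * bessel_kernel_nn \<alpha> z)" by (simp flip: mult.assoc)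
    also have "\<dots> \<le> ennreal (1 / v) * (\<integral>\<^sup>+w. bessel_kernel_nn \<alpha> (z - w) * indicator (ball 0 (1 / 2)) w \<partial>lborel)"
      by (intro mult_left_mono *) simp
    finally show ?thesis .
  qed
  define C where "C = max (C1 * 2 powr s) (1 / v)"
  have C: "C > 0" "C1 * 2 powr s \<le> C" "1 / v \<le> C" using v by (auto simp: C_def less_max_iff_disj)
  show ?thesis
  proof (rule that[OF C(1)])
    fix z :: 'a
    let ?A = "dyadic_kernel s 1 z" and ?B = "\<integral>\<^sup>+w. bessel_kernel_nn \<alpha> (z - w) * indicator (ball 0 (1 / 2)) w \<partial>lborel"
    have "bessel_kernel_nn \<alpha> z \<le> ennreal C * (?A + ?B)"
    proof (cases "norm z < 1")
      case True
      have "ennreal (C1 * 2 powr s) * ?A \<le> ennreal C * (?A + ?B)" using C by (intro mult_mono ennreal_leI) auto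
      with near[OF True] show ?thesis by (rule order_trans)
    next
      case False
      then have z: "norm z \<ge> 1" by simp
      have "ennreal (1 / v) * ?B \<le> ennreal C * (?A + ?B)" using C by (intro mult_mono ennreal_leI) auto
      with far[OF z] show ?thesis by (rule order_trans)
    qed
    then show "bessel_kernel_nn \<alpha> z \<le> ennreal C * (dyadic_kernel (?d - \<alpha>) 1 z + ?B)" by (simp only: s_def)
  qed
qed

section \<open>Wolff's inequality\<close>

text \<open>For a fixed index the weights depend on the gap only and sum to at most a geometric
  series, in either order of summation. The two copies of \<open>W i\<close> and the one of
  \<open>W j\<close> account for the factor 3.\<close>

lemma double_sum_decay_le:
  fixes W :: "nat \<Rightarrow> ennreal"
  assumes \<eta>: "\<eta> > 0"
  shows "(\<Sum>i<n. \<Sum>j\<in>{i..<n}. ennreal (2 powr (- \<eta> * real (j - i))) * (2 * W i + W j))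
    \<le> ennreal (3 / (1 - 2 powr (- \<eta>))) * (\<Sum>i<n. W i)"
proof -
  define G where "G = 1 / (1 - 2 powr (- \<eta>))"
  have G: "G > 0" using \<eta> powr_less_mono[of "- \<eta>" 0 2] by (simp add: G_def)
  define e where "e k = 2 powr (- \<eta> * real k)" for k :: nat
  have eG: "(\<Sum>k<m. ennreal (e k)) \<le> ennreal G" for m
    using sum_geometric_powr_le[OF \<eta>, of m] unfolding e_def G_def by (subst sum_ennreal) (auto intro: ennreal_leI)
  have A: "(\<Sum>i<n. \<Sum>j\<in>{i..<n}. ennreal (e (j - i)) * W i) \<le> ennreal G * (\<Sum>i<n. W i)"
  proof -
    have "(\<Sum>j\<in>{i..<n}. ennreal (e (j - i))) \<le> ennreal G" for i
    proof -
      have "(\<Sum>j\<in>{i..<n}. ennreal (e (j - i))) = (\<Sum>k<n - i. ennreal (e k))"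
        by (intro sum.reindex_bij_witness[of _ "\<lambda>k. k + i" "\<lambda>j. j - i"]) auto
      then show ?thesis using eG[of "n - i"] by simp
    qed
    then have "(\<Sum>i<n. (\<Sum>j\<in>{i..<n}. ennreal (e (j - i))) * W i) \<le> (\<Sum>i<n. ennreal G * W i)"
      by (intro sum_mono mult_right_mono) auto
    then show ?thesis by (simp add: sum_distrib_left sum_distrib_right)
  qed
  have B: "(\<Sum>i<n. \<Sum>j\<in>{i..<n}. ennreal (e (j - i)) * W j) \<le> ennreal G * (\<Sum>i<n. W i)"
  proof -
    have "(\<Sum>i<n. \<Sum>j\<in>{i..<n}. ennreal (e (j - i)) * W j) =
        (\<Sum>i<n. \<Sum>j<n. if i \<le> j then ennreal (e (j - i)) * W j else 0)"
      by (intro sum.cong refl sum.mono_neutral_cong_left) auto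
    also have "\<dots> = (\<Sum>j<n. \<Sum>i<n. if i \<le> j then ennreal (e (j - i)) * W j else 0)"
      by (rule sum.swap)
    also have "\<dots> = (\<Sum>j<n. \<Sum>i\<in>{..j}. ennreal (e (j - i)) * W j)"
      by (intro sum.cong refl sum.mono_neutral_cong_right) auto
    also have "\<dots> = (\<Sum>j<n. (\<Sum>i\<in>{..j}. ennreal (e (j - i))) * W j)"
      by (simp add: sum_distrib_right)
    also have "\<dots> \<le> (\<Sum>j<n. ennreal G * W j)"
    proof (intro sum_mono mult_right_mono)
      fix j
      have "(\<Sum>i\<in>{..j}. ennreal (e (j - i))) = (\<Sum>k<Suc j. ennreal (e k))"
        by (intro sum.reindex_bij_witness[of _ "\<lambda>k. j - k" "\<lambda>i. j - i"]) auto
      then show "(\<Sum>i\<in>{..j}. ennreal (e (j - i))) \<le> ennreal G" using eG[of "Suc j"] by simp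
    qed simp
    finally show ?thesis by (simp add: sum_distrib_left)
  qed
  have "(\<Sum>i<n. \<Sum>j\<in>{i..<n}. ennreal (e (j - i)) * (2 * W i + W j)) =
      2 * (\<Sum>i<n. \<Sum>j\<in>{i..<n}. ennreal (e (j - i)) * W i) + (\<Sum>i<n. \<Sum>j\<in>{i..<n}. ennreal (e (j - i)) * W j)"
  proof -
    have "e * (2 * x + y) = e * x + (e * x + e * y)" for e x y :: ennreal
      by (simp only: mult_2 distrib_left add_ac)
    then show ?thesis by (simp only: mult_2 sum.distrib add_ac)
  qed
  also have "\<dots> \<le> 2 * (ennreal G * (\<Sum>i<n. W i)) + ennreal G * (\<Sum>i<n. W i)"
    by (intro add_mono mult_left_mono A B) simp
  also have "\<dots> = (2 * ennreal G + ennreal G) * (\<Sum>i<n. W i)"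
    by (simp only: distrib_right mult.assoc)
  also have "2 * ennreal G + ennreal G = ennreal (3 * G)"
  proof -
    have "ennreal (3 * G) = ennreal (G + G + G)" by simp
    also have "\<dots> = ennreal G + ennreal G + ennreal G" using G by (simp only: ennreal_plus)
    finally show ?thesis by (simp only: mult_2)
  qed
  finally show ?thesis by (simp add: e_def G_def)
qed

lemma epow_add_ge: "q \<ge> 1 \<Longrightarrow> epow x q + epow y q \<le> epow (x + y) q"
proof -
  assume q: "q \<ge> 1"
  show ?thesis
  proof (cases "q = 1")
    case False
    have "epow x q + epow y q = epow x (q - 1) * x + epow y (q - 1) * y"
      using q False epow_add[of "q - 1" 1] by simp
    also have "\<dots> \<le> epow (x + y) (q - 1) * x + epow (x + y) (q - 1) * y"
      using q by (intro add_mono mult_right_mono epow_mono) auto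
    also have "\<dots> = epow (x + y) q"
      using q False epow_add[of "q - 1" 1 "x + y"] by (simp add: distrib_left)
    finally show ?thesis .
  qed simp
qed

text \<open>Superadditivity of the q-th power for q \<ge> 1, summed. This elementary inequality is
  all that the lower half of Wolff's inequality needs in order to separate the scales.\<close>

lemma suminf_epow_le:
  assumes q: "q \<ge> 1"
  shows "(\<Sum>i. epow (f i) q) \<le> epow (\<Sum>i. f i) q"
  unfolding suminf_eq_SUP
proof (rule SUP_least)
  fix n
  have "(\<Sum>i<n. epow (f i) q) \<le> epow (\<Sum>i<n. f i) q"
  proof (induction n)
    case (Suc n)
    have "(\<Sum>i<Suc n. epow (f i) q) \<le> epow (\<Sum>i<n. f i) q + epow (f n) q" using Suc by (simp add: add_mono)
    also have "\<dots> \<le> epow (\<Sum>i<Suc n. f i) q" using epow_add_ge[OF q] by simp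
    finally show ?case .
  qed simp
  also have "\<dots> \<le> epow (SUP n. \<Sum>i<n. f i) q" using q by (intro epow_mono SUP_upper) auto
  finally show "(\<Sum>i<n. epow (f i) q) \<le> epow (SUP n. \<Sum>i<n. f i) q" .
qed

section \<open>Ball masses and energies at a single scale\<close>

context locally_finite_measure
begin

text \<open>Written as a convolution with an indicator, so that measurability in the centre and
  exchange of integrals come directly from Tonelli.\<close>

definition ball_mass :: "real \<Rightarrow> 'a \<Rightarrow> ennreal" where
  "ball_mass \<rho> x = (\<integral>\<^sup>+y. indicator (ball 0 \<rho>) (x - y) \<partial>M)"

lemma ball_mass_measurable[measurable]: "ball_mass \<rho> \<in> borel_measurable borel"
proof -
  have [measurable]: "ball (0::'a) \<rho> \<in> sets borel" by simp
  show ?thesis unfolding ball_mass_def[abs_def] by measurable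
qed

lemma ball_mass_eq: "ball_mass \<rho> x = emeasure M (ball x \<rho>)"
proof -
  have "(\<lambda>y. indicator (ball 0 \<rho>) (x - y) :: ennreal) = indicator (ball x \<rho>)"
    by (auto simp: fun_eq_iff indicator_def dist_norm norm_minus_commute[of _ x])
  then show ?thesis unfolding ball_mass_def by (simp add: sets_eq_borel)
qed

lemma ball_mass_finite: "ball_mass \<rho> x < top"
  using emeasure_bounded_finite[OF bounded_ball] by (simp add: ball_mass_eq)

lemma ball_mass_mono:
  assumes "ball x \<rho> \<subseteq> ball y \<sigma>" shows "ball_mass \<rho> x \<le> ball_mass \<sigma> y"
  unfolding ball_mass_eq by (intro emeasure_mono assms) (simp add: sets_eq_borel)

lemma ball_mass_le_near:
  assumes "x - y \<in> ball 0 \<sigma>" "\<sigma> \<le> \<rho>"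
  shows "ball_mass \<rho> x \<le> ball_mass (2 * \<rho>) y" "ball_mass \<rho> y \<le> ball_mass (2 * \<rho>) x"
proof -
  have d: "dist x y < \<rho>" using assms by (simp add: dist_norm norm_minus_commute[of x y])
  show "ball_mass \<rho> x \<le> ball_mass (2 * \<rho>) y"
  proof (rule ball_mass_mono, rule subsetI)
    fix w assume "w \<in> ball x \<rho>"
    then show "w \<in> ball y (2 * \<rho>)" using d dist_triangle[of y w x] by (simp add: dist_commute)
  qed
  show "ball_mass \<rho> y \<le> ball_mass (2 * \<rho>) x"
  proof (rule ball_mass_mono, rule subsetI)
    fix w assume "w \<in> ball y \<rho>"
    then show "w \<in> ball x (2 * \<rho>)" using d dist_triangle[of x w y] by (simp add: dist_commute)
  qed
qed

text \<open>The part of Wolff's energy that belongs to one radius. The outer integral is taken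
  against the measure itself, not against Lebesgue measure.\<close>

definition wolff_term :: "real \<Rightarrow> real \<Rightarrow> ennreal" where
  "wolff_term r \<rho> = (\<integral>\<^sup>+y. epow (ball_mass \<rho> y) r \<partial>M)"

lemma nn_integral_indicator_ball_diff:
  "r \<ge> 0 \<Longrightarrow> (\<integral>\<^sup>+x. indicator (ball 0 r) (x - (y::'a)) \<partial>lborel) = ennreal (unit_ball_vol (real DIM('a)) * r ^ DIM('a))"
proof -
  assume r: "r \<ge> 0"
  have "(\<lambda>x. indicator (ball 0 r) (x - y) :: ennreal) = indicator (ball y r)"
    by (auto simp: fun_eq_iff indicator_def dist_norm norm_minus_commute)
  then show ?thesis using r by (simp add: emeasure_lborel_ball)
qed

text \<open>Tonelli turns the mass of the small ball into an integral over centres \<open>y\<close>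
  within \<sigma> of \<open>x\<close>. As \<sigma> \<le> \<rho>, the large ball about
  \<open>x\<close> lies in the ball of twice its radius about \<open>y\<close>, and integrating out
  \<open>x\<close> leaves the volume of the small ball. This volume is the source of the decay in
  the gap between the scales.\<close>

lemma nn_integral_cross_le:
  assumes \<sigma>: "0 \<le> \<sigma>" "\<sigma> \<le> \<rho>" and r: "r > 0"
  shows "(\<integral>\<^sup>+x. epow (ball_mass \<rho> x) r * ball_mass \<sigma> x \<partial>lborel) \<le>
    ennreal (unit_ball_vol (real DIM('a)) * \<sigma> ^ DIM('a)) * wolff_term r (2 * \<rho>)"
proof -
  interpret pair_sigma_finite lborel M ..
  have [measurable]: "ball (0::'a) \<sigma> \<in> sets borel" by simp
  have "(\<integral>\<^sup>+x. epow (ball_mass \<rho> x) r * ball_mass \<sigma> x \<partial>lborel) =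
      (\<integral>\<^sup>+x. \<integral>\<^sup>+y. epow (ball_mass \<rho> x) r * indicator (ball 0 \<sigma>) (x - y) \<partial>M \<partial>lborel)"
    by (subst (2) ball_mass_def, subst nn_integral_cmult) auto
  also have "\<dots> = (\<integral>\<^sup>+y. \<integral>\<^sup>+x. epow (ball_mass \<rho> x) r * indicator (ball 0 \<sigma>) (x - y) \<partial>lborel \<partial>M)"
    by (rule Fubini'[symmetric]) measurable
  also have "\<dots> \<le> (\<integral>\<^sup>+y. \<integral>\<^sup>+x. epow (ball_mass (2 * \<rho>) y) r * indicator (ball 0 \<sigma>) (x - y) \<partial>lborel \<partial>M)"
  proof (intro nn_integral_mono)
    fix y x :: 'a
    show "epow (ball_mass \<rho> x) r * indicator (ball 0 \<sigma>) (x - y) \<le> epow (ball_mass (2 * \<rho>) y) r * indicator (ball 0 \<sigma>) (x - y)"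
    proof (cases "x - y \<in> ball 0 \<sigma>")
      case True
      then show ?thesis using ball_mass_le_near(1)[OF True \<sigma>(2)] r by (auto intro!: epow_mono)
    qed simp
  qed
  also have "\<dots> = (\<integral>\<^sup>+y. epow (ball_mass (2 * \<rho>) y) r * ennreal (unit_ball_vol (real DIM('a)) * \<sigma> ^ DIM('a)) \<partial>M)"
    using nn_integral_indicator_ball_diff[OF \<sigma>(1)] by (simp add: nn_integral_cmult)
  also have "\<dots> = ennreal (unit_ball_vol (real DIM('a)) * \<sigma> ^ DIM('a)) * wolff_term r (2 * \<rho>)"
    unfolding wolff_term_def by (subst nn_integral_multc) (auto simp: mult.commute)
  finally show ?thesis .
qed

text \<open>The reverse comparison: the energy is averaged over \<open>x\<close> within \<rho> of
  \<open>y\<close>, where \<open>ball y \<rho>\<close> lies in the ball of radius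
  \<open>2 * \<rho>\<close> about \<open>x\<close>. Integrating out \<open>y\<close> then yields one
  more factor of ball mass, which raises the exponent from r to r + 1.\<close>

lemma wolff_term_le_nn_integral:
  assumes \<rho>: "\<rho> \<ge> 0" and r: "r > 0"
  shows "ennreal (unit_ball_vol (real DIM('a)) * \<rho> ^ DIM('a)) * wolff_term r \<rho> \<le>
    (\<integral>\<^sup>+x. epow (ball_mass (2 * \<rho>) x) (r + 1) \<partial>lborel)"
proof -
  interpret pair_sigma_finite lborel M ..
  have [measurable]: "ball (0::'a) \<rho> \<in> sets borel" by simp
  have "ennreal (unit_ball_vol (real DIM('a)) * \<rho> ^ DIM('a)) * wolff_term r \<rho> =
    (\<integral>\<^sup>+y. epow (ball_mass \<rho> y) r * ennreal (unit_ball_vol (real DIM('a)) * \<rho> ^ DIM('a)) \<partial>M)"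
    unfolding wolff_term_def by (subst nn_integral_multc) (auto simp: mult.commute)
  also have "\<dots> = (\<integral>\<^sup>+y. \<integral>\<^sup>+x. epow (ball_mass \<rho> y) r * indicator (ball 0 \<rho>) (x - y) \<partial>lborel \<partial>M)"
    using nn_integral_indicator_ball_diff[OF \<rho>(1)] by (simp add: nn_integral_cmult)
  also have "\<dots> \<le> (\<integral>\<^sup>+y. \<integral>\<^sup>+x. epow (ball_mass (2 * \<rho>) x) r * indicator (ball 0 \<rho>) (x - y) \<partial>lborel \<partial>M)"
  proof (intro nn_integral_mono)
    fix y x :: 'a
    show "epow (ball_mass \<rho> y) r * indicator (ball 0 \<rho>) (x - y) \<le> epow (ball_mass (2 * \<rho>) x) r * indicator (ball 0 \<rho>) (x - y)"
    proof (cases "x - y \<in> ball 0 \<rho>")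
      case True
      then show ?thesis using ball_mass_le_near(2)[OF True order_refl] r by (auto intro!: epow_mono)
    qed simp
  qed
  also have "\<dots> = (\<integral>\<^sup>+x. \<integral>\<^sup>+y. epow (ball_mass (2 * \<rho>) x) r * indicator (ball 0 \<rho>) (x - y) \<partial>M \<partial>lborel)"
    by (rule Fubini') measurable
  also have "\<dots> = (\<integral>\<^sup>+x. epow (ball_mass (2 * \<rho>) x) r * ball_mass \<rho> x \<partial>lborel)"
    unfolding ball_mass_def[of \<rho>] by (subst nn_integral_cmult) auto
  also have "\<dots> \<le> (\<integral>\<^sup>+x. epow (ball_mass (2 * \<rho>) x) r * ball_mass (2 * \<rho>) x \<partial>lborel)"
    using \<rho> by (intro nn_integral_mono mult_left_mono ball_mass_mono subset_ball) auto
  also have "\<dots> = (\<integral>\<^sup>+x. epow (ball_mass (2 * \<rho>) x) (r + 1) \<partial>lborel)"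
    using r by (simp add: epow_add)
  finally show ?thesis .
qed

definition dyadic_potential :: "real \<Rightarrow> real \<Rightarrow> 'a \<Rightarrow> ennreal" where
  "dyadic_potential s \<rho> x = (\<Sum>i. ennreal (2 powr (s * real i)) * ball_mass (\<rho> * 2 powr (- real i)) x)"

lemma dyadic_potential_measurable[measurable]: "dyadic_potential s \<rho> \<in> borel_measurable borel"
  unfolding dyadic_potential_def[abs_def] by measurable

lemma dyadic_potential_eq: "dyadic_potential s \<rho> x = (\<integral>\<^sup>+y. dyadic_kernel s \<rho> (x - y) \<partial>M)"
proof -
  have [measurable]: "ball (0::'a) \<rho> \<in> sets borel" for \<rho> by simp
  show ?thesis
    unfolding dyadic_potential_def dyadic_kernel_def ball_mass_def
    by (subst nn_integral_suminf) (auto simp: nn_integral_cmult)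
qed

end

text \<open>For s = d - \<alpha>, r = q - 1 and p conjugate to q the rate
  \<open>s * r - \<alpha>\<close> equals (d - \<alpha> p)(q - 1), because p (q - 1) = q; this is the
  usual weight in Wolff's energy.\<close>

definition wolff_weight :: "real \<Rightarrow> real \<Rightarrow> real \<Rightarrow> nat \<Rightarrow> real" where
  "wolff_weight \<alpha> s r i = 2 powr ((s * r - \<alpha>) * real i)"

lemma dyadic_scale_power:
  assumes "c \<ge> 0"
  shows "(c * 2 powr (- real i)) ^ DIM('a::euclidean_space) = c ^ DIM('a) * 2 powr (- (real DIM('a) * real i))"
proof -
  have "(2 powr (- real i)) ^ DIM('a) = (2 powr (- real i)) powr real DIM('a)" by (simp add: powr_realpow)
  also have "\<dots> = 2 powr (- (real DIM('a) * real i))" by (simp add: powr_powr mult.commute)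
  finally show ?thesis by (simp add: power_mult_distrib)
qed

context locally_finite_measure
begin

text \<open>The pointwise inequality, here with growth rate \<alpha>/2 for the mixed terms, is
  integrated term by term. Mixed terms decay with rate \<alpha> by the one-scale comparison, which
  leaves the net rate \<alpha>/2; pure powers are the diagonal case of the same comparison. The
  overall rate \<open>\<eta>'\<close> is the slower of the two.\<close>

lemma Wolff_upper_partial:
  fixes \<alpha> q :: real
  assumes q: "q > 1" and \<alpha>: "\<alpha> > 0" and s: "s = real DIM('a) - \<alpha>"
    and C: "C > 0" and \<eta>: "\<eta> > 0"
    and pw: "\<And>(a :: nat \<Rightarrow> ennreal) n. (\<And>i. a i < top) \<Longrightarrow> epow (\<Sum>i<n. a i) q \<le>
      ennreal C * (\<Sum>i<n. \<Sum>j\<in>{i..<n}. ennreal (2 powr (- \<eta> * real (j - i))) * (epow (a i) q + epow (a j) q)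
        + ennreal (2 powr (\<alpha> / 2 * real (j - i))) * (epow (a i) (q - 1) * a j))"
  defines "\<eta>' \<equiv> min \<eta> (\<alpha> / 2)"
  shows "(\<integral>\<^sup>+x. epow (\<Sum>i<n. ennreal (2 powr (s * real i)) * ball_mass (2 powr (- real i)) x) q \<partial>lborel) \<le>
    ennreal (C * unit_ball_vol (real DIM('a)) * (3 / (1 - 2 powr (- \<eta>')))) *
      (\<Sum>i<n. ennreal (wolff_weight \<alpha> s (q - 1) i) * wolff_term (q - 1) (2 * 2 powr (- real i)))"
proof -
  define r where "r = q - 1"
  have r: "r > 0" "q = r + 1" using q by (auto simp: r_def)
  define \<omega> where "\<omega> = unit_ball_vol (real DIM('a))"
  have \<omega>: "\<omega> > 0" by (simp add: \<omega>_def)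
  define a where "a i x = ennreal (2 powr (s * real i)) * ball_mass (2 powr (- real i)) x" for i x
  have [measurable]: "a i \<in> borel_measurable borel" for i unfolding a_def[abs_def] by measurable
  have afin: "a i x < top" for i x unfolding a_def using ball_mass_finite by (simp add: ennreal_mult_less_top)
  define W where "W i = ennreal (wolff_weight \<alpha> s r i) * wolff_term r (2 * 2 powr (- real i))" for i
  have cross: "(\<integral>\<^sup>+x. epow (a i x) r * a j x \<partial>lborel) \<le> ennreal (\<omega> * 2 powr (- \<alpha> * real (j - i))) * W i"
    if ij: "i \<le> j" for i j
  proof -
    have "(\<integral>\<^sup>+x. epow (a i x) r * a j x \<partial>lborel) =
        (\<integral>\<^sup>+x. ennreal (2 powr (s * real i * r + s * real j)) * (epow (ball_mass (2 powr (- real i)) x) r * ball_mass (2 powr (- real j)) x) \<partial>lborel)"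
      unfolding a_def using r
      by (intro nn_integral_cong) (simp add: epow_mult epow_ennreal powr_powr powr_add ennreal_mult mult_ac)
    also have "\<dots> = ennreal (2 powr (s * real i * r + s * real j)) * (\<integral>\<^sup>+x. epow (ball_mass (2 powr (- real i)) x) r * ball_mass (2 powr (- real j)) x \<partial>lborel)"
      by (rule nn_integral_cmult) measurable
    also have "\<dots> \<le> ennreal (2 powr (s * real i * r + s * real j)) * (ennreal (\<omega> * (2 powr (- real j)) ^ DIM('a)) * wolff_term r (2 * 2 powr (- real i)))"
      unfolding \<omega>_def using ij by (intro mult_left_mono nn_integral_cross_le r powr_mono) auto
    also have "\<dots> = ennreal (2 powr (s * real i * r + s * real j) * (\<omega> * (2 powr (- real j)) ^ DIM('a))) * wolff_term r (2 * 2 powr (- real i))"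
      using \<omega> by (simp add: ennreal_mult mult.assoc)
    \<comment> \<open>As s - d = -\<alpha>, the coefficient of the finer scale times the volume of
      its ball is 2^(-\<alpha> j). It splits into the decay 2^(-\<alpha> (j - i)) and 2^(-\<alpha>
      i), and the latter completes the weight of scale \<open>i\<close>.\<close>
    also have "2 powr (s * real i * r + s * real j) * (\<omega> * (2 powr (- real j)) ^ DIM('a)) =
        \<omega> * 2 powr (- \<alpha> * real (j - i)) * wolff_weight \<alpha> s r i"
    proof -
      have "(2 powr (- real j)) ^ DIM('a) = 2 powr (- (real DIM('a) * real j))"
        using dyadic_scale_power[of 1 j, where ?'a='a] by simp
      moreover have "s * real i * r + s * real j + - (real DIM('a) * real j) = - \<alpha> * real (j - i) + (s * r - \<alpha>) * real i"
        using ij by (simp add: s of_nat_diff algebra_simps)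
      ultimately have "2 powr (s * real i * r + s * real j) * (2 powr (- real j)) ^ DIM('a) = 2 powr (- \<alpha> * real (j - i)) * wolff_weight \<alpha> s r i"
        unfolding wolff_weight_def by (simp only: powr_add[symmetric])
      then show ?thesis by (simp only: mult.left_commute[of _ \<omega>] mult.assoc)
    qed
    also have "ennreal (\<omega> * 2 powr (- \<alpha> * real (j - i)) * wolff_weight \<alpha> s r i) * wolff_term r (2 * 2 powr (- real i)) =
        ennreal (\<omega> * 2 powr (- \<alpha> * real (j - i))) * W i"
      using \<omega> by (simp add: W_def ennreal_mult wolff_weight_def mult.assoc)
    finally show ?thesis .
  qed
  have diag: "(\<integral>\<^sup>+x. epow (a i x) q \<partial>lborel) \<le> ennreal \<omega> * W i" for i
    using cross[of i i] r by (simp add: epow_add)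
  have term_le: "(\<integral>\<^sup>+x. ennreal (2 powr (- \<eta> * real (j - i))) * (epow (a i x) q + epow (a j x) q)
        + ennreal (2 powr (\<alpha> / 2 * real (j - i))) * (epow (a i x) r * a j x) \<partial>lborel)
      \<le> ennreal \<omega> * (ennreal (2 powr (- \<eta>' * real (j - i))) * (2 * W i + W j))" if ij: "i \<le> j" for i j
  proof -
    have alg: "e * (w * a + w * b) + e * (w * a) = w * (e * (2 * a + b))" for e w a b :: ennreal
    proof -
      have "e * (2 * a + b) = e * a + (e * a + e * b)" by (simp only: mult_2 distrib_left add_ac)
      then show ?thesis by (simp only: distrib_left mult_ac add_ac)
    qed
    define k where "k = real (j - i)"
    have k: "k \<ge> 0" by (simp add: k_def)
    have e1: "2 powr (- \<eta> * k) \<le> 2 powr (- \<eta>' * k)" using k by (intro powr_mono mult_right_mono) (auto simp: \<eta>'_def)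
    have e2: "2 powr (\<alpha> / 2 * k) * 2 powr (- \<alpha> * k) \<le> 2 powr (- \<eta>' * k)"
    proof -
      have "2 powr (\<alpha> / 2 * k) * 2 powr (- \<alpha> * k) = 2 powr (- (\<alpha> / 2) * k)" by (simp add: algebra_simps flip: powr_add)
      also have "\<dots> \<le> 2 powr (- \<eta>' * k)" using k by (intro powr_mono mult_right_mono) (auto simp: \<eta>'_def)
      finally show ?thesis .
    qed
    have "(\<integral>\<^sup>+x. ennreal (2 powr (- \<eta> * k)) * (epow (a i x) q + epow (a j x) q)
        + ennreal (2 powr (\<alpha> / 2 * k)) * (epow (a i x) r * a j x) \<partial>lborel) =
      ennreal (2 powr (- \<eta> * k)) * ((\<integral>\<^sup>+x. epow (a i x) q \<partial>lborel) + (\<integral>\<^sup>+x. epow (a j x) q \<partial>lborel))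
        + ennreal (2 powr (\<alpha> / 2 * k)) * (\<integral>\<^sup>+x. epow (a i x) r * a j x \<partial>lborel)"
      by (simp add: nn_integral_add nn_integral_cmult)
    also have "\<dots> \<le> ennreal (2 powr (- \<eta> * k)) * (ennreal \<omega> * W i + ennreal \<omega> * W j)
        + ennreal (2 powr (\<alpha> / 2 * k)) * (ennreal (\<omega> * 2 powr (- \<alpha> * k)) * W i)"
      unfolding k_def by (intro add_mono mult_left_mono diag cross ij) auto
    also have "ennreal (2 powr (\<alpha> / 2 * k)) * (ennreal (\<omega> * 2 powr (- \<alpha> * k)) * W i) =
        ennreal (2 powr (\<alpha> / 2 * k) * 2 powr (- \<alpha> * k)) * (ennreal \<omega> * W i)"
      using \<omega> by (simp add: ennreal_mult mult_ac)
    also have "ennreal (2 powr (- \<eta> * k)) * (ennreal \<omega> * W i + ennreal \<omega> * W j) + \<dots> \<le>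
        ennreal (2 powr (- \<eta>' * k)) * (ennreal \<omega> * W i + ennreal \<omega> * W j) + ennreal (2 powr (- \<eta>' * k)) * (ennreal \<omega> * W i)"
      by (intro add_mono mult_right_mono ennreal_leI e1 e2) auto
    also have "\<dots> = ennreal \<omega> * (ennreal (2 powr (- \<eta>' * k)) * (2 * W i + W j))"
      by (rule alg)
    finally show ?thesis by (simp only: k_def)
  qed
  define T where "T i j x = ennreal (2 powr (- \<eta> * real (j - i))) * (epow (a i x) q + epow (a j x) q)
        + ennreal (2 powr (\<alpha> / 2 * real (j - i))) * (epow (a i x) r * a j x)" for i j x
  have [measurable]: "T i j \<in> borel_measurable borel" for i j unfolding T_def[abs_def] by measurable
  have "(\<integral>\<^sup>+x. epow (\<Sum>i<n. a i x) q \<partial>lborel) \<le> (\<integral>\<^sup>+x. ennreal C * (\<Sum>i<n. \<Sum>j\<in>{i..<n}. T i j x) \<partial>lborel)"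
    unfolding T_def r_def by (intro nn_integral_mono pw afin)
  also have "\<dots> = ennreal C * (\<Sum>i<n. \<Sum>j\<in>{i..<n}. \<integral>\<^sup>+x. T i j x \<partial>lborel)"
    by (simp add: nn_integral_cmult nn_integral_sum)
  also have "\<dots> \<le> ennreal C * (\<Sum>i<n. \<Sum>j\<in>{i..<n}. ennreal \<omega> * (ennreal (2 powr (- \<eta>' * real (j - i))) * (2 * W i + W j)))"
    unfolding T_def by (intro mult_left_mono sum_mono term_le) auto
  also have "\<dots> = ennreal C * (ennreal \<omega> * (\<Sum>i<n. \<Sum>j\<in>{i..<n}. ennreal (2 powr (- \<eta>' * real (j - i))) * (2 * W i + W j)))"
    by (simp only: sum_distrib_left)
  also have "\<dots> \<le> ennreal C * (ennreal \<omega> * (ennreal (3 / (1 - 2 powr (- \<eta>'))) * (\<Sum>i<n. W i)))"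
    using \<eta> \<alpha> by (intro mult_left_mono double_sum_decay_le) (auto simp: \<eta>'_def)
  also have "\<dots> = ennreal (C * \<omega> * (3 / (1 - 2 powr (- \<eta>')))) * (\<Sum>i<n. W i)"
  proof -
    have nn: "C \<ge> 0" "C * \<omega> \<ge> 0" using C \<omega> by simp_all
    show ?thesis
      unfolding ennreal_mult'[OF nn(2)] ennreal_mult'[OF nn(1)] by (simp only: mult.assoc)
  qed
  finally show ?thesis by (simp only: a_def \<omega>_def W_def r_def)
qed

text \<open>The constant for partial sums does not depend on their length, so monotone convergence
  reaches the full series. Partial sums come first because the pointwise inequality concerns
  finitely many finite terms, while the series itself may diverge.\<close>

lemma Wolff_upper:
  fixes \<alpha> q :: real
  assumes q: "q > 1" and \<alpha>: "\<alpha> > 0" and s: "s = real DIM('a) - \<alpha>"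
    and C: "C > 0" and \<eta>: "\<eta> > 0"
    and pw: "\<And>(a :: nat \<Rightarrow> ennreal) n. (\<And>i. a i < top) \<Longrightarrow> epow (\<Sum>i<n. a i) q \<le>
      ennreal C * (\<Sum>i<n. \<Sum>j\<in>{i..<n}. ennreal (2 powr (- \<eta> * real (j - i))) * (epow (a i) q + epow (a j) q)
        + ennreal (2 powr (\<alpha> / 2 * real (j - i))) * (epow (a i) (q - 1) * a j))"
  shows "(\<integral>\<^sup>+x. epow (dyadic_potential s 1 x) q \<partial>lborel) \<le>
    ennreal (C * unit_ball_vol (real DIM('a)) * (3 / (1 - 2 powr (- min \<eta> (\<alpha> / 2))))) *
      (\<Sum>i. ennreal (wolff_weight \<alpha> s (q - 1) i) * wolff_term (q - 1) (2 * 2 powr (- real i)))"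
proof -
  define a where "a i x = ennreal (2 powr (s * real i)) * ball_mass (2 powr (- real i)) x" for i x
  have [measurable]: "a i \<in> borel_measurable borel" for i unfolding a_def[abs_def] by measurable
  have "epow (dyadic_potential s 1 x) q = (SUP n. epow (\<Sum>i<n. a i x) q)" for x
    using q by (simp add: dyadic_potential_def suminf_eq_SUP epow_SUP a_def)
  then have "(\<integral>\<^sup>+x. epow (dyadic_potential s 1 x) q \<partial>lborel) = (\<integral>\<^sup>+x. (SUP n. epow (\<Sum>i<n. a i x) q) \<partial>lborel)"
    by simp
  also have "\<dots> = (SUP n. \<integral>\<^sup>+x. epow (\<Sum>i<n. a i x) q \<partial>lborel)"
  proof (rule nn_integral_monotone_convergence_SUP)
    show "incseq (\<lambda>n x. epow (\<Sum>i<n. a i x) q)"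
      using q by (intro incseq_SucI le_funI epow_mono) auto
  qed measurable
  also have "\<dots> \<le> ennreal (C * unit_ball_vol (real DIM('a)) * (3 / (1 - 2 powr (- min \<eta> (\<alpha> / 2))))) *
      (\<Sum>i. ennreal (wolff_weight \<alpha> s (q - 1) i) * wolff_term (q - 1) (2 * 2 powr (- real i)))"
  proof (rule SUP_least)
    fix n
    have "(\<Sum>i<n. ennreal (wolff_weight \<alpha> s (q - 1) i) * wolff_term (q - 1) (2 * 2 powr (- real i))) \<le>
       (\<Sum>i. ennreal (wolff_weight \<alpha> s (q - 1) i) * wolff_term (q - 1) (2 * 2 powr (- real i)))"
      by (intro sum_le_suminf) auto
    then show "(\<integral>\<^sup>+x. epow (\<Sum>i<n. a i x) q \<partial>lborel) \<le> ennreal (C * unit_ball_vol (real DIM('a)) * (3 / (1 - 2 powr (- min \<eta> (\<alpha> / 2))))) *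
      (\<Sum>i. ennreal (wolff_weight \<alpha> s (q - 1) i) * wolff_term (q - 1) (2 * 2 powr (- real i)))"
      unfolding a_def
      by (intro order_trans[OF Wolff_upper_partial[OF q \<alpha> s C \<eta> pw]] mult_left_mono) auto
  qed
  finally show ?thesis .
qed

text \<open>Each scale is bounded separately, and superadditivity of the q-th power recombines the
  scales. The radius \<open>4 * L\<close> has three origins: the upper bound produces balls of
  radius 2 * 2^(-i), the Lipschitz map enlarges them by \<open>L\<close>, and the comparison of an
  energy with a Lebesgue integral doubles them once more.\<close>

lemma Wolff_lower:
  fixes \<alpha> q L :: real
  assumes q: "q > 1" and L: "L > 0" and s: "s = real DIM('a) - \<alpha>"
  shows "ennreal (unit_ball_vol (real DIM('a)) * (2 * L) ^ DIM('a)) *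
      (\<Sum>i. ennreal (wolff_weight \<alpha> s (q - 1) i) * wolff_term (q - 1) (2 * L * 2 powr (- real i)))
    \<le> (\<integral>\<^sup>+x. epow (dyadic_potential s (4 * L) x) q \<partial>lborel)"
proof -
  define r where "r = q - 1"
  have r: "r > 0" "q = r + 1" using q by (auto simp: r_def)
  define \<omega> where "\<omega> = unit_ball_vol (real DIM('a))"
  have \<omega>: "\<omega> > 0" by (simp add: \<omega>_def)
  define b where "b i x = ennreal (2 powr (s * real i)) * ball_mass (4 * L * 2 powr (- real i)) x" for i x
  have [measurable]: "b i \<in> borel_measurable borel" for i unfolding b_def[abs_def] by measurable
  have "ennreal (\<omega> * (2 * L) ^ DIM('a)) * (ennreal (wolff_weight \<alpha> s r i) * wolff_term r (2 * L * 2 powr (- real i)))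
     \<le> (\<integral>\<^sup>+x. epow (b i x) q \<partial>lborel)" for i
  proof -
    define \<rho> where "\<rho> = 2 * L * 2 powr (- real i)"
    have \<rho>: "\<rho> \<ge> 0" using L by (simp add: \<rho>_def)
    have eq: "\<omega> * (2 * L) ^ DIM('a) * wolff_weight \<alpha> s r i = 2 powr (s * real i * q) * (\<omega> * \<rho> ^ DIM('a))"
    proof -
      have "s * real i * q + - (real DIM('a) * real i) = (s * r - \<alpha>) * real i"
        by (simp add: r(2) s algebra_simps)
      then have "2 powr (s * real i * q) * 2 powr (- (real DIM('a) * real i)) = wolff_weight \<alpha> s r i"
        unfolding wolff_weight_def by (simp only: powr_add[symmetric])
      then show ?thesis using L dyadic_scale_power[of "2 * L" i, where ?'a='a] by (simp add: \<rho>_def mult_ac)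
    qed
    have A0: "\<omega> * (2 * L) ^ DIM('a) \<ge> 0" using \<omega> L by simp
    have P0: "2 powr (s * real i * q) \<ge> 0" by simp
    have "ennreal (\<omega> * (2 * L) ^ DIM('a)) * ennreal (wolff_weight \<alpha> s r i) =
        ennreal (2 powr (s * real i * q)) * ennreal (\<omega> * \<rho> ^ DIM('a))"
      unfolding ennreal_mult'[OF A0, symmetric] ennreal_mult'[OF P0, symmetric] eq ..
    then have "ennreal (\<omega> * (2 * L) ^ DIM('a)) * (ennreal (wolff_weight \<alpha> s r i) * wolff_term r \<rho>)
       = ennreal (2 powr (s * real i * q)) * (ennreal (\<omega> * \<rho> ^ DIM('a)) * wolff_term r \<rho>)"
      by (simp only: mult.assoc[symmetric])
    also have "\<dots> \<le> ennreal (2 powr (s * real i * q)) * (\<integral>\<^sup>+x. epow (ball_mass (2 * \<rho>) x) (r + 1) \<partial>lborel)"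
      unfolding \<omega>_def by (intro mult_left_mono wolff_term_le_nn_integral \<rho> r) simp
    also have "\<dots> = (\<integral>\<^sup>+x. ennreal (2 powr (s * real i * q)) * epow (ball_mass (2 * \<rho>) x) (r + 1) \<partial>lborel)"
      by (rule nn_integral_cmult[symmetric]) measurable
    also have "\<dots> = (\<integral>\<^sup>+x. epow (b i x) q \<partial>lborel)"
      using q by (intro nn_integral_cong) (simp add: b_def epow_mult epow_ennreal powr_powr \<rho>_def r(2)[symmetric] mult.assoc)
    finally show ?thesis by (simp only: \<rho>_def)
  qed
  then have "(\<Sum>i. ennreal (\<omega> * (2 * L) ^ DIM('a)) * (ennreal (wolff_weight \<alpha> s r i) * wolff_term r (2 * L * 2 powr (- real i))))
     \<le> (\<Sum>i. \<integral>\<^sup>+x. epow (b i x) q \<partial>lborel)"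
    by (intro suminf_le) auto
  also have "\<dots> = (\<integral>\<^sup>+x. (\<Sum>i. epow (b i x) q) \<partial>lborel)"
    by (rule nn_integral_suminf[symmetric]) measurable
  also have "\<dots> \<le> (\<integral>\<^sup>+x. epow (\<Sum>i. b i x) q \<partial>lborel)"
    using q by (intro nn_integral_mono suminf_epow_le) simp
  finally show ?thesis
    by (simp only: ennreal_suminf_cmult b_def dyadic_potential_def \<omega>_def r_def)
qed

end

section \<open>Lipschitz images\<close>

context locally_finite_measure
begin

lemma dyadic_potential_le_potential:
  assumes "\<And>z::'a. dyadic_kernel s \<rho> z \<le> ennreal C * bessel_kernel_nn \<alpha> z"
  shows "dyadic_potential s \<rho> x \<le> ennreal C * potential \<alpha> x"
proof -
  have "dyadic_potential s \<rho> x \<le> (\<integral>\<^sup>+y. ennreal C * bessel_kernel_nn \<alpha> (x - y) \<partial>M)"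
    unfolding dyadic_potential_eq by (intro nn_integral_mono assms)
  also have "\<dots> = ennreal C * potential \<alpha> x"
    unfolding potential_def by (rule nn_integral_cmult) measurable
  finally show ?thesis .
qed

text \<open>Integrated against the measure, the local average of the kernel becomes, by Tonelli, the
  convolution of the kernel with the mass of balls of radius 1/2.\<close>

lemma potential_le_dyadic_potential:
  assumes "\<And>z::'a. bessel_kernel_nn \<alpha> z \<le> ennreal C * (dyadic_kernel s 1 z
      + (\<integral>\<^sup>+w. bessel_kernel_nn \<alpha> (z - w) * indicator (ball 0 (1 / 2)) w \<partial>lborel))"
  shows "potential \<alpha> x \<le> ennreal C * (dyadic_potential s 1 x + (\<integral>\<^sup>+w. bessel_kernel_nn \<alpha> (x - w) * ball_mass (1 / 2) w \<partial>lborel))"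
proof -
  interpret pair_sigma_finite lborel M ..
  have [measurable]: "ball (0::'a) \<rho> \<in> sets borel" for \<rho> by simp
  have [measurable]: "dyadic_kernel s 1 \<in> borel_measurable (borel :: 'a measure)"
    unfolding dyadic_kernel_def[abs_def] by measurable
  have sh: "(\<integral>\<^sup>+w. bessel_kernel_nn \<alpha> (x - y - w) * indicator (ball 0 (1 / 2)) w \<partial>lborel) =
      (\<integral>\<^sup>+w. bessel_kernel_nn \<alpha> (x - w) * indicator (ball 0 (1 / 2)) (w - y) \<partial>lborel)" for y
    using nn_integral_lborel_translate[of "\<lambda>w. bessel_kernel_nn \<alpha> (x - w) * indicator (ball 0 (1 / 2)) (w - y)" y]
    by (simp add: diff_diff_eq)
  have "potential \<alpha> x \<le> (\<integral>\<^sup>+y. ennreal C * (dyadic_kernel s 1 (x - y)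
      + (\<integral>\<^sup>+w. bessel_kernel_nn \<alpha> (x - w) * indicator (ball 0 (1 / 2)) (w - y) \<partial>lborel)) \<partial>M)"
    unfolding potential_def sh[symmetric] by (intro nn_integral_mono assms)
  also have "\<dots> = ennreal C * (dyadic_potential s 1 x + (\<integral>\<^sup>+y. \<integral>\<^sup>+w. bessel_kernel_nn \<alpha> (x - w) * indicator (ball 0 (1 / 2)) (w - y) \<partial>lborel \<partial>M))"
    unfolding dyadic_potential_eq by (simp add: nn_integral_cmult nn_integral_add)
  also have "(\<integral>\<^sup>+y. \<integral>\<^sup>+w. bessel_kernel_nn \<alpha> (x - w) * indicator (ball 0 (1 / 2)) (w - y) \<partial>lborel \<partial>M) =
      (\<integral>\<^sup>+w. \<integral>\<^sup>+y. bessel_kernel_nn \<alpha> (x - w) * indicator (ball 0 (1 / 2)) (w - y) \<partial>M \<partial>lborel)"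
    by (rule Fubini'[symmetric, of "\<lambda>w y. bessel_kernel_nn \<alpha> (x - w) * indicator (ball 0 (1 / 2)) (w - y)", symmetric]) measurable
  also have "\<dots> = (\<integral>\<^sup>+w. bessel_kernel_nn \<alpha> (x - w) * ball_mass (1 / 2) w \<partial>lborel)"
    unfolding ball_mass_def by (simp add: nn_integral_cmult)
  finally show ?thesis .
qed

text \<open>The kernel has total mass 1, so Young's inequality bounds the far part by the L^q norm
  of \<open>ball_mass (1 / 2)\<close>, which is below the term \<open>i = 0\<close> of the dyadic
  potential. In the constant, \<open>2 powr q\<close> comes from the power of a sum and the plain 2
  from two equal contributions.\<close>

lemma nn_integral_epow_potential_le_dyadic:
  assumes \<alpha>: "\<alpha> > 0" and C: "C > 0" and q: "q > 1"
    and K: "\<And>z::'a. bessel_kernel_nn \<alpha> z \<le> ennreal C * (dyadic_kernel s 1 z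
      + (\<integral>\<^sup>+w. bessel_kernel_nn \<alpha> (z - w) * indicator (ball 0 (1 / 2)) w \<partial>lborel))"
  shows "(\<integral>\<^sup>+x. epow (potential \<alpha> x) q \<partial>lborel) \<le>
    ennreal (2 * (2 * C) powr q) * (\<integral>\<^sup>+x. epow (dyadic_potential s 1 x) q \<partial>lborel)"
proof -
  define D where "D = (\<integral>\<^sup>+x. epow (dyadic_potential s 1 x) q \<partial>lborel)"
  let ?B = "\<lambda>x. \<integral>\<^sup>+w. bessel_kernel_nn \<alpha> (x - w) * ball_mass (1 / 2) w \<partial>lborel"
  have bm: "ball_mass (1 / 2) x \<le> dyadic_potential s 1 x" for x
  proof -
    have "f 0 \<le> (\<Sum>i. f i)" for f :: "nat \<Rightarrow> ennreal" using sum_le_suminf[of f "{0}"] by simp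
    from this[of "\<lambda>i. ennreal (2 powr (s * real i)) * ball_mass (1 * 2 powr (- real i)) x"]
    have "ball_mass 1 x \<le> dyadic_potential s 1 x" by (simp add: dyadic_potential_def)
    moreover have "ball_mass (1 / 2) x \<le> ball_mass 1 x" by (intro ball_mass_mono subset_ball) simp
    ultimately show ?thesis by (rule order_trans[rotated])
  qed
  have "(\<integral>\<^sup>+x. epow (?B x) q \<partial>lborel) \<le> epow (\<integral>\<^sup>+x. bessel_kernel_nn \<alpha> (x::'a) \<partial>lborel) q * (\<integral>\<^sup>+x. epow (ball_mass (1 / 2) x) q \<partial>lborel)"
    by (rule nn_integral_Young_convolution[OF q]) measurable
  also have "\<dots> \<le> D"
    unfolding D_def using q by (simp add: nn_integral_bessel_kernel_nn[OF \<alpha>] nn_integral_mono epow_mono bm)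
  finally have B: "(\<integral>\<^sup>+x. epow (?B x) q \<partial>lborel) \<le> D" .
  have "epow (potential \<alpha> x) q \<le> ennreal ((2 * C) powr q) * (epow (dyadic_potential s 1 x) q + epow (?B x) q)" for x
  proof -
    have "epow (potential \<alpha> x) q \<le> epow (ennreal C * (dyadic_potential s 1 x + ?B x)) q"
      using q by (intro epow_mono potential_le_dyadic_potential K) auto
    also have "\<dots> = ennreal (C powr q) * epow (dyadic_potential s 1 x + ?B x) q"
      using q C by (simp add: epow_mult epow_ennreal)
    also have "\<dots> \<le> ennreal (C powr q) * (ennreal (2 powr q) * (epow (dyadic_potential s 1 x) q + epow (?B x) q))"
      using q by (intro mult_left_mono epow_add_le) auto
    also have "\<dots> = ennreal ((2 * C) powr q) * (epow (dyadic_potential s 1 x) q + epow (?B x) q)"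
    proof -
      have "(2 * C) powr q = C powr q * 2 powr q" using C by (simp add: powr_mult)
      moreover have "ennreal (C powr q * 2 powr q) = ennreal (C powr q) * ennreal (2 powr q)" by (rule ennreal_mult') simp
      ultimately show ?thesis by (simp only: mult.assoc)
    qed
    finally show ?thesis .
  qed
  then have "(\<integral>\<^sup>+x. epow (potential \<alpha> x) q \<partial>lborel) \<le> (\<integral>\<^sup>+x. ennreal ((2 * C) powr q) * (epow (dyadic_potential s 1 x) q + epow (?B x) q) \<partial>lborel)"
    by (rule nn_integral_mono)
  also have "\<dots> = ennreal ((2 * C) powr q) * (D + (\<integral>\<^sup>+x. epow (?B x) q \<partial>lborel))"
    unfolding D_def by (simp add: nn_integral_cmult nn_integral_add)
  also have "\<dots> \<le> ennreal ((2 * C) powr q) * (D + D)" by (intro mult_left_mono add_mono B) auto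
  also have "\<dots> = ennreal (2 * (2 * C) powr q) * D"
  proof -
    have "ennreal (2 * (2 * C) powr q) = 2 * ennreal ((2 * C) powr q)" by (subst ennreal_mult') auto
    then show ?thesis by (simp only: mult_2 distrib_left distrib_right)
  qed
  finally show ?thesis by (simp only: D_def)
qed

end

text \<open>The reason for passing to energies: both the ball masses and the outer integration refer
  to the measure itself, so the map transports them without any change of variables in Lebesgue
  measure.\<close>

lemma wolff_term_le_distr:
  fixes M :: "'a::euclidean_space measure" and T :: "'a \<Rightarrow> 'a"
  assumes M: "locally_finite_measure M" and N: "locally_finite_measure (distr M borel T)"
    and T: "L-lipschitz_on UNIV T" and L: "L > 0" and r: "r > 0"
  shows "locally_finite_measure.wolff_term M r \<rho> \<le> locally_finite_measure.wolff_term (distr M borel T) r (L * \<rho>)"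
proof -
  interpret M: locally_finite_measure M by (rule M)
  interpret N: locally_finite_measure "distr M borel T" by (rule N)
  have "continuous_on UNIV T" using T by (rule lipschitz_on_continuous_on)
  then have Tb: "T \<in> borel \<rightarrow>\<^sub>M borel" by (rule borel_measurable_continuous_onI)
  then have [measurable]: "T \<in> M \<rightarrow>\<^sub>M borel" by (simp add: measurable_cong_sets[OF M.sets_eq_borel refl])
  have "M.ball_mass \<rho> y \<le> N.ball_mass (L * \<rho>) (T y)" for y
  proof -
    have "emeasure M (ball y \<rho>) \<le> emeasure M (T -` ball (T y) (L * \<rho>) \<inter> space M)"
    proof (rule emeasure_mono)
      show "ball y \<rho> \<subseteq> T -` ball (T y) (L * \<rho>) \<inter> space M"
      proof
        fix x assume x: "x \<in> ball y \<rho>"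
        have "dist (T y) (T x) \<le> L * dist y x" using T by (auto intro: lipschitz_onD)
        also have "\<dots> < L * \<rho>" using x L by simp
        finally show "x \<in> T -` ball (T y) (L * \<rho>) \<inter> space M" by (simp add: M.space_eq_UNIV)
      qed
    qed measurable
    then show ?thesis by (simp add: M.ball_mass_eq N.ball_mass_eq emeasure_distr)
  qed
  then have "M.wolff_term r \<rho> \<le> (\<integral>\<^sup>+y. epow (N.ball_mass (L * \<rho>) (T y)) r \<partial>M)"
    unfolding M.wolff_term_def using r by (intro nn_integral_mono epow_mono) auto
  also have "\<dots> = N.wolff_term r (L * \<rho>)"
    unfolding N.wolff_term_def by (rule nn_integral_distr[symmetric]) measurable
  finally show ?thesis .
qed

text \<open>All constants come from comparing kernels and numerical sequences, before any map or
  measure is introduced; hence they are uniform in both.\<close>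

lemma potential_energy_le_distr:
  fixes \<alpha> q L :: real
  assumes \<alpha>: "\<alpha> > 0" "\<alpha> < real DIM('a::euclidean_space)" and q: "q > 1" and L: "L > 0"
  obtains K where "K > 0" "\<And>(T :: 'a \<Rightarrow> 'a) M. \<lbrakk>L-lipschitz_on UNIV T; locally_finite_measure M;
      locally_finite_measure (distr M borel T)\<rbrakk> \<Longrightarrow>
    (\<integral>\<^sup>+x. epow (locally_finite_measure.potential M \<alpha> x) q \<partial>lborel) \<le>
    ennreal K * (\<integral>\<^sup>+x. epow (locally_finite_measure.potential (distr M borel T) \<alpha> x) q \<partial>lborel)"
proof -
  define s where "s = real DIM('a) - \<alpha>"
  obtain C1 where C1: "C1 > 0" "\<And>z::'a. bessel_kernel_nn \<alpha> z \<le> ennreal C1 * (dyadic_kernel s 1 z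
      + (\<integral>\<^sup>+w. bessel_kernel_nn \<alpha> (z - w) * indicator (ball 0 (1 / 2)) w \<partial>lborel))"
    using bessel_kernel_le_dyadic_kernel[OF \<alpha>] unfolding s_def by blast
  have L4: "4 * L > 0" using L by simp
  obtain C2 where C2: "C2 > 0" "\<And>z::'a. dyadic_kernel s (4 * L) z \<le> ennreal C2 * bessel_kernel_nn \<alpha> z"
    using dyadic_kernel_le_bessel_kernel[OF \<alpha> L4] unfolding s_def by blast
  have \<alpha>2: "\<alpha> / 2 > 0" using \<alpha> by simp
  obtain C \<eta> where C: "C > 0" "\<eta> > 0"
    "\<And>(a :: nat \<Rightarrow> ennreal) n. (\<And>i. a i < top) \<Longrightarrow> epow (\<Sum>i<n. a i) q \<le>
      ennreal C * (\<Sum>i<n. \<Sum>j\<in>{i..<n}. ennreal (2 powr (- \<eta> * real (j - i))) * (epow (a i) q + epow (a j) q)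
        + ennreal (2 powr (\<alpha> / 2 * real (j - i))) * (epow (a i) (q - 1) * a j))"
    by (rule Wolff_pointwise_ennreal[OF q \<alpha>2]) (erule (1) that, blast)
  define \<omega> where "\<omega> = unit_ball_vol (real DIM('a))"
  \<comment> \<open>In this order: from the potential to its dyadic model, the upper Wolff bound for
    the measure, the lower Wolff bound for its image, and from the dyadic model back to the
    potential. The third constant is divided out.\<close>
  define c1 where "c1 = 2 * (2 * C1) powr q"
  define c2 where "c2 = C * \<omega> * (3 / (1 - 2 powr (- min \<eta> (\<alpha> / 2))))"
  define c3 where "c3 = \<omega> * (2 * L) ^ DIM('a)"
  define c4 where "c4 = C2 powr q"
  have \<omega>: "\<omega> > 0" by (simp add: \<omega>_def)
  have c: "c1 > 0" "c2 > 0" "c3 > 0" "c4 > 0"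
    using C C1 C2 L \<omega> \<alpha> powr_less_mono[of "- min \<eta> (\<alpha> / 2)" 0 2]
    by (auto simp: c1_def c2_def c3_def c4_def intro!: mult_pos_pos divide_pos_pos)
  show ?thesis
  proof (rule that[of "c1 * c2 * (1 / c3) * c4"])
    show "c1 * c2 * (1 / c3) * c4 > 0" using c by simp
    fix T :: "'a \<Rightarrow> 'a" and M
    assume T: "L-lipschitz_on UNIV T" and M: "locally_finite_measure M" and N: "locally_finite_measure (distr M borel T)"
    interpret M: locally_finite_measure M by (rule M)
    interpret N: locally_finite_measure "distr M borel T" by (rule N)
    let ?w = "\<lambda>i. ennreal (wolff_weight \<alpha> s (q - 1) i)"
    define E where "E = (\<integral>\<^sup>+x. epow (N.potential \<alpha> x) q \<partial>lborel)"
    define S where "S = (\<Sum>i. ?w i * N.wolff_term (q - 1) (2 * L * 2 powr (- real i)))"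
    have "(\<integral>\<^sup>+x. epow (M.potential \<alpha> x) q \<partial>lborel) \<le> ennreal c1 * (\<integral>\<^sup>+x. epow (M.dyadic_potential s 1 x) q \<partial>lborel)"
      unfolding c1_def by (rule M.nn_integral_epow_potential_le_dyadic[OF \<alpha>(1) C1(1) q C1(2)])
    also have "\<dots> \<le> ennreal c1 * (ennreal c2 * (\<Sum>i. ?w i * M.wolff_term (q - 1) (2 * 2 powr (- real i))))"
      unfolding c2_def \<omega>_def by (intro mult_left_mono M.Wolff_upper[OF q \<alpha>(1) s_def C]) auto
    also have "\<dots> \<le> ennreal c1 * (ennreal c2 * S)"
      unfolding S_def
    proof (intro mult_left_mono suminf_le)
      fix i
      have "M.wolff_term (q - 1) (2 * 2 powr (- real i)) \<le> N.wolff_term (q - 1) (L * (2 * 2 powr (- real i)))"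
        using q by (intro wolff_term_le_distr M N T L) simp
      then show "M.wolff_term (q - 1) (2 * 2 powr (- real i)) \<le> N.wolff_term (q - 1) (2 * L * 2 powr (- real i))"
        by (simp add: mult_ac)
    qed auto
    also have "S = ennreal (1 / c3) * (ennreal c3 * S)"
    proof -
      have "ennreal (1 / c3) * ennreal c3 = 1" using c by (simp flip: ennreal_mult')
      then show ?thesis by (simp flip: mult.assoc)
    qed
    also have "ennreal c1 * (ennreal c2 * (ennreal (1 / c3) * (ennreal c3 * S))) \<le>
        ennreal c1 * (ennreal c2 * (ennreal (1 / c3) * (\<integral>\<^sup>+x. epow (N.dyadic_potential s (4 * L) x) q \<partial>lborel)))"
      unfolding S_def c3_def \<omega>_def by (intro mult_left_mono N.Wolff_lower q L s_def) auto
    also have "\<dots> \<le> ennreal c1 * (ennreal c2 * (ennreal (1 / c3) * (ennreal c4 * E)))"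
    proof (intro mult_left_mono)
      have "(\<integral>\<^sup>+x. epow (N.dyadic_potential s (4 * L) x) q \<partial>lborel) \<le> (\<integral>\<^sup>+x. epow (ennreal C2 * N.potential \<alpha> x) q \<partial>lborel)"
        using q by (intro nn_integral_mono epow_mono N.dyadic_potential_le_potential C2) auto
      also have "\<dots> = ennreal c4 * E"
        unfolding E_def c4_def using q C2(1) by (simp add: epow_mult epow_ennreal nn_integral_cmult)
      finally show "(\<integral>\<^sup>+x. epow (N.dyadic_potential s (4 * L) x) q \<partial>lborel) \<le> ennreal c4 * E" .
    qed auto
    also have "\<dots> = ennreal (c1 * c2 * (1 / c3) * c4) * E"
    proof -
      have nn: "c1 \<ge> 0" "c1 * c2 \<ge> 0" "c1 * c2 * (1 / c3) \<ge> 0" using c by simp_all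
      show ?thesis
        unfolding ennreal_mult'[OF nn(3)] ennreal_mult'[OF nn(2)] ennreal_mult'[OF nn(1)] by (simp only: mult.assoc)
    qed
    finally show "(\<integral>\<^sup>+x. epow (M.potential \<alpha> x) q \<partial>lborel) \<le> ennreal (c1 * c2 * (1 / c3) * c4) * (\<integral>\<^sup>+x. epow (N.potential \<alpha> x) q \<partial>lborel)"
      by (simp only: E_def)
  qed
qed

section \<open>Duality on test functions and conclusion\<close>

lemma bessel_norm_nonneg:
  "\<alpha> > 0 \<Longrightarrow> p \<ge> 1 \<Longrightarrow> \<phi> \<in> test_functions \<Longrightarrow> bessel_norm \<alpha> p \<phi> \<ge> 0"
  by (simp add: bessel_norm_test_function Lp_norm_nonneg)

lemma bessel_norm_cmult:
  fixes \<phi> :: "'a::euclidean_space \<Rightarrow> real"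
  assumes \<alpha>: "\<alpha> > 0" and p: "p \<ge> 1" and \<phi>: "\<phi> \<in> test_functions"
  shows "bessel_norm \<alpha> p (\<lambda>x. c * \<phi> x) = \<bar>c\<bar> * bessel_norm \<alpha> p \<phi>"
proof -
  have "(one_minus_laplacian ^^ k) (\<lambda>x. c * \<phi> x) = (\<lambda>x. c * (one_minus_laplacian ^^ k) \<phi> x)" for k
    using oml_pow_linear[OF smooth_const[of 0] test_functions_smooth[OF \<phi>], of k c] by (simp add: oml_pow_zero)
  then have "bessel_density \<alpha> (\<lambda>x. c * \<phi> x) = (\<lambda>x. c * bessel_density \<alpha> \<phi> x)"
    by (simp add: bessel_density_def fun_conv_def fun_eq_iff mult.left_commute)
  moreover have "Lp_norm p (\<lambda>x. c * f x) = \<bar>c\<bar> * Lp_norm p f" for f :: "'a \<Rightarrow> real"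
    using p by (simp add: Lp_norm_def abs_mult powr_mult powr_powr)
  ultimately show ?thesis
    by (simp add: bessel_norm_test_function[OF \<alpha> p] \<phi> test_functions_cmult)
qed

text \<open>The easy direction of the duality: \<open>\<phi>\<close> is at every point the potential
  of its density, so its modulus is at most the potential of the modulus of the density. Tonelli
  moves the kernel onto the measure, and Hoelder's inequality separates the factors.\<close>

lemma (in locally_finite_measure) abs_integral_test_function_le:
  assumes \<alpha>: "\<alpha> > 0" and p: "p > 1" and q: "q > 1" "1 / p + 1 / q = 1" and \<phi>: "\<phi> \<in> test_functions"
  shows "ennreal \<bar>LINT x|M. \<phi> x\<bar> \<le>
    ennreal (bessel_norm \<alpha> p \<phi>) * epow (\<integral>\<^sup>+x. epow (potential \<alpha> x) q \<partial>lborel) (1 / q)"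
proof -
  define f where "f = bessel_density \<alpha> \<phi>"
  have bf: "bdint f" unfolding f_def by (rule bdint_bessel_density[OF \<alpha> \<phi>])
  note [measurable] = bdint_measurable[OF bf]
  obtain B where B: "B > 0" "\<And>x. \<bar>f x\<bar> \<le> B" by (rule bdint_boundedE[OF bf]) (rule that)
  have "ennreal \<bar>LINT x|M. \<phi> x\<bar> \<le> ennreal (LINT x|M. \<bar>\<phi> x\<bar>)"
    by (intro ennreal_leI integral_abs_bound)
  also have "\<dots> = (\<integral>\<^sup>+x. ennreal \<bar>\<phi> x\<bar> \<partial>M)"
    by (intro nn_integral_eq_integral[symmetric] integrable_abs integrable_test_function \<phi>) auto
  also have "\<dots> \<le> (\<integral>\<^sup>+x. ennreal (fun_conv (bessel_kernel_real \<alpha>) (\<lambda>x. \<bar>f x\<bar>) x) \<partial>M)"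
  proof (intro nn_integral_mono ennreal_leI)
    fix x
    have "\<bar>\<phi> x\<bar> = \<bar>fun_conv (bessel_kernel_real \<alpha>) f x\<bar>" unfolding f_def fun_conv_bessel_density[OF \<alpha> \<phi>] ..
    also have "\<dots> \<le> (LINT y|lborel. \<bar>bessel_kernel_real \<alpha> (x - y) * f y\<bar>)" unfolding fun_conv_def by (rule integral_abs_bound)
    also have "\<dots> = fun_conv (bessel_kernel_real \<alpha>) (\<lambda>x. \<bar>f x\<bar>) x"
      by (simp add: fun_conv_def abs_mult bessel_kernel_real_nonneg)
    finally show "\<bar>\<phi> x\<bar> \<le> fun_conv (bessel_kernel_real \<alpha>) (\<lambda>x. \<bar>f x\<bar>) x" .
  qed
  also have "\<dots> = (\<integral>\<^sup>+y. ennreal \<bar>f y\<bar> * potential \<alpha> y \<partial>lborel)"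
    by (rule nn_integral_conv_eq_potential[OF \<alpha>]) (use B in auto)
  also have "\<dots> \<le> epow (\<integral>\<^sup>+y. epow (ennreal \<bar>f y\<bar>) p \<partial>lborel) (1 / p) * epow (\<integral>\<^sup>+y. epow (potential \<alpha> y) q \<partial>lborel) (1 / q)"
    by (rule nn_integral_Holder[OF p q]) measurable
  also have "epow (\<integral>\<^sup>+y. epow (ennreal \<bar>f y\<bar>) p \<partial>lborel) (1 / p) = ennreal (bessel_norm \<alpha> p \<phi>)"
    using p Lp_norm_nn[OF bdint_Lp_space[OF bf], of p] by (simp add: bessel_norm_test_function[OF \<alpha> _ \<phi>] f_def)
  finally show ?thesis .
qed

text \<open>The supremum over the unit ball is finite and is itself an admissible constant, by
  homogeneity. This turns membership in the dual, where some constant exists, into a bound by the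
  dual norm.\<close>

lemma in_bessel_dual_bound:
  fixes \<nu> :: "'a::euclidean_space measure"
  assumes \<alpha>: "\<alpha> > 0" and p: "p > 1" and \<nu>: "in_bessel_dual \<alpha> p \<nu>"
  obtains A where "A \<ge> 0" "bessel_dual_norm \<alpha> p \<nu> = ennreal A"
    "\<And>\<phi>. \<phi> \<in> test_functions \<Longrightarrow> \<bar>LINT x|\<nu>. \<phi> x\<bar> \<le> A * bessel_norm \<alpha> p \<phi>"
proof -
  have p1: "p \<ge> 1" using p by simp
  obtain C0 where C0: "\<And>\<phi>. \<phi> \<in> test_functions \<Longrightarrow> \<bar>LINT x|\<nu>. \<phi> x\<bar> \<le> C0 * bessel_norm \<alpha> p \<phi>"
    using \<nu> by (auto simp: in_bessel_dual_def)
  let ?S = "SUP \<phi>\<in>{\<phi> \<in> test_functions. bessel_norm \<alpha> p \<phi> \<le> 1}. ennreal \<bar>LINT x|\<nu>. \<phi> x\<bar>"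
  have eq: "bessel_dual_norm \<alpha> p \<nu> = ?S" using \<nu> by (simp add: bessel_dual_norm_def)
  \<comment> \<open>The constant in the definition of membership carries no sign condition, hence
    the maximum with 0.\<close>
  have "?S \<le> ennreal (max C0 0)"
  proof (rule SUP_least, rule ennreal_leI)
    fix \<phi> :: "'a \<Rightarrow> real" assume "\<phi> \<in> {\<phi> \<in> test_functions. bessel_norm \<alpha> p \<phi> \<le> 1}"
    then have \<phi>: "\<phi> \<in> test_functions" "bessel_norm \<alpha> p \<phi> \<le> 1" by auto
    have n0: "bessel_norm \<alpha> p \<phi> \<ge> 0" by (rule bessel_norm_nonneg[OF \<alpha> p1 \<phi>(1)])
    have "C0 * bessel_norm \<alpha> p \<phi> \<le> max C0 0 * bessel_norm \<alpha> p \<phi>" by (intro mult_right_mono n0) simp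
    also have "\<dots> \<le> max C0 0 * 1" by (intro mult_left_mono \<phi>) simp
    finally show "\<bar>LINT x|\<nu>. \<phi> x\<bar> \<le> max C0 0" using C0[OF \<phi>(1)] by linarith
  qed
  then have "?S < top" by (rule le_less_trans) simp
  then obtain A where A: "?S = ennreal A" "A \<ge> 0" by (cases ?S) auto
  show ?thesis
  proof (rule that[OF A(2)])
    show "bessel_dual_norm \<alpha> p \<nu> = ennreal A" using eq A by simp
    fix \<phi> :: "'a \<Rightarrow> real" assume \<phi>: "\<phi> \<in> test_functions"
    define N where "N = bessel_norm \<alpha> p \<phi>"
    have N0: "N \<ge> 0" unfolding N_def by (rule bessel_norm_nonneg[OF \<alpha> p1 \<phi>])
    show "\<bar>LINT x|\<nu>. \<phi> x\<bar> \<le> A * bessel_norm \<alpha> p \<phi>"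
    proof (cases "N = 0")
      \<comment> \<open>A test function of norm 0 cannot be normalised; for it the original bound
        with \<open>C0\<close> already makes the integral vanish.\<close>
      case True then show ?thesis using C0[OF \<phi>] by (simp add: N_def)
    next
      case False
      then have N: "N > 0" using N0 by simp
      define \<psi> where "\<psi> = (\<lambda>x. (1 / N) * \<phi> x)"
      have \<psi>: "\<psi> \<in> test_functions" unfolding \<psi>_def by (rule test_functions_cmult[OF \<phi>])
      have "bessel_norm \<alpha> p \<psi> = 1" unfolding \<psi>_def bessel_norm_cmult[OF \<alpha> p1 \<phi>] N_def[symmetric] using N by simp
      then have "ennreal \<bar>LINT x|\<nu>. \<psi> x\<bar> \<le> ?S" using \<psi> by (intro SUP_upper) simp
      then have "\<bar>LINT x|\<nu>. \<psi> x\<bar> \<le> A" unfolding A(1) using A(2) by simp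
      moreover have "(LINT x|\<nu>. \<psi> x) = (1 / N) * (LINT x|\<nu>. \<phi> x)" unfolding \<psi>_def by (rule integral_mult_right_zero)
      ultimately show ?thesis using N unfolding N_def[symmetric] by (simp add: abs_mult field_simps)
    qed
  qed
qed

theorem theorem2p4:
  fixes \<alpha> p L :: real
  assumes "\<alpha> > 0" and "1 < p" and "p \<le> real DIM('a::euclidean_space) / \<alpha>" and "L > 0"
  shows "\<exists>C::real. C > 0 \<and>
    (\<forall>(T :: 'a \<Rightarrow> 'a) (\<mu> :: 'a measure). L-lipschitz_on UNIV T \<longrightarrow> \<mu> \<in> radon_measures \<longrightarrow>
      bessel_dual_norm \<alpha> p \<mu> \<le> ennreal C * bessel_dual_norm \<alpha> p (distr \<mu> borel T))"
proof -
  note \<alpha> = assms(1) and p = assms(2) and L = assms(4)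
  define q where "q = p / (p - 1)"
  have q: "q > 1" "1 / p + 1 / q = 1" using p by (auto simp: q_def field_simps)
  \<comment> \<open>The upper bound on \<open>p\<close> enters here: together with
    \<open>1 < p\<close> it gives \<alpha> < d, the range in which the kernel comparisons
    hold.\<close>
  have "\<alpha> * 1 < \<alpha> * p" using \<alpha> p by simp
  also have "\<dots> \<le> real DIM('a)" using assms(3) \<alpha> by (simp add: field_simps)
  finally have \<alpha>d: "\<alpha> < real DIM('a)" by simp
  obtain K where K: "K > 0" "\<And>(T :: 'a \<Rightarrow> 'a) M. \<lbrakk>L-lipschitz_on UNIV T; locally_finite_measure M;
      locally_finite_measure (distr M borel T)\<rbrakk> \<Longrightarrow>
    (\<integral>\<^sup>+x. epow (locally_finite_measure.potential M \<alpha> x) q \<partial>lborel) \<le>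
    ennreal K * (\<integral>\<^sup>+x. epow (locally_finite_measure.potential (distr M borel T) \<alpha> x) q \<partial>lborel)"
    by (rule potential_energy_le_distr[OF \<alpha> \<alpha>d q(1) L]) (rule that)
  define C where "C = K powr (1 / q)"
  have C: "C > 0" using K by (simp add: C_def)
  have "bessel_dual_norm \<alpha> p \<mu> \<le> ennreal C * bessel_dual_norm \<alpha> p (distr \<mu> borel T)"
    if T: "L-lipschitz_on UNIV T" and \<mu>: "\<mu> \<in> radon_measures" for T :: "'a \<Rightarrow> 'a" and \<mu>
  \<comment> \<open>If the image is not in the dual, including the case that it is not locally
    finite, the right side is a positive constant times infinity and there is nothing to
    prove.\<close>
  proof (cases "in_bessel_dual \<alpha> p (distr \<mu> borel T)")
    case False
    then have "bessel_dual_norm \<alpha> p (distr \<mu> borel T) = top" by (simp add: bessel_dual_norm_def)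
    then show ?thesis using C by (simp add: ennreal_mult_top)
  next
    case True
    interpret M: locally_finite_measure \<mu>
      using \<mu> by unfold_locales (auto simp: radon_measures_def)
    \<comment> \<open>Finiteness on compact sets is not automatic for the pushforward; it is part of
      membership in the dual.\<close>
    interpret N: locally_finite_measure "distr \<mu> borel T"
      using True by unfold_locales (auto simp: in_bessel_dual_def)
    obtain A where A: "A \<ge> 0" "bessel_dual_norm \<alpha> p (distr \<mu> borel T) = ennreal A"
      "\<And>\<phi>. \<phi> \<in> test_functions \<Longrightarrow> \<bar>LINT x|distr \<mu> borel T. \<phi> x\<bar> \<le> A * bessel_norm \<alpha> p \<phi>"
      by (rule in_bessel_dual_bound[OF \<alpha> p True]) (rule that)
    have "(\<integral>\<^sup>+x. epow (M.potential \<alpha> x) q \<partial>lborel) \<le> ennreal K * (\<integral>\<^sup>+x. epow (N.potential \<alpha> x) q \<partial>lborel)"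
      by (intro K T M.locally_finite_measure_axioms N.locally_finite_measure_axioms)
    also have "\<dots> \<le> ennreal K * ennreal (A powr q)"
      by (intro mult_left_mono N.nn_integral_epow_potential_le[OF \<alpha> p A(1,3) q(2,1)]) auto
    finally have "epow (\<integral>\<^sup>+x. epow (M.potential \<alpha> x) q \<partial>lborel) (1 / q) \<le> epow (ennreal K * ennreal (A powr q)) (1 / q)"
      using q by (intro epow_mono) auto
    also have "\<dots> = ennreal (C * A)"
      using q K(1) A(1) by (simp add: epow_mult epow_ennreal powr_powr C_def ennreal_mult)
    finally have E: "epow (\<integral>\<^sup>+x. epow (M.potential \<alpha> x) q \<partial>lborel) (1 / q) \<le> ennreal (C * A)" .
    have bound: "\<bar>LINT x|\<mu>. \<phi> x\<bar> \<le> C * A * bessel_norm \<alpha> p \<phi>" if \<phi>: "\<phi> \<in> test_functions" for \<phi>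
    proof -
      have n0: "bessel_norm \<alpha> p \<phi> \<ge> 0" using p by (intro bessel_norm_nonneg \<alpha> \<phi>) simp
      have "ennreal \<bar>LINT x|\<mu>. \<phi> x\<bar> \<le> ennreal (bessel_norm \<alpha> p \<phi>) * epow (\<integral>\<^sup>+x. epow (M.potential \<alpha> x) q \<partial>lborel) (1 / q)"
        by (rule M.abs_integral_test_function_le[OF \<alpha> p q \<phi>])
      also have "\<dots> \<le> ennreal (bessel_norm \<alpha> p \<phi>) * ennreal (C * A)" by (intro mult_left_mono E) simp
      also have "\<dots> = ennreal (C * A * bessel_norm \<alpha> p \<phi>)"
        using n0 C A(1) by (simp add: mult.commute flip: ennreal_mult)
      finally show ?thesis using n0 C A(1) by simp
    qed
    \<comment> \<open>Membership of \<open>\<mu>\<close> is a conclusion here, not an assumption.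
      Only after it is established does its dual norm unfold to the supremum.\<close>
    then have dual: "in_bessel_dual \<alpha> p \<mu>"
      using M.finite_on_compacts unfolding in_bessel_dual_def by blast
    then have "bessel_dual_norm \<alpha> p \<mu> = (SUP \<phi>\<in>{\<phi> \<in> test_functions. bessel_norm \<alpha> p \<phi> \<le> 1}. ennreal \<bar>LINT x|\<mu>. \<phi> x\<bar>)"
      by (simp add: bessel_dual_norm_def)
    also have "\<dots> \<le> ennreal (C * A)"
    proof (rule SUP_least, rule ennreal_leI)
      fix \<phi> :: "'a \<Rightarrow> real" assume "\<phi> \<in> {\<phi> \<in> test_functions. bessel_norm \<alpha> p \<phi> \<le> 1}"
      then have \<phi>: "\<phi> \<in> test_functions" "bessel_norm \<alpha> p \<phi> \<le> 1" by auto
      have "C * A * bessel_norm \<alpha> p \<phi> \<le> C * A * 1" using C A(1) by (intro mult_left_mono \<phi>) auto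
      then show "\<bar>LINT x|\<mu>. \<phi> x\<bar> \<le> C * A" using bound[OF \<phi>(1)] by linarith
    qed
    also have "\<dots> = ennreal C * bessel_dual_norm \<alpha> p (distr \<mu> borel T)"
      using C A by (simp add: ennreal_mult)
    finally show ?thesis .
  qed
  with C show ?thesis by blast
qed

end
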